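(* Let $F$ be a non-abelian free group (of arbitrary cardinality), let $\varphi:F\to F$ be an injective endomorphism, let $F_\varphi$ be the ascending HNN extension of $F$ corresponding to $\varphi$, and let $K$ be a field. Then the following are equivalent: (1) The group ring $KF_{\varphi}$ is primitive. (2) $|K|\leq |F|$ or $F_{\varphi}$ is not virtually the direct product $F\times \mathbb{Z}$. (3) $|K|\leq |F|$ or $\triangle(F_\varphi)=1$. In particular, if $F_{\varphi}$ is a strictly ascending HNN extension, that is, $\varphi(F)\ne F$, then $KF_{\varphi}$ is primitive for any field $K$.
   Context: For a free group $F$ and an injective endomorphism $\varphi$ of $F$, the ascending HNN extension of $F$ corresponding to $\varphi$ is the group $F_{\varphi}=\langle F, t \mid t^{-1}ft=\varphi(f)\ (f\in F)\rangle$. A ring is (right) primitive if it has a faithful irreducible (right) module. For groups $G$ and $H$, $G$ is virtually $H$ if $H$ is isomorphic to a subgroup $N$ of $G$ of finite index. For a group $G$, $\triangle(G)=\{g\in G \mid [G:C_G(g)]<\infty\}$ is the FC center of $G$, where $C_G(g)$ is the centralizer of $g$ in $G$. $|S|$ denotes cardinality. *)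

theory Defs
  imports "HOL-Algebra.Module" "HOL-Algebra.Elementary_Groups" "HOL-Library.Equipollence"
begin

section \<open>Groups given by generators and relations\<close>

text \<open>A letter \<open>(x, True)\<close> stands for the generator \<open>x\<close> and \<open>(x, False)\<close> for its inverse.\<close>

type_synonym 'x word = "('x \<times> bool) list"

definition words :: "'x set \<Rightarrow> 'x word set" where
  "words X = lists (X \<times> UNIV)"

text \<open>The least congruence on the words over \<open>X\<close> that cancels adjacent inverse letters and
  identifies the two sides of every relation \<open>u = v\<close> with \<open>(u, v) \<in> R\<close>.\<close>

inductive_set word_cong :: "'x set \<Rightarrow> ('x word \<times> 'x word) set \<Rightarrow> ('x word \<times> 'x word) set"
  for X R where
  refl: "u \<in> words X \<Longrightarrow> (u, u) \<in> word_cong X R"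
| sym: "(u, v) \<in> word_cong X R \<Longrightarrow> (v, u) \<in> word_cong X R"
| trans: "\<lbrakk>(u, v) \<in> word_cong X R; (v, w) \<in> word_cong X R\<rbrakk> \<Longrightarrow> (u, w) \<in> word_cong X R"
| append: "\<lbrakk>(u, v) \<in> word_cong X R; (u', v') \<in> word_cong X R\<rbrakk>
            \<Longrightarrow> (u @ u', v @ v') \<in> word_cong X R"
| cancel: "x \<in> X \<Longrightarrow> ([(x, b), (x, \<not> b)], []) \<in> word_cong X R"
| rel: "\<lbrakk>(u, v) \<in> R; u \<in> words X; v \<in> words X\<rbrakk> \<Longrightarrow> (u, v) \<in> word_cong X R"

definition presented_group :: "'x set \<Rightarrow> ('x word \<times> 'x word) set \<Rightarrow> 'x word set monoid" where
  "presented_group X R =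
     \<lparr>carrier = words X // word_cong X R,
      mult = (\<lambda>A B. \<Union>u\<in>A. \<Union>v\<in>B. word_cong X R `` {u @ v}),
      one = word_cong X R `` {[]}\<rparr>"

lemma word_cong_in_words:
  "(u, v) \<in> word_cong X R \<Longrightarrow> u \<in> words X \<and> v \<in> words X"
  by (induction rule: word_cong.induct) (auto simp: words_def)

lemma equiv_word_cong: "equiv (words X) (word_cong X R)"
proof (rule equivI)
  show "word_cong X R \<subseteq> words X \<times> words X"
    using word_cong_in_words by fast
  show "refl_on (words X) (word_cong X R)"
    by (auto simp: refl_on_def intro: word_cong.refl)
  show "sym (word_cong X R)"
    by (rule symI) (rule word_cong.sym)
  show "trans (word_cong X R)"
    by (rule transI) (rule word_cong.trans)
qed

lemma presented_group_mult:
  assumes "u \<in> words X" "v \<in> words X"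
  shows "word_cong X R `` {u} \<otimes>\<^bsub>presented_group X R\<^esub> word_cong X R `` {v} = word_cong X R `` {u @ v}"
proof -
  have "word_cong X R `` {u' @ v'} = word_cong X R `` {u @ v}"
    if "(u, u') \<in> word_cong X R" "(v, v') \<in> word_cong X R" for u' v'
    by (rule equiv_class_eq[OF equiv_word_cong word_cong.sym[OF word_cong.append[OF that]]])
  hence "(\<Union>u'\<in>word_cong X R `` {u}. \<Union>v'\<in>word_cong X R `` {v}. word_cong X R `` {u' @ v'}) =
      (\<Union>u'\<in>word_cong X R `` {u}. \<Union>v'\<in>word_cong X R `` {v}. word_cong X R `` {u @ v})"
    by (intro SUP_cong HOL.refl) auto
  moreover have "u \<in> word_cong X R `` {u}" "v \<in> word_cong X R `` {v}"
    using assms by (auto intro: word_cong.refl)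
  ultimately show ?thesis
    unfolding presented_group_def by (simp only: monoid.simps) blast
qed

lemma word_cong_inverse:
  assumes "u \<in> words X"
  shows "\<exists>v\<in>words X. (v @ u, []) \<in> word_cong X R"
  using assms
proof (induction u)
  case Nil
  show ?case by (rule bexI[of _ "[]"]) (auto simp: words_def intro!: word_cong.refl)
next
  case (Cons l u)
  obtain x b where l: "l = (x, b)" by (cases l)
  have x: "x \<in> X" and u: "u \<in> words X" using Cons.prems l by (auto simp: words_def)
  obtain v where v: "v \<in> words X" "(v @ u, []) \<in> word_cong X R" using Cons.IH[OF u] by blast
  have "([(x, \<not> b), (x, \<not> \<not> b)] @ u, [] @ u) \<in> word_cong X R"
    by (rule word_cong.append[OF word_cong.cancel[OF x] word_cong.refl[OF u]])
  hence "(v @ ([(x, \<not> b), (x, \<not> \<not> b)] @ u), v @ ([] @ u)) \<in> word_cong X R"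
    by (rule word_cong.append[OF word_cong.refl[OF v(1)]])
  hence "((v @ [(x, \<not> b)]) @ l # u, v @ u) \<in> word_cong X R"
    by (simp add: l)
  hence "((v @ [(x, \<not> b)]) @ l # u, []) \<in> word_cong X R"
    using v(2) by (rule word_cong.trans)
  moreover have "v @ [(x, \<not> b)] \<in> words X" using v x by (auto simp: words_def)
  ultimately show ?case by blast
qed

lemma group_presented_group: "group (presented_group X R)"
proof (rule groupI)
  let ?G = "presented_group X R"
  let ?c = "\<lambda>u. word_cong X R `` {u}"
  have car: "carrier ?G = ?c ` words X"
    by (auto simp: presented_group_def quotient_def)
  have one: "\<one>\<^bsub>?G\<^esub> = ?c []" by (simp add: presented_group_def)
  have nil: "[] \<in> words X" by (simp add: words_def)
  have app: "u @ v \<in> words X" if "u \<in> words X" "v \<in> words X" for u v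
    using that by (simp add: words_def)
  show "\<one>\<^bsub>?G\<^esub> \<in> carrier ?G" using car one nil by auto
  show "x \<otimes>\<^bsub>?G\<^esub> y \<in> carrier ?G" if "x \<in> carrier ?G" "y \<in> carrier ?G" for x y
    using that app by (auto simp: car presented_group_mult)
  show "x \<otimes>\<^bsub>?G\<^esub> y \<otimes>\<^bsub>?G\<^esub> z = x \<otimes>\<^bsub>?G\<^esub> (y \<otimes>\<^bsub>?G\<^esub> z)"
    if "x \<in> carrier ?G" "y \<in> carrier ?G" "z \<in> carrier ?G" for x y z
    using that app by (auto simp: car presented_group_mult)
  show "\<one>\<^bsub>?G\<^esub> \<otimes>\<^bsub>?G\<^esub> x = x" if "x \<in> carrier ?G" for x
    using that nil by (auto simp: car one presented_group_mult)
  show "\<exists>y\<in>carrier ?G. y \<otimes>\<^bsub>?G\<^esub> x = \<one>\<^bsub>?G\<^esub>" if x: "x \<in> carrier ?G" for x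
  proof -
    obtain u where u: "u \<in> words X" "x = ?c u" using x car by auto
    obtain v where v: "v \<in> words X" "(v @ u, []) \<in> word_cong X R"
      using word_cong_inverse[OF u(1)] by blast
    have "?c v \<otimes>\<^bsub>?G\<^esub> x = \<one>\<^bsub>?G\<^esub>"
      using u v equiv_class_eq[OF equiv_word_cong v(2)] by (simp add: presented_group_mult one)
    thus ?thesis using v car by auto
  qed
qed

section \<open>Free groups and ascending HNN extensions\<close>

text \<open>A basis embeds into the group, so it is no restriction to take the alphabet \<open>X\<close> from the
  element type of the group.\<close>

definition free_group :: "('a, 'm) monoid_scheme \<Rightarrow> bool" where
  "free_group F \<longleftrightarrow> group F \<and> (\<exists>X :: 'a set. F \<cong> presented_group X {})"

datatype 'a hnn_gen = Base 'a | Stable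

text \<open>\<open>\<langle>F, t | t\<^sup>-\<^sup>1 f t = \<phi>(f) (f \<in> F)\<rangle>\<close>: the generators are the elements of \<open>F\<close> and the stable
  letter \<open>t\<close>; the first set of relations is the multiplication table of \<open>F\<close>.\<close>

definition ascending_HNN :: "('a, 'm) monoid_scheme \<Rightarrow> ('a \<Rightarrow> 'a) \<Rightarrow> 'a hnn_gen word set monoid" where
  "ascending_HNN F \<phi> =
     presented_group (insert Stable (Base ` carrier F))
       ({([(Base f, True), (Base g, True)], [(Base (f \<otimes>\<^bsub>F\<^esub> g), True)]) | f g.
            f \<in> carrier F \<and> g \<in> carrier F} \<union>
        {([(Stable, False), (Base f, True), (Stable, True)], [(Base (\<phi> f), True)]) | f.
            f \<in> carrier F})"

section \<open>Finite index and the FC center\<close>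

definition virtually :: "('g, 'm) monoid_scheme \<Rightarrow> ('h, 'n) monoid_scheme \<Rightarrow> bool" where
  "virtually G H \<longleftrightarrow>
     (\<exists>N. subgroup N G \<and> finite (rcosets\<^bsub>G\<^esub> N) \<and> H \<cong> G\<lparr>carrier := N\<rparr>)"

definition centralizer :: "('g, 'm) monoid_scheme \<Rightarrow> 'g \<Rightarrow> 'g set" where
  "centralizer G g = {x \<in> carrier G. x \<otimes>\<^bsub>G\<^esub> g = g \<otimes>\<^bsub>G\<^esub> x}"

definition FC_center :: "('g, 'm) monoid_scheme \<Rightarrow> 'g set" where
  "FC_center G = {g \<in> carrier G. finite (rcosets\<^bsub>G\<^esub> (centralizer G g))}"

section \<open>Group rings and primitivity\<close>

text \<open>The element \<open>\<Sum>x. a x \<cdot> x\<close> of the group ring is its coefficient function, which vanishes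
  outside \<open>carrier G\<close>.\<close>

definition group_ring :: "('k, 'm) ring_scheme \<Rightarrow> ('g, 'n) monoid_scheme \<Rightarrow> ('g \<Rightarrow> 'k) ring" where
  "group_ring K G =
     \<lparr>carrier = {a. (\<forall>x. a x \<in> carrier K) \<and> finite {x. a x \<noteq> \<zero>\<^bsub>K\<^esub>} \<and> {x. a x \<noteq> \<zero>\<^bsub>K\<^esub>} \<subseteq> carrier G},
      mult = (\<lambda>a b z. finsum K (\<lambda>(x, y). a x \<otimes>\<^bsub>K\<^esub> b y)
                {(x, y). a x \<noteq> \<zero>\<^bsub>K\<^esub> \<and> b y \<noteq> \<zero>\<^bsub>K\<^esub> \<and> x \<otimes>\<^bsub>G\<^esub> y = z}),
      one = (\<lambda>x. if x = \<one>\<^bsub>G\<^esub> then \<one>\<^bsub>K\<^esub> else \<zero>\<^bsub>K\<^esub>),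
      zero = (\<lambda>x. \<zero>\<^bsub>K\<^esub>),
      add = (\<lambda>a b x. a x \<oplus>\<^bsub>K\<^esub> b x)\<rparr>"

text \<open>Unital right modules over a not necessarily commutative ring. The scalar is still written on
  the left, so \<open>r \<odot>\<^bsub>M\<^esub> x\<close> is what is usually written \<open>x r\<close>; note the order in
  \<open>act_assoc\<close>.\<close>

locale right_module = R?: ring R + M?: abelian_group M
  for R :: "('r, 'n) ring_scheme" (structure) and M :: "('r, 'm, 'p) module_scheme" (structure) +
  assumes act_closed: "\<lbrakk>r \<in> carrier R; x \<in> carrier M\<rbrakk> \<Longrightarrow> r \<odot>\<^bsub>M\<^esub> x \<in> carrier M"
    and act_add_scalar: "\<lbrakk>r \<in> carrier R; s \<in> carrier R; x \<in> carrier M\<rbrakk> \<Longrightarrow>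
      (r \<oplus>\<^bsub>R\<^esub> s) \<odot>\<^bsub>M\<^esub> x = r \<odot>\<^bsub>M\<^esub> x \<oplus>\<^bsub>M\<^esub> s \<odot>\<^bsub>M\<^esub> x"
    and act_add: "\<lbrakk>r \<in> carrier R; x \<in> carrier M; y \<in> carrier M\<rbrakk> \<Longrightarrow>
      r \<odot>\<^bsub>M\<^esub> (x \<oplus>\<^bsub>M\<^esub> y) = r \<odot>\<^bsub>M\<^esub> x \<oplus>\<^bsub>M\<^esub> r \<odot>\<^bsub>M\<^esub> y"
    and act_assoc: "\<lbrakk>r \<in> carrier R; s \<in> carrier R; x \<in> carrier M\<rbrakk> \<Longrightarrow>
      (r \<otimes>\<^bsub>R\<^esub> s) \<odot>\<^bsub>M\<^esub> x = s \<odot>\<^bsub>M\<^esub> (r \<odot>\<^bsub>M\<^esub> x)"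
    and act_one: "x \<in> carrier M \<Longrightarrow> \<one>\<^bsub>R\<^esub> \<odot>\<^bsub>M\<^esub> x = x"

definition irreducible_right_module ::
  "('r, 'n) ring_scheme \<Rightarrow> ('r, 'm, 'p) module_scheme \<Rightarrow> bool" where
  "irreducible_right_module R M \<longleftrightarrow>
     right_module R M \<and> carrier M \<noteq> {\<zero>\<^bsub>M\<^esub>} \<and>
     (\<forall>N. submodule N R M \<longrightarrow> N = {\<zero>\<^bsub>M\<^esub>} \<or> N = carrier M)"

definition faithful_right_module ::
  "('r, 'n) ring_scheme \<Rightarrow> ('r, 'm, 'p) module_scheme \<Rightarrow> bool" where
  "faithful_right_module R M \<longleftrightarrow>
     right_module R M \<and>
     (\<forall>r\<in>carrier R. (\<forall>x\<in>carrier M. r \<odot>\<^bsub>M\<^esub> x = \<zero>\<^bsub>M\<^esub>) \<longrightarrow> r = \<zero>\<^bsub>R\<^esub>)"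

text \<open>An irreducible module is a quotient of the ring by a right ideal, so modules whose elements are
  sets of ring elements suffice; \<open>primitive_ringI\<close> below shows that the element type does
  not matter.\<close>

definition primitive_ring :: "('r, 'n) ring_scheme \<Rightarrow> bool" where
  "primitive_ring R \<longleftrightarrow>
     (\<exists>M :: ('r, 'r set) module. faithful_right_module R M \<and> irreducible_right_module R M)"

lemma right_module_transfer:
  fixes M :: "('r, 'm) module" and \<psi> :: "'m \<Rightarrow> 'n"
  assumes M: "right_module R M" and inj: "inj_on \<psi> (carrier M)"
  defines "\<gamma> \<equiv> inv_into (carrier M) \<psi>"
  defines "N \<equiv> \<lparr>carrier = \<psi> ` carrier M, monoid.mult = undefined, one = undefined, zero = \<psi> \<zero>\<^bsub>M\<^esub>,
              add = (\<lambda>a b. \<psi> (\<gamma> a \<oplus>\<^bsub>M\<^esub> \<gamma> b)), smult = (\<lambda>r a. \<psi> (r \<odot>\<^bsub>M\<^esub> \<gamma> a))\<rparr>"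
  shows "right_module R N"
    and "faithful_right_module R M \<Longrightarrow> faithful_right_module R N"
    and "irreducible_right_module R M \<Longrightarrow> irreducible_right_module R N"
proof -
  interpret M: right_module R M by fact
  have \<gamma>[simp]: "\<gamma> (\<psi> x) = x" if "x \<in> carrier M" for x
    using that inj by (simp add: \<gamma>_def)
  have Nc: "carrier N = \<psi> ` carrier M" and Nz: "\<zero>\<^bsub>N\<^esub> = \<psi> \<zero>\<^bsub>M\<^esub>"
    by (simp_all add: N_def)
  have Na: "\<psi> x \<oplus>\<^bsub>N\<^esub> \<psi> y = \<psi> (x \<oplus>\<^bsub>M\<^esub> y)" if "x \<in> carrier M" "y \<in> carrier M" for x y
    using that by (simp add: N_def)
  have Ns: "r \<odot>\<^bsub>N\<^esub> \<psi> x = \<psi> (r \<odot>\<^bsub>M\<^esub> x)" if "x \<in> carrier M" for x r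
    using that by (simp add: N_def)
  have abN: "abelian_group N"
  proof (rule abelian_groupI)
    fix x assume "x \<in> carrier N"
    then obtain x' where x': "x' \<in> carrier M" "x = \<psi> x'" using Nc by auto
    show "\<exists>y\<in>carrier N. y \<oplus>\<^bsub>N\<^esub> x = \<zero>\<^bsub>N\<^esub>"
      by (rule bexI[of _ "\<psi> (\<ominus>\<^bsub>M\<^esub> x')"]) (use x' in \<open>auto simp: Nc Na Nz M.M.l_neg\<close>)
  qed (auto simp: Nc Na Nz M.M.a_ac)
  show N: "right_module R N"
    by (intro right_module.intro right_module_axioms.intro M.R.ring_axioms abN)
       (auto simp: Nc Na Ns M.act_closed M.act_add M.act_add_scalar M.act_assoc M.act_one)
  have inj': "\<psi> x = \<psi> y \<longleftrightarrow> x = y" if "x \<in> carrier M" "y \<in> carrier M" for x y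
    using inj that by (auto dest: inj_onD)
  show "faithful_right_module R N" if "faithful_right_module R M"
    using that N unfolding faithful_right_module_def
    by (auto simp: Nc Nz Ns inj' M.act_closed)
  show "irreducible_right_module R N" if irr: "irreducible_right_module R M"
    unfolding irreducible_right_module_def
  proof (intro conjI allI impI N)
    show "carrier N \<noteq> {\<zero>\<^bsub>N\<^esub>}"
    proof
      assume a: "carrier N = {\<zero>\<^bsub>N\<^esub>}"
      have "x = \<zero>\<^bsub>M\<^esub>" if "x \<in> carrier M" for x
      proof -
        have "\<psi> x \<in> carrier N" using that by (simp add: Nc)
        thus ?thesis using a that inj' Nz by auto
      qed
      hence "carrier M = {\<zero>\<^bsub>M\<^esub>}" by auto
      thus False using irr by (simp add: irreducible_right_module_def)
    qed
  next
    fix U assume "submodule U R N"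
    then interpret U: submodule U R N .
    have Us: "U \<subseteq> \<psi> ` carrier M" using U.subset by (simp add: Nc)
    let ?V = "{x \<in> carrier M. \<psi> x \<in> U}"
    have UV: "U = \<psi> ` ?V" using Us by auto
    interpret N: right_module R N by (rule N)
    have minus1: "(\<ominus>\<^bsub>R\<^esub> \<one>\<^bsub>R\<^esub>) \<odot>\<^bsub>M\<^esub> x = \<ominus>\<^bsub>M\<^esub> x" if x: "x \<in> carrier M" for x
    proof -
      have zero: "\<zero>\<^bsub>R\<^esub> \<odot>\<^bsub>M\<^esub> x = \<zero>\<^bsub>M\<^esub>"
        using M.act_add_scalar[of "\<zero>\<^bsub>R\<^esub>" "\<zero>\<^bsub>R\<^esub>" x] x M.act_closed[of "\<zero>\<^bsub>R\<^esub>" x]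
        by (metis M.M.add.l_cancel_one M.R.l_zero M.R.zero_closed)
      have "(\<ominus>\<^bsub>R\<^esub> \<one>\<^bsub>R\<^esub>) \<odot>\<^bsub>M\<^esub> x \<oplus>\<^bsub>M\<^esub> x = \<zero>\<^bsub>M\<^esub>"
        using M.act_add_scalar[of "\<ominus>\<^bsub>R\<^esub> \<one>\<^bsub>R\<^esub>" "\<one>\<^bsub>R\<^esub>" x] x
        by (simp add: M.R.l_neg zero M.act_one)
      thus ?thesis using x M.act_closed by (simp add: M.M.minus_equality)
    qed
    have "submodule ?V R M"
    proof (intro submodule.intro subgroup.intro submodule_axioms.intro)
      show "?V \<subseteq> carrier (add_monoid M)" by auto
      show "\<one>\<^bsub>add_monoid M\<^esub> \<in> ?V" using U.one_closed by (simp add: Nz)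
      show "x \<otimes>\<^bsub>add_monoid M\<^esub> y \<in> ?V" if "x \<in> ?V" "y \<in> ?V" for x y
        using that U.m_closed[of "\<psi> x" "\<psi> y"] by (auto simp: Na)
      show smc: "r \<odot>\<^bsub>M\<^esub> x \<in> ?V" if "r \<in> carrier R" "x \<in> ?V" for r x
        using that U.smult_closed[of r "\<psi> x"] by (auto simp: Ns M.act_closed)
      show "inv\<^bsub>add_monoid M\<^esub> x \<in> ?V" if "x \<in> ?V" for x
        using smc[of "\<ominus>\<^bsub>R\<^esub> \<one>\<^bsub>R\<^esub>" x] that minus1[of x] by (simp add: a_inv_def)
    qed
    hence "?V = {\<zero>\<^bsub>M\<^esub>} \<or> ?V = carrier M"
      using irr unfolding irreducible_right_module_def by blast
    thus "U = {\<zero>\<^bsub>N\<^esub>} \<or> U = carrier N"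
      using UV by (metis (no_types, lifting) Nc Nz image_empty image_insert)
  qed
qed

lemma primitive_ringI:
  fixes M :: "('r, 'm) module"
  assumes faithful: "faithful_right_module R M" and irr: "irreducible_right_module R M"
  shows "primitive_ring R"
proof -
  interpret M: right_module R M using faithful by (simp add: faithful_right_module_def)
  obtain x where x: "x \<in> carrier M" "x \<noteq> \<zero>\<^bsub>M\<^esub>"
    using irr M.M.zero_closed unfolding irreducible_right_module_def by blast
  let ?V = "(\<lambda>r. r \<odot>\<^bsub>M\<^esub> x) ` carrier R"
  have minus: "\<ominus>\<^bsub>M\<^esub> (r \<odot>\<^bsub>M\<^esub> x) = (\<ominus>\<^bsub>R\<^esub> r) \<odot>\<^bsub>M\<^esub> x" if r: "r \<in> carrier R" for r
  proof -
    have zero: "\<zero>\<^bsub>R\<^esub> \<odot>\<^bsub>M\<^esub> x = \<zero>\<^bsub>M\<^esub>"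
      using M.act_add_scalar[of "\<zero>\<^bsub>R\<^esub>" "\<zero>\<^bsub>R\<^esub>" x] x M.act_closed[of "\<zero>\<^bsub>R\<^esub>" x]
      by (metis M.M.add.l_cancel_one M.R.l_zero M.R.zero_closed)
    have "(\<ominus>\<^bsub>R\<^esub> r) \<odot>\<^bsub>M\<^esub> x \<oplus>\<^bsub>M\<^esub> r \<odot>\<^bsub>M\<^esub> x = \<zero>\<^bsub>M\<^esub>"
      using M.act_add_scalar[of "\<ominus>\<^bsub>R\<^esub> r" r x] x r by (simp add: M.R.l_neg zero)
    thus ?thesis using x r M.act_closed by (simp add: M.M.minus_equality)
  qed
  have zeroV: "\<zero>\<^bsub>R\<^esub> \<odot>\<^bsub>M\<^esub> x = \<zero>\<^bsub>M\<^esub>"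
    using M.act_add_scalar[of "\<zero>\<^bsub>R\<^esub>" "\<zero>\<^bsub>R\<^esub>" x] x M.act_closed[of "\<zero>\<^bsub>R\<^esub>" x]
    by (metis M.M.add.l_cancel_one M.R.l_zero M.R.zero_closed)
  have "submodule ?V R M"
  proof (intro submodule.intro subgroup.intro submodule_axioms.intro)
    show "?V \<subseteq> carrier (add_monoid M)" using x M.act_closed by auto
    show "\<one>\<^bsub>add_monoid M\<^esub> \<in> ?V" using zeroV by (auto intro!: image_eqI[of _ _ "\<zero>\<^bsub>R\<^esub>"])
    show "y \<otimes>\<^bsub>add_monoid M\<^esub> z \<in> ?V" if yz: "y \<in> ?V" "z \<in> ?V" for y z
    proof -
      obtain r s where "r \<in> carrier R" "s \<in> carrier R" "y = r \<odot>\<^bsub>M\<^esub> x" "z = s \<odot>\<^bsub>M\<^esub> x"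
        using yz by auto
      thus ?thesis using x by (auto intro!: image_eqI[of _ _ "r \<oplus>\<^bsub>R\<^esub> s"] simp: M.act_add_scalar)
    qed
    show "inv\<^bsub>add_monoid M\<^esub> y \<in> ?V" if y: "y \<in> ?V" for y
    proof -
      obtain r where "r \<in> carrier R" "y = r \<odot>\<^bsub>M\<^esub> x" using y by auto
      thus ?thesis using minus[of r]
        by (auto intro!: image_eqI[of _ _ "\<ominus>\<^bsub>R\<^esub> r"] simp: a_inv_def)
    qed
    show "r \<odot>\<^bsub>M\<^esub> y \<in> ?V" if r: "r \<in> carrier R" and y: "y \<in> ?V" for r y
    proof -
      obtain s where "s \<in> carrier R" "y = s \<odot>\<^bsub>M\<^esub> x" using y by auto
      thus ?thesis using x r by (auto intro!: image_eqI[of _ _ "s \<otimes>\<^bsub>R\<^esub> r"] simp: M.act_assoc)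
    qed
  qed
  moreover have "x \<in> ?V" using x M.act_one by (auto intro!: image_eqI[of _ _ "\<one>\<^bsub>R\<^esub>"])
  ultimately have V: "?V = carrier M"
    using irr x unfolding irreducible_right_module_def by blast
  define \<psi> where "\<psi> = (\<lambda>m. {r \<in> carrier R. r \<odot>\<^bsub>M\<^esub> x = m})"
  have "inj_on \<psi> (carrier M)"
  proof (rule inj_onI)
    fix m n assume m: "m \<in> carrier M" and eq: "\<psi> m = \<psi> n"
    obtain r where "r \<in> carrier R" "m = r \<odot>\<^bsub>M\<^esub> x" using m V by blast
    hence "r \<in> \<psi> n" using eq by (auto simp: \<psi>_def)
    thus "m = n" using \<open>m = r \<odot>\<^bsub>M\<^esub> x\<close> by (simp add: \<psi>_def)
  qed
  from right_module_transfer(2,3)[OF M.right_module_axioms this] faithful irr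
  show ?thesis unfolding primitive_ring_def by blast
qed

end

theory Submission
  imports Defs "HOL-Algebra.Ideal"
begin

text \<open>Write \<open>G = F\<^sub>\<phi>\<close>. Since \<open>F\<close> has unique roots and its nontrivial elements have abelian centralisers, the
  FC centre of \<open>G\<close> is its centre; if it is nontrivial, then \<open>\<phi>\<close> is surjective and \<open>F\<close> together with a
  central element of positive degree generates a subgroup \<open>F \<times> \<int>\<close> of finite index.

  If \<open>z \<noteq> 1\<close> is central and \<open>M\<close> is a simple faithful module, the elements \<open>v / (z - c)\<close> of \<open>M\<close>, for
  \<open>c \<in> K\<close>, are linearly independent, which forces \<open>|K| \<le> |G| = |F|\<close>.

  Conversely, \<open>KG\<close> is primitive if there is a set \<open>E\<close> that meets every nonzero ideal and elements
  \<open>\<epsilon> a\<close> in the ideals generated by the \<open>a \<in> E\<close> such that the \<open>1 + \<epsilon> a\<close> generate a proper right ideal: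
  a maximal right ideal above it contains no nonzero ideal. A set \<open>E\<close> with \<open>|E| \<le> |F|\<close> is found inside
  \<open>\<int>F\<close> (image of the integers as coefficients) if the centre is trivial, and inside \<open>K[F \<times> \<int>]\<close> if
  \<open>|K| \<le> |F|\<close>. For distinct basis elements \<open>p\<close>, \<open>q\<close> and a prefix code \<open>(c\<^sub>a)\<close> of positive words put
  \<open>\<epsilon> a = \<Sum>\<^bsub>l \<in> {p, q}\<^esub> c\<^sub>a l p\<^sup>M a p\<^bsup>3M\<^esup> c\<^sub>a l\<close>. In a sum \<open>\<Sum>\<^sub>a (1 + \<epsilon> a) r\<^sub>a\<close> a longest word arises
  without cancellation from one of the two letters \<open>l\<close>, and the code allows to read off \<open>a\<close> and then all
  factors from it, so the sum is not zero.\<close>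

section \<open>Reduced words\<close>

text \<open>Two sizes compete. The elements of \<open>E\<close> are distinguished by words over the
  alphabet of \<open>F\<close>, so there may be at most |F| of them, while \<open>K\<close> can be
  far larger. With trivial centre, an element of an ideal is written with scalars from
  \<open>K\<close> times elements whose coefficients are images of integers; in a shortest such
  expression each term is proportional to the whole, so the large field disappears. A central
  \<open>z\<close> obstructs this: for \<open>c\<close> transcendental over the prime field, the
  ideal generated by \<open>z - c\<close> contains no nonzero element with such coefficients. The
  module argument shows that the bound on |K| is then unavoidable.

  A second obstacle is that the multipliers in a relation range over all of \<open>KG\<close>,
  whereas words exist only for the subgroup \<open>H\<close>. A right translation brings one nonzero
  coefficient into \<open>H\<close>, and all factors other than the multiplier lie in
  \<open>H\<close>, so the comparison can be confined to \<open>H\<close>.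

  Two letters \<open>p\<close> and \<open>q\<close> are used because the letter standing before a
  multiplier must not cancel against it, and the multiplier is not known when the elements are
  chosen.\<close>

definition inv_letter :: "'x \<times> bool \<Rightarrow> 'x \<times> bool" where
  "inv_letter l = (fst l, \<not> snd l)"

definition inv_word :: "'x word \<Rightarrow> 'x word" where
  "inv_word w = rev (map inv_letter w)"

fun cancel_cons :: "'x \<times> bool \<Rightarrow> 'x word \<Rightarrow> 'x word" where
  "cancel_cons l [] = [l]"
| "cancel_cons l (m # w) = (if m = inv_letter l then w else l # m # w)"

definition nf :: "'x word \<Rightarrow> 'x word" where
  "nf w = foldr cancel_cons w []"

abbreviation reduced :: "'x word \<Rightarrow> bool" where
  "reduced \<equiv> successively (\<lambda>l m. m \<noteq> inv_letter l)"

lemma inv_letter_inv [simp]: "inv_letter (inv_letter l) = l"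
  by (simp add: inv_letter_def)

lemma inv_letter_eq_iff [simp]: "inv_letter l = inv_letter m \<longleftrightarrow> l = m"
  by (metis inv_letter_inv)

lemma inv_letter_neq [simp]: "inv_letter l \<noteq> l" "l \<noteq> inv_letter l"
  by (cases l; simp add: inv_letter_def)+

lemma inv_word_inv [simp]: "inv_word (inv_word w) = w"
  by (simp add: inv_word_def rev_map comp_def)

lemma inv_word_append [simp]: "inv_word (u @ v) = inv_word v @ inv_word u"
  by (simp add: inv_word_def)

lemma words_append_iff [simp]: "u @ v \<in> words X \<longleftrightarrow> u \<in> words X \<and> v \<in> words X"
  by (simp add: words_def)

lemma words_Nil [simp]: "[] \<in> words X"
  by (simp add: words_def)

lemma words_Cons [simp]: "l # w \<in> words X \<longleftrightarrow> fst l \<in> X \<and> w \<in> words X"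
  by (cases l) (auto simp: words_def)

lemma words_inv_word [simp]: "inv_word w \<in> words X \<longleftrightarrow> w \<in> words X"
proof -
  have "inv_word w \<in> words X" if "w \<in> words X" for w
    using that by (fastforce simp: words_def inv_word_def inv_letter_def lists_eq_set)
  thus ?thesis by (metis inv_word_inv)
qed

lemma reduced_cancel_cons: "reduced w \<Longrightarrow> reduced (cancel_cons l w)"
  by (cases w) (auto simp: successively_Cons)

lemma reduced_foldr: "reduced v \<Longrightarrow> reduced (foldr cancel_cons u v)"
  by (induction u) (auto intro: reduced_cancel_cons)

lemma reduced_nf [simp]: "reduced (nf w)"
  unfolding nf_def by (rule reduced_foldr) simp

text \<open>Reducedness enters here: after a leading \<open>l\<close> of \<open>w\<close> has been
  cancelled, the next letter must not be its inverse, or the outer \<open>cancel_cons\<close> would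
  cancel again.\<close>

lemma cancel_cons_inv: "reduced w \<Longrightarrow> cancel_cons l (cancel_cons (inv_letter l) w) = w"
  by (cases w rule: remdups_adj.cases) (auto simp: successively_Cons)

lemma cancel_cons_reduced: "reduced (l # w) \<Longrightarrow> cancel_cons l w = l # w"
  by (cases w) auto

lemma nf_reduced: "reduced w \<Longrightarrow> nf w = w"
proof (induction w)
  case (Cons l w)
  thus ?case using cancel_cons_reduced[of l w] by (auto simp: nf_def successively_Cons)
qed (simp add: nf_def)

lemma nf_Nil [simp]: "nf [] = []"
  by (simp add: nf_def)

lemma length_cancel_cons: "length (cancel_cons l w) \<le> Suc (length w)"
  by (cases w) auto

lemma length_nf: "length (nf w) \<le> length w"
proof (induction w)
  case (Cons l w)
  thus ?case using length_cancel_cons[of l "nf w"] by (simp add: nf_def)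
qed simp

text \<open>Every cancellation costs two letters, so equal length means that none took place. This
  later identifies a longest word as uncancelled.\<close>

lemma nf_eqI_length: "length (nf w) = length w \<Longrightarrow> nf w = w"
proof (induction w)
  case (Cons l w)
  have eq: "nf (l # w) = cancel_cons l (nf w)" by (simp add: nf_def)
  have "length (nf w) = length w"
    using Cons.prems eq length_cancel_cons[of l "nf w"] length_nf[of w] by simp
  hence "nf w = w" by (rule Cons.IH)
  thus ?case using Cons.prems eq by (cases w) (auto split: if_splits)
qed simp

text \<open>Van der Waerden's argument: inverse letters act on the reduced words by inverse maps, so
  congruent words act alike. Applied to \<open>[]\<close> this gives uniqueness of normal forms
  without a confluence proof.\<close>

lemma foldr_cancel_cong:
  assumes "(u, v) \<in> word_cong X {}" "reduced w"
  shows "foldr cancel_cons u w = foldr cancel_cons v w"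
  using assms
proof (induction arbitrary: w rule: word_cong.induct)
  case (cancel x b)
  thus ?case using cancel_cons_inv[of w "(x, b)"] by (simp add: inv_letter_def)
qed (auto simp: reduced_foldr)

lemma cancel_cons_cong:
  assumes "l # w \<in> words X"
  shows "(l # w, cancel_cons l w) \<in> word_cong X {}"
proof (cases w)
  case Nil
  thus ?thesis using assms by (auto intro: word_cong.refl)
next
  case (Cons m v)
  show ?thesis
  proof (cases "m = inv_letter l")
    case True
    have "([l, inv_letter l] @ v, [] @ v) \<in> word_cong X {}"
      using word_cong.cancel[of "fst l" X "snd l" "{}"] assms Cons
      by (intro word_cong.append word_cong.refl) (auto simp: inv_letter_def)
    thus ?thesis using True Cons by simp
  next
    case False
    thus ?thesis using assms Cons by (auto intro: word_cong.refl)
  qed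
qed

lemma nf_cong:
  assumes "w \<in> words X"
  shows "(w, nf w) \<in> word_cong X {}"
  using assms
proof (induction w)
  case Nil
  show ?case by (auto intro: word_cong.refl)
next
  case (Cons l w)
  have "([l] @ w, [l] @ nf w) \<in> word_cong X {}"
    using Cons by (intro word_cong.append word_cong.refl) auto
  moreover have "l # nf w \<in> words X"
    using calculation word_cong_in_words by force
  hence "(l # nf w, cancel_cons l (nf w)) \<in> word_cong X {}"
    by (rule cancel_cons_cong)
  ultimately show ?case by (auto simp: nf_def intro: word_cong.trans)
qed

lemma nf_in_words: "w \<in> words X \<Longrightarrow> nf w \<in> words X"
  using nf_cong word_cong_in_words by blast

lemma nf_eq_iff_cong:
  assumes "u \<in> words X" "v \<in> words X"
  shows "nf u = nf v \<longleftrightarrow> (u, v) \<in> word_cong X {}"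
proof
  show "(u, v) \<in> word_cong X {}" if "nf u = nf v"
    using nf_cong[OF assms(1)] nf_cong[OF assms(2)] that
    by (metis word_cong.sym word_cong.trans)
  show "nf u = nf v" if "(u, v) \<in> word_cong X {}"
    using foldr_cancel_cong[OF that, of "[]"] by (simp add: nf_def)
qed

lemma nf_append_cong:
  assumes "nf u = nf u'" "nf v = nf v'"
  shows "nf (u @ v) = nf (u' @ v')"
proof -
  \<comment> \<open>Over the full alphabet every list is a word, so the congruence applies without
    side conditions.\<close>
  have "w \<in> words UNIV" for w :: "'a word" by (auto simp: words_def)
  note iff = nf_eq_iff_cong[OF this this]
  show ?thesis using word_cong.append assms unfolding iff by blast
qed

lemma nf_idem [simp]: "nf (nf w) = nf w"
  by (rule nf_reduced) simp

lemma nf_nf_append_left [simp]: "nf (nf u @ v) = nf (u @ v)"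
  by (rule nf_append_cong) auto

lemma nf_nf_append_right [simp]: "nf (u @ nf v) = nf (u @ v)"
  by (rule nf_append_cong) auto

lemma nf_append_inv: "nf (w @ inv_word w) = []"
proof (induction w)
  case (Cons l w)
  have "nf (l # w @ inv_word w @ [inv_letter l]) = nf ([l] @ nf ((w @ inv_word w) @ [inv_letter l]))"
    by (simp only: nf_nf_append_right) simp
  also have "\<dots> = nf ([l] @ nf (nf (w @ inv_word w) @ [inv_letter l]))"
    by (simp only: nf_nf_append_left)
  also have "\<dots> = []" using Cons by (simp add: nf_def)
  finally show ?case by (simp add: inv_word_def)
qed (simp add: inv_word_def)

lemma nf_inv_append: "nf (inv_word w @ w) = []"
  using nf_append_inv[of "inv_word w"] by simp

lemma reduced_inv_word: "reduced w \<Longrightarrow> reduced (inv_word w)"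
  unfolding inv_word_def successively_rev successively_map
  by (erule successively_mono) (metis inv_letter_inv)

definition free_words :: "'x set \<Rightarrow> 'x word monoid" where
  "free_words X = \<lparr>carrier = {w \<in> words X. reduced w}, mult = (\<lambda>u v. nf (u @ v)), one = []\<rparr>"

lemma free_words_simps [simp]:
  "carrier (free_words X) = {w \<in> words X. reduced w}"
  "u \<otimes>\<^bsub>free_words X\<^esub> v = nf (u @ v)"
  "\<one>\<^bsub>free_words X\<^esub> = []"
  by (simp_all add: free_words_def)

lemma group_free_words: "group (free_words X)"
proof (rule groupI)
  show "\<exists>v\<in>carrier (free_words X). v \<otimes>\<^bsub>free_words X\<^esub> u = \<one>\<^bsub>free_words X\<^esub>"
    if "u \<in> carrier (free_words X)" for u
    using that by (intro bexI[of _ "inv_word u"]) (auto simp: nf_inv_append reduced_inv_word)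
qed (auto simp: nf_in_words nf_reduced)

lemma presented_group_iso_free_words: "presented_group X {} \<cong> free_words X"
proof -
  let ?c = "\<lambda>u. word_cong X {} `` {u}"
  have car: "carrier (presented_group X {}) = ?c ` words X"
    by (auto simp: presented_group_def quotient_def)
  have cls: "?c u = ?c v \<longleftrightarrow> nf u = nf v" if "u \<in> words X" "v \<in> words X" for u v
    using that nf_eq_iff_cong eq_equiv_class_iff[OF equiv_word_cong that] by metis
  have "?c \<in> iso (free_words X) (presented_group X {})"
  proof (rule isoI)
    show "?c \<in> hom (free_words X) (presented_group X {})"
      by (rule homI) (auto simp: car presented_group_mult cls nf_in_words)
    show "bij_betw ?c (carrier (free_words X)) (carrier (presented_group X {}))"
      unfolding bij_betw_def
    proof
      show "inj_on ?c (carrier (free_words X))"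
        by (rule inj_onI) (auto simp: cls nf_reduced)
      have "?c w \<in> ?c ` carrier (free_words X)" if "w \<in> words X" for w
        using that by (intro image_eqI[of _ _ "nf w"]) (auto simp: cls nf_in_words)
      thus "?c ` carrier (free_words X) = carrier (presented_group X {})"
        by (auto simp: car)
    qed
  qed
  thus ?thesis
    using group.iso_sym[OF group_free_words is_isoI] by blast
qed

section \<open>Centralisers in free groups\<close>

text \<open>Cancellation between two reduced words happens only at the seam, and \<open>k\<close> is
  the number of pairs cancelled there.\<close>

lemma nf_append_reduced:
  assumes "reduced u" "reduced v"
  shows "\<exists>k. k \<le> length u \<and> k \<le> length v \<and> nf (u @ v) = take (length u - k) u @ drop k v"
  using assms(1)
proof (induction u)
  case Nil
  thus ?case using assms(2) by (simp add: nf_reduced)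
next
  case (Cons l u)
  then obtain k where k: "k \<le> length u" "k \<le> length v"
      "nf (u @ v) = take (length u - k) u @ drop k v"
    by (auto simp: successively_Cons)
  have eq: "nf ((l # u) @ v) = cancel_cons l (nf (u @ v))" by (simp add: nf_def)
  \<comment> \<open>Only if \<open>u\<close> has been consumed entirely can the new letter
    \<open>l\<close> meet a letter of \<open>v\<close> and cancel it.\<close>
  show ?case
  proof (cases "k = length u")
    case False
    then obtain m u' where u: "u = m # u'" using k(1) by (cases u) auto
    have "length u - k = Suc (length u - k - 1)" using False k(1) by simp
    hence "take (length u - k) u = m # take (length u - k - 1) u'" using u by simp
    moreover have "m \<noteq> inv_letter l" using Cons.prems u by (simp add: successively_Cons)
    ultimately have "nf ((l # u) @ v) = l # take (length u - k) u @ drop k v"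
      using eq k(3) by simp
    thus ?thesis using k by (intro exI[of _ k]) (simp add: Suc_diff_le)
  next
    case True
    show ?thesis
    proof (cases "drop k v")
      case Nil
      thus ?thesis using eq k True by (intro exI[of _ k]) simp
    next
      case (Cons m v')
      show ?thesis
      proof (cases "m = inv_letter l")
        case True
        have "Suc k \<le> length v" using Cons k(2) by (metis Suc_leI drop_all le_eq_less_or_eq list.distinct(1))
        moreover have "drop (Suc k) v = v'"
          using Cons by (metis drop_Suc list.sel(3) tl_drop)
        ultimately show ?thesis using eq k(3) \<open>k = length u\<close> True Cons
          by (intro exI[of _ "Suc k"]) simp
      next
        case False
        thus ?thesis using eq k \<open>k = length u\<close> Cons by (intro exI[of _ k]) simp
      qed
    qed
  qed
qed


lemma nf_cancel_left [simp]: "nf (u @ inv_word w @ w @ v) = nf (u @ v)"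
proof -
  have "nf (u @ (inv_word w @ w) @ v) = nf (u @ [] @ v)"
    by (intro nf_append_cong) (simp_all add: nf_inv_append)
  thus ?thesis by simp
qed

lemma nf_cancel_right [simp]: "nf (u @ w @ inv_word w @ v) = nf (u @ v)"
  using nf_cancel_left[of u "inv_word w" v] by simp

lemma nf_right_cancel: "nf (u @ w) = nf (v @ w) \<Longrightarrow> nf u = nf v"
  using nf_append_cong[of "u @ w" "v @ w" "inv_word w" "inv_word w"]
    nf_cancel_right[of _ w "[]"] by simp

section \<open>Powers of a cyclically reduced word\<close>

context
  fixes f :: "'x word"
  assumes f: "f \<noteq> []" and cyc: "reduced (f @ f)"
begin

text \<open>The infinite word is handled letter by letter, so that prefixes of arbitrary length are
  available and not only powers of \<open>f\<close>.\<close>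

definition power_letter :: "nat \<Rightarrow> 'x \<times> bool" where
  "power_letter i = f ! (i mod length f)"

definition power_prefix :: "nat \<Rightarrow> 'x word" where
  "power_prefix N = map power_letter [0..<N]"

lemma power_prefix_append:
  "power_prefix (M + N) = power_prefix M @ map power_letter [M..<M + N]"
  by (simp add: power_prefix_def upt_add_eq_append[of 0 M N] del: upt_Suc)

lemma reduced_power_prefix: "reduced (power_prefix N)"
proof -
  let ?n = "length f"
  have ff: "(f @ f) ! j = f ! (j mod ?n)" if "j < 2 * ?n" for j
    using that by (cases "j < ?n") (auto simp: nth_append mod_if)
  have "power_letter (Suc i) \<noteq> inv_letter (power_letter i)" for i
  proof -
    define r where "r = i mod ?n"
    have r: "r < ?n" using f by (simp add: r_def)
    hence "(f @ f) ! Suc r \<noteq> inv_letter ((f @ f) ! r)"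
      using cyc f unfolding successively_conv_nth by auto
    moreover have "Suc i mod ?n = Suc r mod ?n" by (simp add: r_def mod_Suc_eq)
    ultimately show ?thesis
      using ff[of r] ff[of "Suc r"] r by (simp add: power_letter_def r_def)
  qed
  thus ?thesis by (simp add: successively_conv_nth power_prefix_def)
qed

lemma power_prefix_Suc_mult:
  "power_prefix (Suc j * length f) = f @ power_prefix (j * length f)"
proof -
  have "map power_letter [length f..<length f + j * length f] = power_prefix (j * length f)"
    by (rule nth_equalityI) (auto simp: power_prefix_def power_letter_def)
  moreover have "power_prefix (length f) = f"
    by (rule nth_equalityI) (auto simp: power_prefix_def power_letter_def)
  ultimately show ?thesis
    using power_prefix_append[of "length f" "j * length f"] by simp
qed

lemma commute_power_prefix:
  assumes "nf (g @ f) = nf (f @ g)"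
  shows "nf (g @ power_prefix (j * length f)) = nf (power_prefix (j * length f) @ g)"
proof (induction j)
  case 0
  show ?case by (simp add: power_prefix_def)
next
  case (Suc j)
  let ?P = "power_prefix (j * length f)"
  have "nf (g @ f @ ?P) = nf ((f @ g) @ ?P)"
    using nf_append_cong[OF assms, of ?P ?P] by simp
  also have "\<dots> = nf (f @ (?P @ g))"
    using nf_append_cong[of f f, OF _ Suc] by simp
  finally show ?case by (simp add: power_prefix_Suc_mult del: mult_Suc)
qed

text \<open>An element commuting with \<open>f\<close> fixes the infinite word \<open>f f f \<dots>\<close> up to a shift, and it is
  determined by the length of that shift.\<close>

lemma commute_shift:
  assumes g: "reduced g" and comm: "nf (g @ f) = nf (f @ g)"
  shows "\<exists>k m. \<forall>N. nf (g @ power_prefix (k + N)) = nf (power_prefix (m + N))"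
proof -
  let ?n = "length f"
  \<comment> \<open>As a multiple of the length of \<open>f\<close>, \<open>L\<close> belongs to a
    power of \<open>f\<close>, which commutes with \<open>g\<close>. It exceeds
    \<open>2 * length g\<close> by at least two periods, so a full period survives the at most
    \<open>length g\<close> cancellations at either end.\<close>
  define L where "L = (2 * length g + 2) * ?n"
  have n: "?n > 0" using f by simp
  hence "(2 * length g) * 1 \<le> (2 * length g) * ?n" by (intro mult_le_mono) (use n in \<open>auto simp: Suc_le_eq\<close>)
  hence L: "2 * length g + 2 * ?n \<le> L" by (simp add: L_def algebra_simps)
  have len: "length (power_prefix N) = N" for N by (simp add: power_prefix_def)
  have nth: "power_prefix N ! i = power_letter i" if "i < N" for i N
    using that by (simp add: power_prefix_def)
  obtain k where k: "k \<le> length g" "k \<le> L"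
      "nf (g @ power_prefix L) = take (length g - k) g @ drop k (power_prefix L)"
    using nf_append_reduced[OF g reduced_power_prefix[of L]] len by auto
  obtain k' where k': "k' \<le> length g"
      "nf (power_prefix L @ g) = take (L - k') (power_prefix L) @ drop k' g"
    using nf_append_reduced[OF reduced_power_prefix[of L] g] len by auto
  define m where "m = length g - k"
  \<comment> \<open>The same product in two orders: as \<open>g\<close> times the power it ends in a
    shifted periodic word, as the power times \<open>g\<close> it begins with the periodic word
    itself.\<close>
  define Q where "Q = nf (g @ power_prefix L)"
  have Q1: "Q = take m g @ drop k (power_prefix L)" using k by (simp add: Q_def m_def)
  have Q2: "Q = take (L - k') (power_prefix L) @ drop k' g"
    using k'(2) commute_power_prefix[OF comm, of "2 * length g + 2"] by (simp only: Q_def L_def)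
  have Qi: "Q ! i = power_letter i" if "i < L - length g" for i
  proof -
    have "i < L - k'" using that k'(1) by linarith
    thus ?thesis by (simp add: Q2 nth_append len nth)
  qed
  have lm: "length (take m g) = m" by (simp add: m_def)
  have "take m g = power_prefix m"
  proof (rule nth_equalityI)
    show "take m g ! i = power_prefix m ! i" if "i < length (take m g)" for i
    proof -
      have "i < m" using that lm by simp
      moreover have "m \<le> L - length g" "m \<le> length g" using L by (simp_all add: m_def)
      ultimately show ?thesis using Qi[of i] lm by (simp add: Q1 nth_append nth)
    qed
  qed (simp only: lm len)
  moreover have "power_prefix L = power_prefix k @ drop k (power_prefix L)"
  proof -
    have "power_prefix L = power_prefix k @ map power_letter [k..<L]"
      using power_prefix_append[of k "L - k"] k(2) by simp
    thus ?thesis by (metis append_eq_conv_conj len)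
  qed
  ultimately have "nf ((g @ power_prefix k) @ drop k (power_prefix L)) =
      nf (power_prefix m @ drop k (power_prefix L))"
    using Q1 by (metis Q_def append.assoc nf_idem)
  hence base: "nf (g @ power_prefix k) = nf (power_prefix m)" by (rule nf_right_cancel)
  \<comment> \<open>Both sides are periodic in \<open>i\<close>, so agreement over the one period
    visible in \<open>Q\<close> suffices.\<close>
  have shift: "power_letter (m + i) = power_letter (k + i)" for i
  proof -
    define r where "r = i mod ?n"
    have r: "r < ?n" using n by (simp add: r_def)
    hence "m + r < L - length g" "k + r < L" using L k(1) n by (auto simp: m_def)
    hence "power_letter (m + r) = power_letter (k + r)"
      using Qi[of "m + r"] lm by (simp add: Q1 nth_append len nth)
    thus ?thesis by (simp add: power_letter_def r_def mod_add_right_eq)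
  qed
  have "nf (g @ power_prefix (k + N)) = nf (power_prefix (m + N))" for N
  proof -
    have "map power_letter [k..<k + N] = map power_letter [m..<m + N]"
      by (rule nth_equalityI) (auto simp: shift)
    hence "nf ((g @ power_prefix k) @ map power_letter [k..<k + N]) =
        nf (power_prefix m @ map power_letter [m..<m + N])"
      by (intro nf_append_cong base) simp
    thus ?thesis by (simp add: power_prefix_append)
  qed
  thus ?thesis by blast
qed

text \<open>By \<open>commute_shift\<close>, \<open>a\<close> and \<open>b\<close> turn prefixes of
  lengths \<open>k + N\<close> and \<open>k' + N\<close> into prefixes of lengths
  \<open>m + N\<close> and \<open>m' + N\<close>. Such shifts commute, so \<open>a b\<close> and
  \<open>b a\<close> agree on a common prefix, which is then cancelled.\<close>

lemma commute_trans_cyc: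
  assumes "reduced a" "nf (a @ f) = nf (f @ a)" and "reduced b" "nf (b @ f) = nf (f @ b)"
  shows "nf (a @ b) = nf (b @ a)"
proof -
  obtain k m where a: "\<And>N. nf (a @ power_prefix (k + N)) = nf (power_prefix (m + N))"
    using commute_shift[OF assms(1,2)] by blast
  obtain k' m' where b: "\<And>N. nf (b @ power_prefix (k' + N)) = nf (power_prefix (m' + N))"
    using commute_shift[OF assms(3,4)] by blast
  have "nf (a @ b @ power_prefix (k' + k)) = nf (a @ power_prefix (m' + k))"
    by (intro nf_append_cong b) simp
  also have "\<dots> = nf (power_prefix (m' + m))" using a[of m'] by (simp add: add.commute)
  finally have 1: "nf ((a @ b) @ power_prefix (k' + k)) = nf (power_prefix (m' + m))" by simp
  have "nf (b @ a @ power_prefix (k + k')) = nf (b @ power_prefix (m + k'))"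
    by (intro nf_append_cong a) simp
  also have "\<dots> = nf (power_prefix (m' + m))" using b[of m] by (simp add: add.commute)
  finally have 2: "nf ((b @ a) @ power_prefix (k' + k)) = nf (power_prefix (m' + m))"
    by (simp add: add.commute)
  show ?thesis using nf_right_cancel 1 2 by metis
qed

lemma nf_power_prefix_neq: "j > 0 \<Longrightarrow> nf (power_prefix (j * length f)) \<noteq> []"
  using f by (simp add: nf_reduced reduced_power_prefix) (simp add: power_prefix_def Suc_le_eq)

end

text \<open>If \<open>f f\<close> is not reduced, the first and the last letter of \<open>f\<close>
  are inverse to each other and can be stripped off. The decomposition is an equality of
  lists.\<close>

lemma cyclically_reduced_conjugate:
  assumes "reduced f" "f \<noteq> []"
  shows "\<exists>c g. g \<noteq> [] \<and> reduced (g @ g) \<and> f = c @ g @ inv_word c"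
  using assms
proof (induction "length f" arbitrary: f rule: less_induct)
  case less
  show ?case
  proof (cases "reduced (f @ f)")
    case True
    thus ?thesis using less.prems by (intro exI[of _ "[]"] exI[of _ f]) (simp add: inv_word_def)
  next
    case False
    hence eq: "hd f = inv_letter (last f)"
      using less.prems by (auto simp: successively_append_iff)
    obtain l f1 where f1: "f = l # f1" using less.prems by (cases f) auto
    have "f1 \<noteq> []" using eq f1 by auto
    then obtain f2 m where f2: "f1 = f2 @ [m]" by (cases f1 rule: rev_cases) auto
    have m: "m = inv_letter l" using eq f1 f2 by simp
    have f: "f = l # f2 @ [inv_letter l]" using f1 f2 m by simp
    have "f2 \<noteq> []" using less.prems f by auto
    moreover have "reduced f2"
      using less.prems f by (simp add: successively_Cons successively_append_iff)
    ultimately obtain c g where "g \<noteq> []" "reduced (g @ g)" "f2 = c @ g @ inv_word c"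
      using less.hyps[of f2] f by auto
    thus ?thesis using f by (intro exI[of _ "l # c"] exI[of _ g]) (simp add: inv_word_def)
  qed
qed

lemma nf_commute_conj:
  assumes "nf (u @ v) = nf (v @ u)"
  shows "nf ((inv_word c @ u @ c) @ (inv_word c @ v @ c)) =
    nf ((inv_word c @ v @ c) @ (inv_word c @ u @ c))"
proof -
  have *: "nf ((inv_word c @ u @ c) @ (inv_word c @ v @ c)) = nf (inv_word c @ (u @ v) @ c)" for u v
    using nf_cancel_right[of "inv_word c @ u" c "v @ c"] by simp
  show ?thesis
    unfolding * using nf_append_cong[OF HOL.refl nf_append_cong[OF assms HOL.refl]] by blast
qed

text \<open>Conjugation by \<open>c\<close> turns \<open>f\<close> into its cyclically reduced core
  \<open>g\<close>. The words \<open>a\<close> and \<open>b\<close> are arbitrary; normal forms are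
  taken after conjugating them.\<close>

lemma commute_trans_nf:
  assumes "reduced f" "f \<noteq> []" "nf (a @ f) = nf (f @ a)" "nf (b @ f) = nf (f @ b)"
  shows "nf (a @ b) = nf (b @ a)"
proof -
  obtain c g where g: "g \<noteq> []" "reduced (g @ g)" "f = c @ g @ inv_word c"
    using cyclically_reduced_conjugate[OF assms(1,2)] by blast
  have nfg: "nf (inv_word c @ f @ c) = nf g"
    using nf_cancel_left[of "[]" c "g @ inv_word c @ c"] nf_cancel_left[of g c "[]"] by (simp add: g(3))
  have comm: "nf (nf (inv_word c @ u @ c) @ g) = nf (g @ nf (inv_word c @ u @ c))"
    if "nf (u @ f) = nf (f @ u)" for u
  proof -
    have "nf ((inv_word c @ u @ c) @ g) = nf ((inv_word c @ u @ c) @ (inv_word c @ f @ c))"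
      using nfg by (intro nf_append_cong) auto
    also have "\<dots> = nf ((inv_word c @ f @ c) @ (inv_word c @ u @ c))"
      by (rule nf_commute_conj[OF that])
    also have "\<dots> = nf (g @ (inv_word c @ u @ c))"
      using nfg by (intro nf_append_cong) auto
    finally show ?thesis by simp
  qed
  have "nf (nf (inv_word c @ a @ c) @ nf (inv_word c @ b @ c)) =
      nf (nf (inv_word c @ b @ c) @ nf (inv_word c @ a @ c))"
    using commute_trans_cyc[OF g(1,2) _ comm[OF assms(3)] _ comm[OF assms(4)]] by simp
  hence "nf ((inv_word c @ a @ c) @ (inv_word c @ b @ c)) =
      nf ((inv_word c @ b @ c) @ (inv_word c @ a @ c))"
    by simp
  from nf_commute_conj[OF this, of "inv_word c"]
  have "nf ((c @ (inv_word c @ a @ c) @ inv_word c) @ (c @ (inv_word c @ b @ c) @ inv_word c)) =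
      nf ((c @ (inv_word c @ b @ c) @ inv_word c) @ (c @ (inv_word c @ a @ c) @ inv_word c))"
    by simp
  moreover have "nf (c @ (inv_word c @ u @ c) @ inv_word c) = nf u" for u
    using nf_cancel_right[of "[]" c "u @ c @ inv_word c"] nf_cancel_right[of u c "[]"] by simp
  ultimately show ?thesis using nf_append_cong nf_nf_append_left nf_nf_append_right by metis
qed

text \<open>All powers of \<open>f\<close> are conjugates, by the same \<open>c\<close>, of powers
  of the cyclically reduced core, and in those nothing cancels.\<close>

lemma free_words_pow_neq_one:
  fixes m :: nat
  assumes "f \<in> carrier (free_words X)" "f \<noteq> []" "m > 0"
  shows "f [^]\<^bsub>free_words X\<^esub> m \<noteq> []"
proof -
  interpret group "free_words X" by (rule group_free_words)
  obtain c g where g: "g \<noteq> []" "reduced (g @ g)" "f = c @ g @ inv_word c"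
    using cyclically_reduced_conjugate[of f] assms by auto
  have "f [^]\<^bsub>free_words X\<^esub> j = nf (c @ power_prefix g (j * length g) @ inv_word c)" for j
  proof (induction j)
    case 0
    show ?case by (simp add: power_prefix_def[OF g(1,2)] nf_append_inv)
  next
    case (Suc j)
    let ?P = "power_prefix g (j * length g)"
    have "f [^]\<^bsub>free_words X\<^esub> Suc j = f \<otimes>\<^bsub>free_words X\<^esub> f [^]\<^bsub>free_words X\<^esub> j"
      using nat_pow_Suc2[OF assms(1)] .
    also have "\<dots> = nf (f @ c @ ?P @ inv_word c)" by (simp add: Suc)
    also have "\<dots> = nf ((c @ g) @ inv_word c @ c @ ?P @ inv_word c)" by (simp add: g(3))
    also have "\<dots> = nf (c @ (g @ ?P) @ inv_word c)" by (simp only: nf_cancel_left) simp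
    finally show ?case by (simp add: power_prefix_Suc_mult[OF g(1,2)] del: mult_Suc)
  qed
  moreover have "nf (c @ w @ inv_word c) \<noteq> []" if "nf w \<noteq> []" for w
  proof
    assume "nf (c @ w @ inv_word c) = []"
    hence "nf (inv_word c @ (c @ w @ inv_word c) @ c) = nf (inv_word c @ [] @ c)"
      by (intro nf_append_cong) auto
    moreover have "nf (inv_word c @ (c @ w @ inv_word c) @ c) = nf w"
      using nf_cancel_left[of "[]" c "w @ inv_word c @ c"] nf_cancel_left[of w c "[]"] by simp
    ultimately show False using that by (simp add: nf_inv_append)
  qed
  ultimately show ?thesis using nf_power_prefix_neq[OF g(1,2) assms(3)] by simp
qed

section \<open>Abstract free groups: torsion, transitivity of commutation, uniqueness of
  roots\<close>

lemma free_group_iso_words: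
  fixes F :: "('a, 'm) monoid_scheme"
  assumes "free_group F"
  obtains X :: "'a set" and \<omega> where "\<omega> \<in> iso F (free_words X)"
  using assms iso_trans[OF _ presented_group_iso_free_words]
  unfolding free_group_def is_iso_def by blast

lemma free_group_pow_neq_one:
  fixes m :: nat
  assumes F: "free_group F" and x: "x \<in> carrier F" "x \<noteq> \<one>\<^bsub>F\<^esub>" and "m > 0"
  shows "x [^]\<^bsub>F\<^esub> m \<noteq> \<one>\<^bsub>F\<^esub>"
proof -
  obtain X :: "'a set" and \<omega> where "\<omega> \<in> iso F (free_words X)"
    by (rule free_group_iso_words[OF F])
  hence hom: "\<omega> \<in> hom F (free_words X)" and inj: "inj_on \<omega> (carrier F)"
    by (auto simp: iso_def bij_betw_def)
  interpret F: group F using F by (simp add: free_group_def)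
  interpret h: group_hom F "free_words X" \<omega>
    by (intro group_hom.intro group_hom_axioms.intro F.group_axioms group_free_words hom)
  have "\<omega> x \<noteq> []" using x inj_onD[OF inj, of x "\<one>\<^bsub>F\<^esub>"] h.hom_one by auto
  hence "\<omega> x [^]\<^bsub>free_words X\<^esub> m \<noteq> []"
    using free_words_pow_neq_one h.hom_closed[OF x(1)] \<open>m > 0\<close> by blast
  thus ?thesis using h.hom_nat_pow[OF x(1), of m] h.hom_one by auto
qed

lemma free_group_commute_trans:
  assumes F: "free_group F" and x: "x \<in> carrier F" "x \<noteq> \<one>\<^bsub>F\<^esub>"
    and a: "a \<in> carrier F" "a \<otimes>\<^bsub>F\<^esub> x = x \<otimes>\<^bsub>F\<^esub> a"
    and b: "b \<in> carrier F" "b \<otimes>\<^bsub>F\<^esub> x = x \<otimes>\<^bsub>F\<^esub> b"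
  shows "a \<otimes>\<^bsub>F\<^esub> b = b \<otimes>\<^bsub>F\<^esub> a"
proof -
  obtain X :: "'a set" and \<omega> where "\<omega> \<in> iso F (free_words X)"
    by (rule free_group_iso_words[OF F])
  hence hom: "\<omega> \<in> hom F (free_words X)" and inj: "inj_on \<omega> (carrier F)"
    by (auto simp: iso_def bij_betw_def)
  interpret F: group F using F by (simp add: free_group_def)
  interpret h: group_hom F "free_words X" \<omega>
    by (intro group_hom.intro group_hom_axioms.intro F.group_axioms group_free_words hom)
  have m: "nf (\<omega> u @ \<omega> v) = \<omega> (u \<otimes>\<^bsub>F\<^esub> v)" if "u \<in> carrier F" "v \<in> carrier F" for u v
    using that h.hom_mult by simp
  have "\<omega> x \<noteq> []" using x inj_onD[OF inj, of x "\<one>\<^bsub>F\<^esub>"] h.hom_one by auto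
  moreover have "reduced (\<omega> x)" using h.hom_closed[OF x(1)] by simp
  ultimately have "nf (\<omega> a @ \<omega> b) = nf (\<omega> b @ \<omega> a)"
    using m[OF a(1) x(1)] m[OF x(1) a(1)] m[OF b(1) x(1)] m[OF x(1) b(1)] a(2) b(2)
    by (elim commute_trans_nf[of "\<omega> x", rotated]) simp_all
  hence "\<omega> (a \<otimes>\<^bsub>F\<^esub> b) = \<omega> (b \<otimes>\<^bsub>F\<^esub> a)" by (simp only: m a(1) b(1))
  thus ?thesis using inj_onD[OF inj] F.m_closed a(1) b(1) by metis
qed

text \<open>If the common power is nontrivial, both \<open>x\<close> and \<open>y\<close> commute
  with it and hence with each other, so \<open>x y^-1\<close> is a torsion element.\<close>

lemma free_group_root_unique:
  fixes m :: nat
  assumes F: "free_group F" and xy: "x \<in> carrier F" "y \<in> carrier F"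
    and "m > 0" and eq: "x [^]\<^bsub>F\<^esub> m = y [^]\<^bsub>F\<^esub> m"
  shows "x = y"
proof (cases "x = \<one>\<^bsub>F\<^esub>")
  interpret F: group F using F by (simp add: free_group_def)
  case True
  thus ?thesis
    using free_group_pow_neq_one[OF F xy(2) _ \<open>m > 0\<close>] eq F.nat_pow_one by metis
next
  interpret F: group F using F by (simp add: free_group_def)
  case False
  let ?z = "x [^]\<^bsub>F\<^esub> m"
  have comm: "u \<otimes>\<^bsub>F\<^esub> u [^]\<^bsub>F\<^esub> m = u [^]\<^bsub>F\<^esub> m \<otimes>\<^bsub>F\<^esub> u" if "u \<in> carrier F" for u
    using F.nat_pow_Suc2[OF that, of m] by simp
  have "?z \<noteq> \<one>\<^bsub>F\<^esub>" by (rule free_group_pow_neq_one[OF F xy(1) False \<open>m > 0\<close>])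
  moreover have "x [^]\<^bsub>F\<^esub> m \<otimes>\<^bsub>F\<^esub> y = y \<otimes>\<^bsub>F\<^esub> x [^]\<^bsub>F\<^esub> m"
    unfolding eq by (rule comm[OF xy(2), symmetric])
  ultimately have "x \<otimes>\<^bsub>F\<^esub> y = y \<otimes>\<^bsub>F\<^esub> x"
    using free_group_commute_trans[OF F _ _ xy(1) comm[OF xy(1)] xy(2)] xy(1) by auto
  hence "inv\<^bsub>F\<^esub> y \<otimes>\<^bsub>F\<^esub> (x \<otimes>\<^bsub>F\<^esub> y) \<otimes>\<^bsub>F\<^esub> inv\<^bsub>F\<^esub> y = inv\<^bsub>F\<^esub> y \<otimes>\<^bsub>F\<^esub> (y \<otimes>\<^bsub>F\<^esub> x) \<otimes>\<^bsub>F\<^esub> inv\<^bsub>F\<^esub> y"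
    by simp
  moreover have "inv\<^bsub>F\<^esub> y \<otimes>\<^bsub>F\<^esub> (x \<otimes>\<^bsub>F\<^esub> y) \<otimes>\<^bsub>F\<^esub> inv\<^bsub>F\<^esub> y = inv\<^bsub>F\<^esub> y \<otimes>\<^bsub>F\<^esub> x"
    using xy by (simp add: F.m_assoc)
  moreover have "inv\<^bsub>F\<^esub> y \<otimes>\<^bsub>F\<^esub> (y \<otimes>\<^bsub>F\<^esub> x) = x"
    using xy by (simp add: F.m_assoc[symmetric])
  ultimately have "x \<otimes>\<^bsub>F\<^esub> inv\<^bsub>F\<^esub> y = inv\<^bsub>F\<^esub> y \<otimes>\<^bsub>F\<^esub> x" by simp
  hence "(x \<otimes>\<^bsub>F\<^esub> inv\<^bsub>F\<^esub> y) [^]\<^bsub>F\<^esub> m = ?z \<otimes>\<^bsub>F\<^esub> (inv\<^bsub>F\<^esub> y) [^]\<^bsub>F\<^esub> m"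
    using xy by (intro F.pow_mult_distrib) auto
  also have "\<dots> = \<one>\<^bsub>F\<^esub>" using xy eq F.nat_pow_inv by simp
  finally have "x \<otimes>\<^bsub>F\<^esub> inv\<^bsub>F\<^esub> y = \<one>\<^bsub>F\<^esub>"
    using free_group_pow_neq_one[OF F _ _ \<open>m > 0\<close>] xy by (metis F.inv_closed F.m_closed)
  thus ?thesis using xy by (metis F.inv_closed F.inv_equality F.inv_inv)
qed

section \<open>Ascending HNN extensions\<close>

lemma semiconj_pow:
  assumes "group_hom F G \<beta>" "group_hom F F \<phi>" and t: "t \<in> carrier G"
    and semi: "\<And>f. f \<in> carrier F \<Longrightarrow> \<beta> f \<otimes>\<^bsub>G\<^esub> t = t \<otimes>\<^bsub>G\<^esub> \<beta> (\<phi> f)"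
    and f: "f \<in> carrier F"
  shows "\<beta> f \<otimes>\<^bsub>G\<^esub> t [^]\<^bsub>G\<^esub> (m::nat) = t [^]\<^bsub>G\<^esub> m \<otimes>\<^bsub>G\<^esub> \<beta> ((\<phi> ^^ m) f)"
proof -
  interpret b: group_hom F G \<beta> by fact
  interpret p: group_hom F F \<phi> by fact
  have closed: "(\<phi> ^^ i) g \<in> carrier F" if "g \<in> carrier F" for i g
    using that by (induction i) auto
  show ?thesis
    using f
  proof (induction m arbitrary: f)
    case (Suc m)
    have "\<beta> f \<otimes>\<^bsub>G\<^esub> t [^]\<^bsub>G\<^esub> Suc m = \<beta> f \<otimes>\<^bsub>G\<^esub> (t \<otimes>\<^bsub>G\<^esub> t [^]\<^bsub>G\<^esub> m)"
      using b.H.nat_pow_Suc2[OF t] by simp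
    also have "\<dots> = t \<otimes>\<^bsub>G\<^esub> (\<beta> (\<phi> f) \<otimes>\<^bsub>G\<^esub> t [^]\<^bsub>G\<^esub> m)"
      using semi[OF Suc.prems] Suc.prems t by (simp add: b.H.m_assoc[symmetric])
    also have "\<dots> = (t \<otimes>\<^bsub>G\<^esub> t [^]\<^bsub>G\<^esub> m) \<otimes>\<^bsub>G\<^esub> \<beta> ((\<phi> ^^ m) (\<phi> f))"
      using Suc.IH[of "\<phi> f"] Suc.prems t closed[of "\<phi> f" m] by (simp add: b.H.m_assoc)
    finally show ?case using b.H.nat_pow_Suc2[OF t, of m] by (simp add: funpow_swap1)
  qed auto
qed

text \<open>The properties of the HNN extension on which the rest is built; the presentation serves
  to produce an instance. \<open>normal_form\<close> asserts existence, while injectivity of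
  \<open>\<beta>\<close> and the degree \<open>\<delta>\<close>, the exponent sum of
  \<open>t\<close>, supply the needed uniqueness.\<close>

locale ascending_ext = F: group F + G: group G
  for F :: "('a, 'm) monoid_scheme" and G :: "('g, 'n) monoid_scheme" (structure) +
  fixes \<phi> :: "'a \<Rightarrow> 'a" and \<beta> :: "'a \<Rightarrow> 'g" and t :: 'g and \<delta> :: "'g \<Rightarrow> int"
  assumes phi_hom: "\<phi> \<in> hom F F" and phi_inj: "inj_on \<phi> (carrier F)"
    and beta_hom: "\<beta> \<in> hom F G" and beta_inj: "inj_on \<beta> (carrier F)"
    and t_closed [simp, intro]: "t \<in> carrier G"
    and beta_t: "f \<in> carrier F \<Longrightarrow> \<beta> f \<otimes> t = t \<otimes> \<beta> (\<phi> f)"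
    and normal_form: "g \<in> carrier G \<Longrightarrow>
      \<exists>(m::nat) (n::nat). \<exists>f\<in>carrier F. g = t [^] m \<otimes> \<beta> f \<otimes> inv (t [^] n)"
    and degree_hom: "\<delta> \<in> hom G integer_group"
    and degree_t [simp]: "\<delta> t = 1"
    and degree_beta [simp]: "f \<in> carrier F \<Longrightarrow> \<delta> (\<beta> f) = 0"

definition hnn_gens :: "('a, 'm) monoid_scheme \<Rightarrow> 'a hnn_gen set" where
  "hnn_gens F = insert Stable (Base ` carrier F)"

definition hnn_rels ::
  "('a, 'm) monoid_scheme \<Rightarrow> ('a \<Rightarrow> 'a) \<Rightarrow> ('a hnn_gen word \<times> 'a hnn_gen word) set" where
  "hnn_rels F \<phi> =
     {([(Base f, True), (Base g, True)], [(Base (f \<otimes>\<^bsub>F\<^esub> g), True)]) | f g.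
        f \<in> carrier F \<and> g \<in> carrier F} \<union>
     {([(Stable, False), (Base f, True), (Stable, True)], [(Base (\<phi> f), True)]) | f.
        f \<in> carrier F}"

lemma ascending_HNN_eq: "ascending_HNN F \<phi> = presented_group (hnn_gens F) (hnn_rels F \<phi>)"
  by (simp add: ascending_HNN_def hnn_gens_def hnn_rels_def)

definition degree_word :: "'a hnn_gen word \<Rightarrow> int" where
  "degree_word w = (\<Sum>(x, b)\<leftarrow>w. if x = Stable then if b then 1 else - 1 else 0)"

lemma degree_word_cong:
  "(u, v) \<in> word_cong (hnn_gens F) (hnn_rels F \<phi>) \<Longrightarrow> degree_word u = degree_word v"
  by (induction rule: word_cong.induct) (auto simp: degree_word_def hnn_rels_def)

text \<open>The words act on the germs at infinity of the sequences in \<open>F\<close>: the element \<open>f\<close> of \<open>F\<close> acts by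
  left multiplication with \<open>(\<phi>\<^sup>i f)\<^sub>i\<close> and the stable letter by the shift, which is invertible on
  germs. This shows that \<open>F\<close> embeds into the extension.\<close>

context
  fixes F :: "('a, 'm) monoid_scheme" and \<phi> :: "'a \<Rightarrow> 'a"
  assumes F: "group F" and \<phi>: "\<phi> \<in> hom F F" "inj_on \<phi> (carrier F)"
begin

interpretation F: group F by (rule F)
interpretation \<phi>: group_hom F F \<phi>
  by (intro group_hom.intro group_hom_axioms.intro F \<phi>)

fun act_letter :: "'a hnn_gen \<times> bool \<Rightarrow> (nat \<Rightarrow> 'a) \<Rightarrow> nat \<Rightarrow> 'a" where
  "act_letter (Base f, True) x = (\<lambda>i. (\<phi> ^^ i) f \<otimes>\<^bsub>F\<^esub> x i)"
| "act_letter (Base f, False) x = (\<lambda>i. inv\<^bsub>F\<^esub> ((\<phi> ^^ i) f) \<otimes>\<^bsub>F\<^esub> x i)"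
| "act_letter (Stable, True) x = (\<lambda>i. x (i - 1))"
| "act_letter (Stable, False) x = (\<lambda>i. x (Suc i))"

definition act_word :: "'a hnn_gen word \<Rightarrow> (nat \<Rightarrow> 'a) \<Rightarrow> nat \<Rightarrow> 'a" where
  "act_word w x = foldr act_letter w x"

lemma funpow_closed: "f \<in> carrier F \<Longrightarrow> (\<phi> ^^ i) f \<in> carrier F"
  by (induction i) auto

lemma funpow_mult:
  "f \<in> carrier F \<Longrightarrow> g \<in> carrier F \<Longrightarrow>
    (\<phi> ^^ i) (f \<otimes>\<^bsub>F\<^esub> g) = (\<phi> ^^ i) f \<otimes>\<^bsub>F\<^esub> (\<phi> ^^ i) g"
  by (induction i) (auto simp: funpow_closed)

lemma act_letter_closed:
  assumes "fst l \<in> hnn_gens F" "\<And>i. x i \<in> carrier F"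
  shows "act_letter l x i \<in> carrier F"
proof (cases "(l, x)" rule: act_letter.cases)
qed (use assms funpow_closed in \<open>auto simp: hnn_gens_def\<close>)

lemma act_word_closed:
  "w \<in> words (hnn_gens F) \<Longrightarrow> (\<And>i. x i \<in> carrier F) \<Longrightarrow> act_word w x i \<in> carrier F"
proof (induction w arbitrary: i)
  case (Cons l w)
  have "w \<in> words (hnn_gens F)" using Cons.prems(1) by simp
  hence "act_word w x i \<in> carrier F" for i by (rule Cons.IH) (rule Cons.prems(2))
  thus ?case using act_letter_closed[of l "act_word w x"] Cons.prems(1) by (simp add: act_word_def)
qed (simp add: act_word_def)

lemma act_word_eventually_eq:
  assumes "\<forall>\<^sub>F i in sequentially. x i = y i"
  shows "\<forall>\<^sub>F i in sequentially. act_word u x i = act_word u y i"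
proof (induction u)
  case (Cons l u)
  obtain z b where l: "l = (z, b)" by (cases l)
  have "\<forall>\<^sub>F i in sequentially. act_word u x (Suc i) = act_word u y (Suc i)"
    using Cons by (simp add: eventually_sequentially_Suc[of "\<lambda>i. act_word u x i = act_word u y i"])
  moreover have "\<forall>\<^sub>F i in sequentially. act_word u x (i - 1) = act_word u y (i - 1)"
    by (subst eventually_sequentially_Suc[symmetric]) (simp add: Cons)
  ultimately show ?case using Cons
    by (cases z; cases b) (auto simp: act_word_def l elim: eventually_mono)
qed (simp add: act_word_def assms)

text \<open>The claim is about two eventually equal sequences rather than one, because in the case
  of concatenation the inner words deliver results that are only eventually equal.\<close>

lemma act_word_cong:
  assumes "(u, v) \<in> word_cong (hnn_gens F) (hnn_rels F \<phi>)"
    and "\<forall>i. x i \<in> carrier F" "\<forall>i. y i \<in> carrier F" "\<forall>\<^sub>F i in sequentially. x i = y i"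
  shows "\<forall>\<^sub>F i in sequentially. act_word u x i = act_word v y i"
  using assms
proof (induction arbitrary: x y rule: word_cong.induct)
  case (refl u)
  thus ?case by (intro act_word_eventually_eq)
next
  case (sym u v)
  have "\<forall>\<^sub>F i in sequentially. act_word u y i = act_word v x i"
    using sym.prems by (intro sym.IH) (auto elim: eventually_mono)
  thus ?case by (auto elim: eventually_mono)
next
  case (trans u v w)
  have "\<forall>\<^sub>F i in sequentially. act_word u x i = act_word v x i"
    using trans.prems by (intro trans.IH) auto
  moreover have "\<forall>\<^sub>F i in sequentially. act_word v x i = act_word w y i"
    using trans.prems by (intro trans.IH) auto
  ultimately show ?case by eventually_elim simp
next
  case (append u v u' v')
  have "u' \<in> words (hnn_gens F)" "v' \<in> words (hnn_gens F)"
    using append.hyps word_cong_in_words by blast+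
  hence "\<forall>\<^sub>F i in sequentially. act_word u (act_word u' x) i = act_word v (act_word v' y) i"
    using append.prems by (intro append.IH) (auto intro: act_word_closed)
  thus ?case by (simp add: act_word_def)
next
  case (cancel z b)
  \<comment> \<open>At index \<open>0\<close> the truncated \<open>i - 1\<close> loses the value
    \<open>x 0\<close>, so in one order the two stable letters undo each other only at positive
    indices.\<close>
  have "\<forall>\<^sub>F i in sequentially. act_word [(z, b), (z, \<not> b)] x i = x i"
    using eventually_gt_at_top[of 0]
  proof eventually_elim
    case (elim i)
    have "inv\<^bsub>F\<^esub> u \<otimes>\<^bsub>F\<^esub> (u \<otimes>\<^bsub>F\<^esub> x i) = x i" "u \<otimes>\<^bsub>F\<^esub> (inv\<^bsub>F\<^esub> u \<otimes>\<^bsub>F\<^esub> x i) = x i"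
      if "u \<in> carrier F" for u
      using that cancel.prems(1) by (simp_all add: F.m_assoc[symmetric])
    thus ?case using elim cancel.hyps funpow_closed
      by (cases z; cases b) (auto simp: act_word_def hnn_gens_def)
  qed
  thus ?case using cancel.prems(3) by eventually_elim (simp add: act_word_def)
next
  case (rel u v)
  \<comment> \<open>The relations hold for the sequences themselves: between the two shifts,
    multiplication by \<open>\<phi>^i f\<close> becomes multiplication by
    \<open>\<phi>^(i+1) f\<close>, the action of \<open>\<phi> f\<close>.\<close>
  have "act_word u x = act_word v x"
    using rel by (auto simp: hnn_rels_def act_word_def funpow_closed funpow_mult F.m_assoc
        funpow_swap1)
  moreover have "\<forall>\<^sub>F i in sequentially. act_word v x i = act_word v y i"
    by (rule act_word_eventually_eq) fact
  ultimately show ?case by simp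
qed


text \<open>On the constant sequence of ones the letter of \<open>f\<close> produces the sequence
  \<open>\<phi>^i f\<close>, so congruent letters have a common iterate, and the iterates of
  \<open>\<phi>\<close> are injective.\<close>

lemma base_inj:
  assumes "f \<in> carrier F" "g \<in> carrier F"
    and "([(Base f, True)], [(Base g, True)]) \<in> word_cong (hnn_gens F) (hnn_rels F \<phi>)"
  shows "f = g"
proof -
  have "\<forall>\<^sub>F i in sequentially. act_word [(Base f, True)] (\<lambda>_. \<one>\<^bsub>F\<^esub>) i =
      act_word [(Base g, True)] (\<lambda>_. \<one>\<^bsub>F\<^esub>) i"
    by (rule act_word_cong[OF assms(3)]) auto
  then obtain i where "act_word [(Base f, True)] (\<lambda>_. \<one>\<^bsub>F\<^esub>) i =
      act_word [(Base g, True)] (\<lambda>_. \<one>\<^bsub>F\<^esub>) i"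
    by (auto simp: eventually_sequentially)
  hence eq: "(\<phi> ^^ i) f = (\<phi> ^^ i) g"
    using assms funpow_closed by (simp add: act_word_def)
  have "inj_on (\<phi> ^^ i) (carrier F)"
  proof (induction i)
    case (Suc i)
    have "inj_on (\<phi> \<circ> (\<phi> ^^ i)) (carrier F)"
      using Suc funpow_closed by (intro comp_inj_on inj_on_subset[OF \<phi>(2)]) auto
    thus ?case by (simp add: comp_def)
  qed simp
  thus ?thesis using eq assms by (auto dest: inj_onD)
qed

end

lemma ascending_HNN_ext:
  assumes F: "group F" and \<phi>: "\<phi> \<in> hom F F" "inj_on \<phi> (carrier F)"
  obtains \<beta> t \<delta> where "ascending_ext F (ascending_HNN F \<phi>) \<phi> \<beta> t \<delta>"
proof -
  interpret F: group F by (rule F)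
  interpret \<phi>: group_hom F F \<phi>
    by (intro group_hom.intro group_hom_axioms.intro F \<phi>)
  define X where "X = hnn_gens F"
  define R where "R = hnn_rels F \<phi>"
  define G where "G = presented_group X R"
  define c where "c u = word_cong X R `` {u}" for u
  interpret G: group G unfolding G_def by (rule group_presented_group)
  have car: "carrier G = c ` words X"
    by (auto simp: G_def c_def presented_group_def quotient_def)
  have one: "\<one>\<^bsub>G\<^esub> = c []" by (simp add: G_def c_def presented_group_def)
  have mult: "c u \<otimes>\<^bsub>G\<^esub> c v = c (u @ v)" if "u \<in> words X" "v \<in> words X" for u v
    using presented_group_mult[OF that] by (simp add: G_def c_def)
  have eqI: "c u = c v" if "(u, v) \<in> word_cong X R" for u v
    unfolding c_def by (rule equiv_class_eq[OF equiv_word_cong that])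
  have eqD: "(u, v) \<in> word_cong X R" if "c u = c v" "v \<in> words X" for u v
    using that eq_equiv_class[OF _ equiv_word_cong] by (simp add: c_def)
  define \<beta> where "\<beta> f = c [(Base f, True)]" for f
  define t where "t = c [(Stable, True)]"
  define \<delta> where "\<delta> A = degree_word (SOME u. u \<in> A)" for A :: "'a hnn_gen word set"
  have base: "Base f \<in> X" if "f \<in> carrier F" for f using that by (simp add: X_def hnn_gens_def)
  have stable: "Stable \<in> X" by (simp add: X_def hnn_gens_def)
  have bc: "\<beta> f \<in> carrier G" if "f \<in> carrier F" for f
    using that by (auto simp: car \<beta>_def base)
  have tc: "t \<in> carrier G" by (auto simp: car t_def stable)
  have inv: "c [(x, False)] = inv\<^bsub>G\<^esub> (c [(x, True)])" if "x \<in> X" for x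
  proof (rule G.inv_equality[symmetric])
    show "c [(x, False)] \<otimes>\<^bsub>G\<^esub> c [(x, True)] = \<one>\<^bsub>G\<^esub>"
      using that eqI[OF word_cong.cancel[OF that, of False]] by (simp add: mult one)
  qed (use that in \<open>auto simp: car\<close>)
  have bm: "\<beta> (f \<otimes>\<^bsub>F\<^esub> g) = \<beta> f \<otimes>\<^bsub>G\<^esub> \<beta> g" if "f \<in> carrier F" "g \<in> carrier F" for f g
  proof -
    have "([(Base f, True), (Base g, True)], [(Base (f \<otimes>\<^bsub>F\<^esub> g), True)]) \<in> word_cong X R"
      using that base by (intro word_cong.rel) (auto simp: R_def hnn_rels_def)
    from eqI[OF this] show ?thesis using that by (simp add: \<beta>_def mult base)
  qed
  hence bh: "\<beta> \<in> hom F G" by (intro homI bc)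
  interpret b: group_hom F G \<beta>
    by (intro group_hom.intro group_hom_axioms.intro F G.group_axioms bh)
  have tbt: "inv\<^bsub>G\<^esub> t \<otimes>\<^bsub>G\<^esub> \<beta> f \<otimes>\<^bsub>G\<^esub> t = \<beta> (\<phi> f)" if "f \<in> carrier F" for f
  proof -
    have "([(Stable, False), (Base f, True), (Stable, True)], [(Base (\<phi> f), True)]) \<in> word_cong X R"
      using that base stable by (intro word_cong.rel) (auto simp: R_def hnn_rels_def)
    from eqI[OF this] show ?thesis
      using that by (simp add: \<beta>_def t_def inv[symmetric] mult base stable)
  qed
  have bt: "\<beta> f \<otimes>\<^bsub>G\<^esub> t = t \<otimes>\<^bsub>G\<^esub> \<beta> (\<phi> f)" if "f \<in> carrier F" for f
  proof -
    have "t \<otimes>\<^bsub>G\<^esub> (inv\<^bsub>G\<^esub> t \<otimes>\<^bsub>G\<^esub> (\<beta> f \<otimes>\<^bsub>G\<^esub> t)) = \<beta> f \<otimes>\<^bsub>G\<^esub> t"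
      using that tc bc by (simp add: G.m_assoc[symmetric])
    thus ?thesis using tbt[OF that] that tc bc by (simp add: G.m_assoc)
  qed
  note btm = semiconj_pow[OF b.group_hom_axioms \<phi>.group_hom_axioms tc bt]
  \<comment> \<open>The new first letter is moved into place: an element of \<open>F\<close> passes
    \<open>t^m\<close> at the cost of \<open>\<phi>^m\<close>. An inverse stable letter cancels
    against \<open>t^m\<close>, or for \<open>m = 0\<close> passes the middle factor, applying
    \<open>\<phi>\<close> to it, and joins the right end.\<close>
  have nform: "\<exists>(m::nat) (n::nat). \<exists>f\<in>carrier F. c w = t [^]\<^bsub>G\<^esub> m \<otimes>\<^bsub>G\<^esub> \<beta> f \<otimes>\<^bsub>G\<^esub> inv\<^bsub>G\<^esub> (t [^]\<^bsub>G\<^esub> n)"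
    if "w \<in> words X" for w
    using that
  proof (induction w)
    case Nil
    show ?case
      by (rule exI[of _ 0], rule exI[of _ 0], rule bexI[of _ "\<one>\<^bsub>F\<^esub>"])
         (auto simp: one[symmetric])
  next
    case (Cons l w)
    then obtain m n :: nat and f where f: "f \<in> carrier F"
      "c w = t [^]\<^bsub>G\<^esub> m \<otimes>\<^bsub>G\<^esub> \<beta> f \<otimes>\<^bsub>G\<^esub> inv\<^bsub>G\<^esub> (t [^]\<^bsub>G\<^esub> n)" by auto
    obtain x b where l: "l = (x, b)" by (cases l)
    have x: "x \<in> X" and w: "w \<in> words X" using Cons.prems l by auto
    have cl: "c (l # w) = c [l] \<otimes>\<^bsub>G\<^esub> c w" using mult[of "[l]" w] x w l by simp
    have left: "\<exists>(m::nat) (n::nat). \<exists>f\<in>carrier F. \<beta> g \<otimes>\<^bsub>G\<^esub> c w =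
        t [^]\<^bsub>G\<^esub> m \<otimes>\<^bsub>G\<^esub> \<beta> f \<otimes>\<^bsub>G\<^esub> inv\<^bsub>G\<^esub> (t [^]\<^bsub>G\<^esub> n)" if g: "g \<in> carrier F" for g
    proof -
      have gm: "(\<phi> ^^ m) g \<in> carrier F" by (rule funpow_closed[OF F \<phi> g])
      have "\<beta> g \<otimes>\<^bsub>G\<^esub> c w = (\<beta> g \<otimes>\<^bsub>G\<^esub> t [^]\<^bsub>G\<^esub> m) \<otimes>\<^bsub>G\<^esub> \<beta> f \<otimes>\<^bsub>G\<^esub> inv\<^bsub>G\<^esub> (t [^]\<^bsub>G\<^esub> n)"
        using f g tc bc by (simp add: G.m_assoc)
      also have "\<dots> = t [^]\<^bsub>G\<^esub> m \<otimes>\<^bsub>G\<^esub> \<beta> ((\<phi> ^^ m) g \<otimes>\<^bsub>F\<^esub> f) \<otimes>\<^bsub>G\<^esub> inv\<^bsub>G\<^esub> (t [^]\<^bsub>G\<^esub> n)"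
        using f g gm tc bc by (simp add: btm bm G.m_assoc)
      finally show ?thesis using f gm by blast
    qed
    show ?case
    proof (cases x)
      case (Base g)
      hence g: "g \<in> carrier F" using x by (auto simp: X_def hnn_gens_def)
      have "c [l] = \<beta> (if b then g else inv\<^bsub>F\<^esub> g)"
        using inv[OF x] g by (auto simp: l Base \<beta>_def[symmetric])
      thus ?thesis using left[of "if b then g else inv\<^bsub>F\<^esub> g"] g cl by simp
    next
      case Stable
      show ?thesis
      proof (cases b)
        case True
        hence "c [l] = t" by (simp add: l Stable t_def)
        hence "c (l # w) = t [^]\<^bsub>G\<^esub> Suc m \<otimes>\<^bsub>G\<^esub> \<beta> f \<otimes>\<^bsub>G\<^esub> inv\<^bsub>G\<^esub> (t [^]\<^bsub>G\<^esub> n)"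
          unfolding cl f(2) G.nat_pow_Suc2[OF tc] using f tc bc by (simp add: G.m_assoc)
        thus ?thesis using f by blast
      next
        case False
        hence cinv: "c [l] = inv\<^bsub>G\<^esub> t" using inv[OF x] by (simp add: l Stable t_def)
        show ?thesis
        proof (cases m)
          case (Suc k)
          have "c (l # w) = inv\<^bsub>G\<^esub> t \<otimes>\<^bsub>G\<^esub> (t \<otimes>\<^bsub>G\<^esub> t [^]\<^bsub>G\<^esub> k \<otimes>\<^bsub>G\<^esub> \<beta> f \<otimes>\<^bsub>G\<^esub> inv\<^bsub>G\<^esub> (t [^]\<^bsub>G\<^esub> n))"
            unfolding cl f(2) cinv Suc G.nat_pow_Suc2[OF tc] by simp
          also have "\<dots> = t [^]\<^bsub>G\<^esub> k \<otimes>\<^bsub>G\<^esub> \<beta> f \<otimes>\<^bsub>G\<^esub> inv\<^bsub>G\<^esub> (t [^]\<^bsub>G\<^esub> n)"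
          proof -
            have "inv\<^bsub>G\<^esub> t \<otimes>\<^bsub>G\<^esub> (t \<otimes>\<^bsub>G\<^esub> y) = y" if "y \<in> carrier G" for y
              using that tc by (simp add: G.m_assoc[symmetric])
            thus ?thesis using f tc bc by (simp add: G.m_assoc)
          qed
          finally show ?thesis using f by blast
        next
          case 0
          have "inv\<^bsub>G\<^esub> t \<otimes>\<^bsub>G\<^esub> \<beta> f = \<beta> (\<phi> f) \<otimes>\<^bsub>G\<^esub> inv\<^bsub>G\<^esub> t"
            using tbt[OF f(1)] tc bc f by (simp add: G.inv_solve_right)
          hence "c (l # w) = t [^]\<^bsub>G\<^esub> (0::nat) \<otimes>\<^bsub>G\<^esub> \<beta> (\<phi> f) \<otimes>\<^bsub>G\<^esub> (inv\<^bsub>G\<^esub> t \<otimes>\<^bsub>G\<^esub> inv\<^bsub>G\<^esub> (t [^]\<^bsub>G\<^esub> n))"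
            unfolding cl f(2) cinv 0 using f tc bc by (simp add: G.m_assoc[symmetric])
          also have "inv\<^bsub>G\<^esub> t \<otimes>\<^bsub>G\<^esub> inv\<^bsub>G\<^esub> (t [^]\<^bsub>G\<^esub> n) = inv\<^bsub>G\<^esub> (t [^]\<^bsub>G\<^esub> Suc n)"
            using tc by (simp add: G.inv_mult_group)
          finally show ?thesis using f \<phi>.hom_closed by blast
        qed
      qed
    qed
  qed
  have deg: "\<delta> (c u) = degree_word u" if "u \<in> words X" for u
  proof -
    have "u \<in> c u" using that by (auto simp: c_def intro: word_cong.refl)
    hence "(SOME v. v \<in> c u) \<in> c u" by (rule someI)
    hence "(u, SOME v. v \<in> c u) \<in> word_cong X R" by (simp add: c_def)
    thus ?thesis using degree_word_cong unfolding \<delta>_def X_def R_def by metis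
  qed
  have "ascending_ext F G \<phi> \<beta> t \<delta>"
  proof (intro ascending_ext.intro ascending_ext_axioms.intro F G.group_axioms \<phi> bh tc bt)
    show "inj_on \<beta> (carrier F)"
      using base_inj[OF F \<phi>] eqD base
      by (intro inj_onI) (auto simp: \<beta>_def X_def[symmetric] R_def[symmetric])
    show "\<exists>(m::nat) (n::nat). \<exists>f\<in>carrier F. g = t [^]\<^bsub>G\<^esub> m \<otimes>\<^bsub>G\<^esub> \<beta> f \<otimes>\<^bsub>G\<^esub> inv\<^bsub>G\<^esub> (t [^]\<^bsub>G\<^esub> n)"
      if "g \<in> carrier G" for g
      using that nform by (auto simp: car)
    show "\<delta> \<in> hom G integer_group"
      by (rule homI) (auto simp: car mult deg degree_word_def integer_group_def)
    show "\<delta> t = 1" by (simp add: t_def deg stable degree_word_def)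
    show "\<delta> (\<beta> f) = 0" if "f \<in> carrier F" for f
      using that by (simp add: \<beta>_def deg base degree_word_def)
  qed
  thus thesis using that by (simp add: G_def X_def R_def ascending_HNN_eq)
qed

section \<open>The centre of an ascending HNN extension\<close>

context group
begin

lemma inv_cancel [simp]:
  assumes "x \<in> carrier G" "y \<in> carrier G"
  shows "inv x \<otimes> (x \<otimes> y) = y" "x \<otimes> (inv x \<otimes> y) = y"
  using assms by (simp_all add: m_assoc[symmetric])

lemma commute_mult:
  assumes "a \<in> carrier G" "b \<in> carrier G" "u \<in> carrier G" "a \<otimes> u = u \<otimes> a" "b \<otimes> u = u \<otimes> b"
  shows "a \<otimes> b \<otimes> u = u \<otimes> (a \<otimes> b)"
  using assms by (metis m_assoc)

lemma commute_inv:
  assumes "a \<in> carrier G" "u \<in> carrier G" "a \<otimes> u = u \<otimes> a"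
  shows "inv a \<otimes> u = u \<otimes> inv a"
proof -
  have "inv a \<otimes> u = inv a \<otimes> (u \<otimes> a) \<otimes> inv a" using assms(1,2) by (simp add: m_assoc)
  also have "\<dots> = inv a \<otimes> (a \<otimes> u) \<otimes> inv a" by (simp add: assms(3))
  also have "\<dots> = u \<otimes> inv a" using assms(1,2) by (simp add: m_assoc[symmetric])
  finally show ?thesis .
qed

lemma commute_pow:
  assumes "a \<in> carrier G" "u \<in> carrier G" "a \<otimes> u = u \<otimes> a"
  shows "a [^] (n::nat) \<otimes> u = u \<otimes> a [^] n"
  using assms by (induction n) (auto intro!: commute_mult)

lemma conjugation_hom:
  assumes "c \<in> carrier G"
  shows "group_hom G G (\<lambda>x. inv c \<otimes> x \<otimes> c)"
proof (intro group_hom.intro group_hom_axioms.intro is_group homI)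
  fix x y assume xy: "x \<in> carrier G" "y \<in> carrier G"
  thus "inv c \<otimes> (x \<otimes> y) \<otimes> c = inv c \<otimes> x \<otimes> c \<otimes> (inv c \<otimes> y \<otimes> c)"
    using assms by (simp add: m_assoc)
qed (use assms in auto)

lemma conjugation_inj:
  assumes "c \<in> carrier G" "x \<in> carrier G" "y \<in> carrier G"
    and "inv c \<otimes> x \<otimes> c = inv c \<otimes> y \<otimes> c"
  shows "x = y"
proof -
  have "c \<otimes> (inv c \<otimes> x \<otimes> c) \<otimes> inv c = c \<otimes> (inv c \<otimes> y \<otimes> c) \<otimes> inv c" using assms(4) by simp
  thus ?thesis using assms(1-3) by (simp add: m_assoc)
qed

lemma conjugation_commute:
  assumes "c \<in> carrier G" "x \<in> carrier G" "c \<otimes> x = x \<otimes> c"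
  shows "inv c \<otimes> x \<otimes> c = x"
  using assms(1,2) by (simp add: m_assoc assms(3)[symmetric])

end

definition central :: "('g, 'n) monoid_scheme \<Rightarrow> 'g \<Rightarrow> bool" where
  "central G z \<longleftrightarrow> z \<in> carrier G \<and> (\<forall>g\<in>carrier G. z \<otimes>\<^bsub>G\<^esub> g = g \<otimes>\<^bsub>G\<^esub> z)"

lemma (in group) central_one: "central G \<one>"
  by (simp add: central_def)

lemma (in group) central_mult: "central G a \<Longrightarrow> central G b \<Longrightarrow> central G (a \<otimes> b)"
  unfolding central_def by (meson commute_mult m_closed)

lemma (in group) central_inv: "central G a \<Longrightarrow> central G (inv a)"
  by (auto simp: central_def commute_inv)

lemma (in group) central_int_pow: "central G a \<Longrightarrow> central G (a [^] (n::int))"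
proof -
  assume a: "central G a"
  have "central G (a [^] (m::nat))" for m
    by (induction m) (simp_all add: central_one central_mult a)
  moreover have "a \<in> carrier G" using a by (simp add: central_def)
  ultimately show ?thesis
    by (cases n rule: int_cases2) (simp_all add: int_pow_int int_pow_neg_int central_inv)
qed

context ascending_ext
begin

sublocale phi: group_hom F F \<phi>
  by (intro group_hom.intro group_hom_axioms.intro F.group_axioms phi_hom)

sublocale beta: group_hom F G \<beta>
  by (intro group_hom.intro group_hom_axioms.intro F.group_axioms G.group_axioms beta_hom)

sublocale degree: group_hom G integer_group \<delta>
  by (intro group_hom.intro group_hom_axioms.intro G.group_axioms group_integer_group degree_hom)

lemma degree_mult [simp]: "g \<in> carrier G \<Longrightarrow> h \<in> carrier G \<Longrightarrow> \<delta> (g \<otimes> h) = \<delta> g + \<delta> h"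
  using degree.hom_mult by simp

lemma degree_one [simp]: "\<delta> \<one> = 0"
  using degree.hom_one by simp

lemma degree_inv [simp]: "g \<in> carrier G \<Longrightarrow> \<delta> (inv g) = - \<delta> g"
  using degree.hom_inv by simp

lemma degree_pow [simp]: "g \<in> carrier G \<Longrightarrow> \<delta> (g [^] (n::nat)) = int n * \<delta> g"
  by (induction n) (simp_all add: algebra_simps)

lemma degree_int_pow [simp]: "g \<in> carrier G \<Longrightarrow> \<delta> (g [^] (n::int)) = n * \<delta> g"
  by (cases n rule: int_cases2) (simp_all add: int_pow_int G.int_pow_neg_int)

lemma beta_eq_iff: "x \<in> carrier F \<Longrightarrow> y \<in> carrier F \<Longrightarrow> \<beta> x = \<beta> y \<longleftrightarrow> x = y"
  by (rule inj_on_eq_iff[OF beta_inj])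

lemma funpow_phi_hom: "group_hom F F (\<phi> ^^ n)"
proof (induction n)
  case 0
  show ?case by (intro group_hom.intro group_hom_axioms.intro F.group_axioms homI) simp_all
next
  case (Suc n)
  interpret h: group_hom F F "\<phi> ^^ n" by (rule Suc)
  show ?case by (intro group_hom.intro group_hom_axioms.intro F.group_axioms homI) simp_all
qed

lemma funpow_phi_closed [simp]: "f \<in> carrier F \<Longrightarrow> (\<phi> ^^ n) f \<in> carrier F"
  using group_hom.hom_closed[OF funpow_phi_hom] .

lemma funpow_phi_inj: "inj_on (\<phi> ^^ n) (carrier F)"
proof (induction n)
  case (Suc n)
  have "inj_on (\<phi> \<circ> (\<phi> ^^ n)) (carrier F)"
    using Suc by (intro comp_inj_on inj_on_subset[OF phi_inj]) auto
  thus ?case by (simp add: comp_def)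
qed simp

lemma beta_t_pow: "f \<in> carrier F \<Longrightarrow> \<beta> f \<otimes> t [^] (n::nat) = t [^] n \<otimes> \<beta> ((\<phi> ^^ n) f)"
  by (rule semiconj_pow[OF beta.group_hom_axioms phi.group_hom_axioms t_closed beta_t])

lemma conj_beta: "f \<in> carrier F \<Longrightarrow> inv (t [^] (n::nat)) \<otimes> \<beta> f \<otimes> t [^] n = \<beta> ((\<phi> ^^ n) f)"
  using beta_t_pow[of f n] by (simp add: G.m_assoc)

text \<open>Degree zero forces equal exponents in the normal form, so \<open>g\<close> lies in the
  ascending union of the groups \<open>t^n F t^-n\<close>. The form with all large \<open>k\<close>
  lets one \<open>k\<close> serve finitely many elements.\<close>

lemma degree_zero_conj:
  assumes g: "g \<in> carrier G" "\<delta> g = 0"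
  shows "\<exists>n. \<forall>k::nat. k \<ge> n \<longrightarrow> (\<exists>f\<in>carrier F. inv (t [^] k) \<otimes> g \<otimes> t [^] k = \<beta> f)"
proof -
  obtain m n :: nat and f where f: "f \<in> carrier F" "g = t [^] m \<otimes> \<beta> f \<otimes> inv (t [^] n)"
    using normal_form[OF g(1)] by blast
  have "int m = int n" using g(2) f by simp
  hence eq: "g = t [^] n \<otimes> \<beta> f \<otimes> inv (t [^] n)" using f by simp
  have "\<exists>f\<in>carrier F. inv (t [^] k) \<otimes> g \<otimes> t [^] k = \<beta> f" if "k \<ge> n" for k :: nat
  proof -
    obtain j where k: "k = n + j" using \<open>k \<ge> n\<close> le_Suc_ex by blast
    have tk: "t [^] k = t [^] n \<otimes> t [^] j" by (simp add: k G.nat_pow_mult)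
    have "inv (t [^] k) \<otimes> g \<otimes> t [^] k =
        inv (t [^] j) \<otimes> (inv (t [^] n) \<otimes> t [^] n) \<otimes> \<beta> f \<otimes> (inv (t [^] n) \<otimes> t [^] n) \<otimes> t [^] j"
      using f(1) by (simp add: eq tk G.inv_mult_group G.m_assoc del: G.l_inv G.r_inv)
    also have "\<dots> = \<beta> ((\<phi> ^^ j) f)" using f(1) conj_beta by simp
    finally show ?thesis using f(1) by auto
  qed
  thus ?thesis by blast
qed

end

locale free_ascending_ext = ascending_ext +
  assumes free: "free_group F" and nonabelian: "\<not> comm_group F"
begin

lemma noncommuting:
  obtains p q where "p \<in> carrier F" "q \<in> carrier F" "p \<otimes>\<^bsub>F\<^esub> q \<noteq> q \<otimes>\<^bsub>F\<^esub> p"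
  using F.group_comm_groupI nonabelian by blast

text \<open>A nontrivial \<open>h\<close> would make the image of \<open>\<phi>^n\<close>
  commutative, by transitivity of commutation, and then \<open>F\<close> too because the iterate is
  injective.\<close>

lemma centralizes_image_trivial:
  assumes h: "h \<in> carrier F"
    and comm: "\<And>x. x \<in> carrier F \<Longrightarrow> (\<phi> ^^ n) x \<otimes>\<^bsub>F\<^esub> h = h \<otimes>\<^bsub>F\<^esub> (\<phi> ^^ n) x"
  shows "h = \<one>\<^bsub>F\<^esub>"
proof (rule ccontr)
  assume ne: "h \<noteq> \<one>\<^bsub>F\<^esub>"
  obtain p q where pq: "p \<in> carrier F" "q \<in> carrier F" "p \<otimes>\<^bsub>F\<^esub> q \<noteq> q \<otimes>\<^bsub>F\<^esub> p" by (rule noncommuting)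
  interpret h: group_hom F F "\<phi> ^^ n" by (rule funpow_phi_hom)
  have "(\<phi> ^^ n) p \<otimes>\<^bsub>F\<^esub> (\<phi> ^^ n) q = (\<phi> ^^ n) q \<otimes>\<^bsub>F\<^esub> (\<phi> ^^ n) p"
    by (rule free_group_commute_trans[OF free h ne funpow_phi_closed[OF pq(1)] comm[OF pq(1)]
          funpow_phi_closed[OF pq(2)] comm[OF pq(2)]])
  hence "(\<phi> ^^ n) (p \<otimes>\<^bsub>F\<^esub> q) = (\<phi> ^^ n) (q \<otimes>\<^bsub>F\<^esub> p)"
    by (simp only: h.hom_mult[OF pq(1,2)] h.hom_mult[OF pq(2,1)])
  hence "p \<otimes>\<^bsub>F\<^esub> q = q \<otimes>\<^bsub>F\<^esub> p"
    using inj_onD[OF funpow_phi_inj] pq F.m_closed by metis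
  thus False using pq by simp
qed

text \<open>Conjugation by \<open>t^k\<close> moves \<open>a\<close> into \<open>F\<close>, while
  the centralised image of \<open>\<phi>^n\<close> only shrinks to that of
  \<open>\<phi>^(k+n)\<close>.\<close>

lemma degree_zero_trivial:
  assumes a: "a \<in> carrier G" "\<delta> a = 0"
    and comm: "\<And>x. x \<in> carrier F \<Longrightarrow> \<beta> ((\<phi> ^^ n) x) \<otimes> a = a \<otimes> \<beta> ((\<phi> ^^ n) x)"
  shows "a = \<one>"
proof -
  obtain k h where h: "h \<in> carrier F" "inv (t [^] (k::nat)) \<otimes> a \<otimes> t [^] k = \<beta> h"
    using degree_zero_conj[OF a] by blast
  interpret c: group_hom G G "\<lambda>x. inv (t [^] k) \<otimes> x \<otimes> t [^] k"
    by (rule G.conjugation_hom) simp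
  have "(\<phi> ^^ (k + n)) x \<otimes>\<^bsub>F\<^esub> h = h \<otimes>\<^bsub>F\<^esub> (\<phi> ^^ (k + n)) x" if x: "x \<in> carrier F" for x
  proof -
    have "\<beta> ((\<phi> ^^ (k + n)) x) = inv (t [^] k) \<otimes> \<beta> ((\<phi> ^^ n) x) \<otimes> t [^] k"
      using x by (simp add: conj_beta funpow_add)
    hence "\<beta> ((\<phi> ^^ (k + n)) x) \<otimes> \<beta> h = \<beta> h \<otimes> \<beta> ((\<phi> ^^ (k + n)) x)"
      using comm[OF x] c.hom_mult[of "\<beta> ((\<phi> ^^ n) x)" a] c.hom_mult[of a "\<beta> ((\<phi> ^^ n) x)"] x a(1)
      by (simp add: h(2))
    hence "\<beta> ((\<phi> ^^ (k + n)) x \<otimes>\<^bsub>F\<^esub> h) = \<beta> (h \<otimes>\<^bsub>F\<^esub> (\<phi> ^^ (k + n)) x)" using x h(1) by simp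
    thus ?thesis using x h(1) beta_eq_iff by (metis F.m_closed funpow_phi_closed)
  qed
  hence "h = \<one>\<^bsub>F\<^esub>" by (rule centralizes_image_trivial[OF h(1)])
  hence "inv (t [^] k) \<otimes> a \<otimes> t [^] k = inv (t [^] k) \<otimes> \<one> \<otimes> t [^] k" using h(2) by simp
  thus ?thesis by (rule G.conjugation_inj[rotated 3]) (use a in auto)
qed

text \<open>The conjugate of \<open>\<beta> y\<close> by \<open>u\<close> has the same
  \<open>m\<close>-th power as \<open>\<beta> y\<close>. It has degree zero, so a power of
  \<open>t\<close> moves both into \<open>F\<close>, where roots are unique.\<close>

lemma commute_root:
  fixes m :: nat
  assumes y: "y \<in> carrier F" and u: "u \<in> carrier G" and m: "m > 0"
    and comm: "u \<otimes> \<beta> y [^] m = \<beta> y [^] m \<otimes> u"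
  shows "u \<otimes> \<beta> y = \<beta> y \<otimes> u"
proof -
  define x where "x = inv u \<otimes> \<beta> y \<otimes> u"
  interpret cu: group_hom G G "\<lambda>x. inv u \<otimes> x \<otimes> u" by (rule G.conjugation_hom[OF u])
  have x: "x \<in> carrier G" "\<delta> x = 0" using u y by (auto simp: x_def)
  have xm: "x [^] m = \<beta> y [^] m"
    using cu.hom_nat_pow[of "\<beta> y" m] G.conjugation_commute[OF u _ comm] y by (simp add: x_def)
  obtain k f where f: "f \<in> carrier F" "inv (t [^] (k::nat)) \<otimes> x \<otimes> t [^] k = \<beta> f"
    using degree_zero_conj[OF x] by blast
  interpret c: group_hom G G "\<lambda>x. inv (t [^] k) \<otimes> x \<otimes> t [^] k"
    by (rule G.conjugation_hom) simp
  have "\<beta> f [^] m = \<beta> ((\<phi> ^^ k) y) [^] m"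
    using c.hom_nat_pow[of x m] c.hom_nat_pow[of "\<beta> y" m] x y
    by (simp add: f(2) xm conj_beta)
  hence "\<beta> (f [^]\<^bsub>F\<^esub> m) = \<beta> ((\<phi> ^^ k) y [^]\<^bsub>F\<^esub> m)"
    using f y beta.hom_nat_pow by simp
  hence "f [^]\<^bsub>F\<^esub> m = (\<phi> ^^ k) y [^]\<^bsub>F\<^esub> m" using f y beta_eq_iff by simp
  hence "f = (\<phi> ^^ k) y" using free_group_root_unique[OF free f(1) _ m] y by simp
  hence "inv (t [^] k) \<otimes> x \<otimes> t [^] k = inv (t [^] k) \<otimes> \<beta> y \<otimes> t [^] k"
    using f y by (simp add: conj_beta)
  hence "x = \<beta> y" by (rule G.conjugation_inj[rotated 3]) (use x y in simp_all)
  hence "u \<otimes> (inv u \<otimes> \<beta> y \<otimes> u) = u \<otimes> \<beta> y" by (simp add: x_def)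
  thus ?thesis using u y by (simp add: G.m_assoc)
qed

text \<open>If \<open>u\<close> centralises \<open>F\<close>, then the commutator of \<open>u\<close> and \<open>t\<close> has degree \<open>0\<close> and centralises
  \<open>\<phi> F\<close>, so it is trivial.\<close>

lemma centralizes_base_central:
  assumes u: "u \<in> carrier G"
    and comm: "\<And>x. x \<in> carrier F \<Longrightarrow> \<beta> x \<otimes> u = u \<otimes> \<beta> x"
  shows "central G u"
proof -
  define v where "v = inv t \<otimes> u \<otimes> t"
  have v: "v \<in> carrier G" using u by (simp add: v_def)
  interpret c: group_hom G G "\<lambda>x. inv t \<otimes> x \<otimes> t" by (rule G.conjugation_hom) simp
  have "inv u \<otimes> v = \<one>"
  proof (rule degree_zero_trivial[of _ 1])
    show "\<beta> ((\<phi> ^^ 1) x) \<otimes> (inv u \<otimes> v) = inv u \<otimes> v \<otimes> \<beta> ((\<phi> ^^ 1) x)" if x: "x \<in> carrier F" for x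
    proof -
      have "inv t \<otimes> \<beta> x \<otimes> t = \<beta> (\<phi> x)" using conj_beta[OF x, of 1] by simp
      hence "v \<otimes> \<beta> (\<phi> x) = \<beta> (\<phi> x) \<otimes> v"
        using c.hom_mult[of u "\<beta> x"] c.hom_mult[of "\<beta> x" u] comm[OF x] x u by (simp add: v_def)
      moreover have "inv u \<otimes> \<beta> (\<phi> x) = \<beta> (\<phi> x) \<otimes> inv u"
        using x u by (intro G.commute_inv) (auto simp: comm)
      ultimately show ?thesis using G.commute_mult[of "inv u" v "\<beta> (\<phi> x)"] u v x by simp
    qed
  qed (use u in \<open>auto simp: v_def\<close>)
  hence "v = u" using u v by (metis G.inv_closed G.inv_equality G.inv_inv)
  hence "t \<otimes> (inv t \<otimes> u \<otimes> t) = t \<otimes> u" by (simp add: v_def)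
  hence ut: "t \<otimes> u = u \<otimes> t" using u by (simp add: G.m_assoc)
  have "g \<otimes> u = u \<otimes> g" if g: "g \<in> carrier G" for g
  proof -
    obtain m n :: nat and f where f: "f \<in> carrier F" "g = t [^] m \<otimes> \<beta> f \<otimes> inv (t [^] n)"
      using normal_form[OF g] by blast
    show ?thesis unfolding f(2) using f(1) u ut comm
      by (intro G.commute_mult G.commute_inv G.commute_pow) auto
  qed
  thus ?thesis using u by (auto simp: central_def)
qed

lemma noncentral_noncommuting:
  assumes "u \<in> carrier G" "\<not> central G u"
  obtains y where "y \<in> carrier F" "\<beta> y \<otimes> u \<noteq> u \<otimes> \<beta> y"
  using centralizes_base_central assms by blast

text \<open>If the centralizer of \<open>g\<close> has finite index, two powers of any
  \<open>x\<close> in \<open>F\<close> lie in one of its cosets, so a positive power of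
  \<open>x\<close> commutes with \<open>g\<close>, and by \<open>commute_root\<close> so does
  \<open>x\<close>. Commuting with \<open>F\<close> implies being central.\<close>

lemma FC_center_eq: "FC_center G = {g. central G g}"
proof (intro Set.set_eqI iffI)
  fix g assume "g \<in> FC_center G"
  hence g: "g \<in> carrier G" and fin: "finite (rcosets (centralizer G g))"
    by (auto simp: FC_center_def)
  have sub: "subgroup (centralizer G g) G"
    using g by (intro G.subgroupI)
      (auto simp: centralizer_def intro!: G.commute_mult G.commute_inv exI[of _ "\<one>"])
  have "\<beta> x \<otimes> g = g \<otimes> \<beta> x" if x: "x \<in> carrier F" for x
  proof -
    let ?f = "\<lambda>i::nat. centralizer G g #> (\<beta> x [^] i)"
    have "range ?f \<subseteq> rcosets (centralizer G g)" 
      using x G.rcosetsI[OF subgroup.subset[OF sub]] by auto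
    hence "finite (range ?f)" using fin finite_subset by blast
    hence "\<not> inj ?f" using finite_imageD by blast
    then obtain i j where ij: "i < j" "?f i = ?f j" by (auto simp: inj_def neq_iff)
    have "\<beta> x [^] j \<in> ?f j" by (rule G.rcos_self[OF _ sub]) (use x in simp)
    hence "\<beta> x [^] j \<in> ?f i" by (simp only: ij(2))
    then obtain c where c: "c \<in> centralizer G g" "\<beta> x [^] j = c \<otimes> \<beta> x [^] i"
      by (auto simp: r_coset_def)
    have "\<beta> x [^] (j - i) \<otimes> \<beta> x [^] i = \<beta> x [^] j" using ij x by (simp add: G.nat_pow_mult)
    hence "\<beta> x [^] (j - i) = c" using c x by (simp add: centralizer_def)
    hence "g \<otimes> \<beta> x [^] (j - i) = \<beta> x [^] (j - i) \<otimes> g" using c by (simp add: centralizer_def)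
    thus ?thesis using commute_root[OF x g, of "j - i"] ij by simp
  qed
  thus "g \<in> {g. central G g}" using centralizes_base_central[OF g] by simp
next
  fix g assume "g \<in> {g. central G g}"
  hence g: "g \<in> carrier G" "centralizer G g = carrier G"
    by (auto simp: central_def centralizer_def)
  have "carrier G #> a = carrier G" if "a \<in> carrier G" for a
    using G.coset_join2[OF that G.subgroup_self that] .
  hence "rcosets (carrier G) \<subseteq> {carrier G}" by (auto simp: RCOSETS_def)
  thus "g \<in> FC_center G" using g by (simp add: FC_center_def finite_subset)
qed

lemma central_degree_zero: "central G z \<Longrightarrow> \<delta> z = 0 \<Longrightarrow> z = \<one>"
  by (rule degree_zero_trivial[of _ 0]) (auto simp: central_def)

text \<open>A central element of positive degree can be brought to the form \<open>t^k f\<close>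
  with \<open>k > 0\<close>. Commuting with \<open>F\<close> then makes \<open>\<phi>^k\<close> an
  inner automorphism of \<open>F\<close>.\<close>

lemma central_imp_surj:
  assumes z: "central G z" "z \<noteq> \<one>"
  shows "\<phi> ` carrier F = carrier F"
proof -
  have "\<exists>z. central G z \<and> \<delta> z > 0"
  proof (cases "\<delta> z > 0")
    case False
    hence "\<delta> (inv z) > 0" using central_degree_zero z by (force simp: central_def)
    thus ?thesis using G.central_inv[OF z(1)] by blast
  qed (use z in blast)
  then obtain z where z: "central G z" "\<delta> z > 0" by blast
  have zc: "z \<in> carrier G" using z by (simp add: central_def)
  obtain m n :: nat and f where f: "f \<in> carrier F" "z = t [^] m \<otimes> \<beta> f \<otimes> inv (t [^] n)"
    using normal_form[OF zc] by blast
  have mn: "m > n" using z(2) f by simp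
  define k where "k = m - n"
  \<comment> \<open>Centrality allows the trailing inverse power of \<open>t\<close> to be
    conjugated to the front, where it shortens \<open>t^m\<close>.\<close>
  have "z = inv (t [^] n) \<otimes> z \<otimes> t [^] n"
    using z(1) by (intro G.conjugation_commute[symmetric]) (auto simp: central_def)
  also have "\<dots> = inv (t [^] n) \<otimes> (t [^] n \<otimes> t [^] k) \<otimes> \<beta> f \<otimes> (inv (t [^] n) \<otimes> t [^] n)"
    using f(1) mn by (simp add: f(2) k_def G.nat_pow_mult G.m_assoc del: G.l_inv)
  also have "\<dots> = t [^] k \<otimes> \<beta> f"
    using f(1) by (simp add: G.m_assoc[symmetric])
  finally have zk: "z = t [^] k \<otimes> \<beta> f" .
  have "y \<in> \<phi> ` carrier F" if y: "y \<in> carrier F" for y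
  proof -
    define x where "x = inv\<^bsub>F\<^esub> f \<otimes>\<^bsub>F\<^esub> y \<otimes>\<^bsub>F\<^esub> f"
    have x: "x \<in> carrier F" using y f by (simp add: x_def)
    have "t [^] k \<otimes> (\<beta> f \<otimes> \<beta> x) = \<beta> x \<otimes> (t [^] k \<otimes> \<beta> f)"
      using z(1) x f(1) by (simp add: zk central_def G.m_assoc)
    also have "\<dots> = t [^] k \<otimes> (\<beta> ((\<phi> ^^ k) x) \<otimes> \<beta> f)"
      using x f(1) beta_t_pow[OF x, of k] by (simp add: G.m_assoc[symmetric])
    finally have "\<beta> (f \<otimes>\<^bsub>F\<^esub> x) = \<beta> ((\<phi> ^^ k) x \<otimes>\<^bsub>F\<^esub> f)"
      using x f(1) by simp
    hence "f \<otimes>\<^bsub>F\<^esub> x = (\<phi> ^^ k) x \<otimes>\<^bsub>F\<^esub> f"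
      by (rule beta_eq_iff[THEN iffD1, rotated 2]) (use x f(1) in simp_all)
    moreover have "f \<otimes>\<^bsub>F\<^esub> x = y \<otimes>\<^bsub>F\<^esub> f"
      using y f(1) by (simp add: x_def F.m_assoc[symmetric])
    ultimately have "y = (\<phi> ^^ k) x" using x y f(1) by simp
    moreover have "k = Suc (k - 1)" using mn by (simp add: k_def)
    ultimately have "y = \<phi> ((\<phi> ^^ (k - 1)) x)" by (metis funpow.simps(2) o_apply)
    thus ?thesis using x by simp
  qed
  thus ?thesis by auto
qed

lemma degree_zero_base:
  assumes surj: "\<phi> ` carrier F = carrier F" and g: "g \<in> carrier G" "\<delta> g = 0"
  shows "\<exists>f\<in>carrier F. g = \<beta> f"
proof -
  obtain k f where f: "f \<in> carrier F" "inv (t [^] (k::nat)) \<otimes> g \<otimes> t [^] k = \<beta> f"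
    using degree_zero_conj[OF g] by blast
  have "(\<phi> ^^ k) ` carrier F = carrier F"
  proof (induction k)
    case (Suc k)
    have "(\<phi> ^^ Suc k) ` carrier F = \<phi> ` ((\<phi> ^^ k) ` carrier F)" by (simp add: image_image)
    thus ?case using Suc surj by simp
  qed simp
  then obtain f' where f': "f' \<in> carrier F" "f = (\<phi> ^^ k) f'" using f(1) by blast
  hence "inv (t [^] k) \<otimes> g \<otimes> t [^] k = inv (t [^] k) \<otimes> \<beta> f' \<otimes> t [^] k"
    using f by (simp add: conj_beta)
  hence "g = \<beta> f'" by (rule G.conjugation_inj[rotated 3]) (use g f' in simp_all)
  thus ?thesis using f' by blast
qed

text \<open>By \<open>central_degree_zero\<close> the degree embeds the centre into the integers,
  where an element of least positive degree generates.\<close>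

lemma central_generator:
  assumes z0: "central G z0" "z0 \<noteq> \<one>"
  obtains z where "central G z" "\<delta> z > 0" "\<And>w. central G w \<Longrightarrow> \<delta> z dvd \<delta> w"
proof -
  let ?P = "\<lambda>k::nat. k > 0 \<and> (\<exists>z. central G z \<and> \<delta> z = int k)"
  have "\<exists>k. ?P k"
  proof (cases "\<delta> z0 > 0")
    case True
    thus ?thesis using z0 by (intro exI[of _ "nat (\<delta> z0)"]) auto
  next
    case False
    hence "\<delta> (inv z0) > 0" using central_degree_zero z0 by (force simp: central_def)
    thus ?thesis using G.central_inv[OF z0(1)] by (intro exI[of _ "nat (\<delta> (inv z0))"]) force
  qed
  hence P: "?P (LEAST k. ?P k)" by (rule LeastI_ex)
  then obtain z where z: "central G z" "\<delta> z = int (LEAST k. ?P k)" "\<delta> z > 0" by auto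
  have zc: "z \<in> carrier G" using z by (simp add: central_def)
  have "\<delta> z dvd \<delta> w" if w: "central G w" for w
  proof (rule ccontr)
    assume nd: "\<not> \<delta> z dvd \<delta> w"
    define v where "v = w \<otimes> z [^] (- (\<delta> w div \<delta> z))"
    have wc: "w \<in> carrier G" using w by (simp add: central_def)
    have v: "central G v" unfolding v_def by (intro G.central_mult w G.central_int_pow z)
    have dv: "\<delta> v = \<delta> w mod \<delta> z"
      using wc zc by (simp add: v_def minus_div_mult_eq_mod[symmetric])
    have "\<delta> v > 0" "\<delta> v < \<delta> z" using dv z(3) nd 
        pos_mod_sign[OF z(3), of "\<delta> w"] pos_mod_bound[OF z(3), of "\<delta> w"]
      by (auto simp: dvd_eq_mod_eq_0 order_less_le)
    hence "?P (nat (\<delta> v))" using v by auto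
    hence "(LEAST k. ?P k) \<le> nat (\<delta> v)" by (rule Least_le)
    thus False using z(2) \<open>\<delta> v < \<delta> z\<close> \<open>\<delta> v > 0\<close> by linarith
  qed
  thus thesis using that z by blast
qed

text \<open>The elements of \<open>F\<close> commuting with a given element form a subgroup that contains the roots of
  its elements, so a sequence \<open>x y\<^sup>k\<close> meets every coset of it at most once unless it stays in it.\<close>

lemma separating_element:
  assumes "finite I" "\<And>u v. (u, v) \<in> I \<Longrightarrow> u \<in> carrier G \<and> v \<in> carrier G \<and> \<not> central G u"
  shows "\<exists>x\<in>carrier F. \<forall>(u, v)\<in>I. \<beta> x \<otimes> u \<noteq> v \<otimes> \<beta> x"
  using assms
proof (induction I rule: finite_induct)
  case empty
  show ?case by (rule bexI[of _ "\<one>\<^bsub>F\<^esub>"]) auto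
next
  case (insert uv I)
  obtain u v where uv: "uv = (u, v)" by (cases uv)
  have u: "u \<in> carrier G" "v \<in> carrier G" "\<not> central G u" using insert.prems uv by auto
  obtain x where x: "x \<in> carrier F" "\<And>u v. (u, v) \<in> I \<Longrightarrow> \<beta> x \<otimes> u \<noteq> v \<otimes> \<beta> x"
    using insert.IH insert.prems by blast
  obtain y where y: "y \<in> carrier F" "\<beta> y \<otimes> u \<noteq> u \<otimes> \<beta> y"
    using noncentral_noncommuting[OF u(1,3)] by blast
  define xy where "xy k = x \<otimes>\<^bsub>F\<^esub> y [^]\<^bsub>F\<^esub> (k::nat)" for k
  have xyc: "xy k \<in> carrier F" for k using x y by (simp add: xy_def)
  \<comment> \<open>The exponents \<open>k\<close> for which \<open>x y^k\<close> fails on a given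
    pair. Each pair turns out to have at most one, so some exponent is good for all pairs.\<close>
  define B where "B = (\<lambda>(u', v'). {k. \<beta> (xy k) \<otimes> u' = v' \<otimes> \<beta> (xy k)})"
  have step: "k = l" if mem: "(u', v') \<in> insert uv I" and k: "k \<in> B (u', v')" and l: "l \<in> B (u', v')"
    and le: "k \<le> l" for u' v' k l
  proof (rule ccontr)
    assume "k \<noteq> l"
    hence kl: "l - k > 0" using le by simp
    have c: "u' \<in> carrier G" "v' \<in> carrier G" using insert.prems mem by auto
    let ?w = "\<beta> (xy k)" and ?d = "\<beta> y [^] (l - k)"
    have w: "?w \<in> carrier G" "?d \<in> carrier G" using xyc y by auto
    have "\<beta> (xy l) = ?w \<otimes> ?d"
    proof -
      have "y [^]\<^bsub>F\<^esub> l = y [^]\<^bsub>F\<^esub> k \<otimes>\<^bsub>F\<^esub> y [^]\<^bsub>F\<^esub> (l - k)" using le y by (simp add: F.nat_pow_mult)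
      hence "xy l = xy k \<otimes>\<^bsub>F\<^esub> y [^]\<^bsub>F\<^esub> (l - k)" using x y by (simp add: xy_def F.m_assoc)
      thus ?thesis using xyc y beta.hom_nat_pow by simp
    qed
    hence "?w \<otimes> (?d \<otimes> u') = (v' \<otimes> ?w) \<otimes> ?d"
      using l c w by (simp add: B_def G.m_assoc)
    also have "\<dots> = ?w \<otimes> (u' \<otimes> ?d)" 
      using k c w G.m_assoc[of v' ?w ?d] G.m_assoc[of ?w u' ?d] by (simp add: B_def)
    finally have "u' \<otimes> ?d = ?d \<otimes> u'" using c w by simp
    hence comm: "u' \<otimes> \<beta> y = \<beta> y \<otimes> u'" by (rule commute_root[OF y(1) c(1) kl])
    show False
    proof (cases "(u', v') = uv")
      case True
      thus False using comm y uv by simp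
    next
      case False
      hence "(u', v') \<in> I" using mem by simp
      moreover have "\<beta> x \<otimes> u' = v' \<otimes> \<beta> x"
      proof -
        let ?e = "\<beta> y [^] k"
        have e: "?e \<in> carrier G" "?w = \<beta> x \<otimes> ?e" using x y beta.hom_nat_pow by (auto simp: xy_def)
        have ue: "?e \<otimes> u' = u' \<otimes> ?e" using comm c y by (intro G.commute_pow) auto
        have "(\<beta> x \<otimes> u') \<otimes> ?e = ?w \<otimes> u'" using ue e x c by (simp add: G.m_assoc)
        also have "\<dots> = (v' \<otimes> \<beta> x) \<otimes> ?e" using k e x c by (simp add: B_def G.m_assoc)
        finally show ?thesis using e x c by simp
      qed
      ultimately show False using x(2) by blast
    qed
  qed
  have "finite (B w)" if "w \<in> insert uv I" for w
  proof -
    have "k = l" if "k \<in> B w" "l \<in> B w" for k l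
      using step[of "fst w" "snd w"] that \<open>w \<in> insert uv I\<close> by (metis nle_le prod.collapse)
    hence "B w \<subseteq> {SOME k. k \<in> B w}" by (metis insertI1 someI subsetI)
    thus ?thesis using finite_subset by blast
  qed
  hence "finite (\<Union>w\<in>insert uv I. B w)" using insert.hyps by blast
  then obtain k where "k \<notin> (\<Union>w\<in>insert uv I. B w)" using ex_new_if_finite infinite_UNIV_nat by blast
  thus ?case using xyc by (intro bexI[of _ "xy k"]) (auto simp: B_def)
qed

section \<open>Nontrivial centre and the direct product of \<open>F\<close> with the
  integers\<close>

lemma degree_dvd_decomp:
  assumes z: "central G z" "\<delta> z > 0" and g: "g \<in> carrier G" "\<delta> z dvd \<delta> g"
  shows "\<exists>f\<in>carrier F. g = \<beta> f \<otimes> z [^] (\<delta> g div \<delta> z)"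
proof -
  have zc: "z \<in> carrier G" and z1: "z \<noteq> \<one>" using z by (auto simp: central_def)
  define j where "j = \<delta> g div \<delta> z"
  have "\<delta> g = j * \<delta> z" using g(2) by (simp add: j_def)
  hence "\<delta> (g \<otimes> inv (z [^] j)) = 0" using g(1) zc by simp
  then obtain f where f: "f \<in> carrier F" "g \<otimes> inv (z [^] j) = \<beta> f"
    using degree_zero_base[OF central_imp_surj[OF z(1) z1], of "g \<otimes> inv (z [^] j)"] g zc
    by blast
  have "g = (g \<otimes> inv (z [^] j)) \<otimes> z [^] j" using g zc by (simp add: G.m_assoc)
  thus ?thesis using f by (auto simp: j_def)
qed

lemma virtually_product_if_central:
  assumes "central G z0" "z0 \<noteq> \<one>"
  shows "virtually G (F \<times>\<times> integer_group)"
proof -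
  obtain z where z: "central G z" "\<delta> z > 0" using central_generator[OF assms] by blast
  have zc: "z \<in> carrier G" using z by (simp add: central_def)
  \<comment> \<open>\<open>H\<close> is the internal product of \<open>F\<close> and the powers of
    \<open>z\<close>; the powers \<open>t^r\<close> with \<open>0 \<le> r < \<delta> z\<close>
    represent its cosets.\<close>
  define H where "H = {g \<in> carrier G. \<delta> z dvd \<delta> g}"
  have sub: "subgroup H G"
    by (rule G.subgroupI) (auto simp: H_def intro: exI[of _ "\<one>"])
  have "rcosets H \<subseteq> (\<lambda>r. H #> (t [^] r)) ` {0..<\<delta> z}"
  proof
    fix A assume "A \<in> rcosets H"
    then obtain g where g: "g \<in> carrier G" "A = H #> g" by (auto simp: RCOSETS_def)
    define r where "r = \<delta> g mod \<delta> z"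
    have "g \<otimes> inv (t [^] r) \<in> H" using g by (auto simp: H_def r_def mod_eq_dvd_iff[symmetric])
    hence "(g \<otimes> inv (t [^] r)) \<otimes> t [^] r \<in> H #> (t [^] r)" by (auto simp: r_coset_def)
    hence "g \<in> H #> (t [^] r)" using g by (simp add: G.m_assoc)
    hence "A = H #> (t [^] r)" using G.repr_independence[OF _ _ sub] g by simp
    thus "A \<in> (\<lambda>r. H #> (t [^] r)) ` {0..<\<delta> z}" using z by (auto simp: r_def)
  qed
  hence fin: "finite (rcosets H)" using finite_subset by blast
  let ?h = "\<lambda>(f, j). \<beta> f \<otimes> z [^] (j::int)"
  have zcomm: "z [^] (j::int) \<otimes> g = g \<otimes> z [^] j" if "g \<in> carrier G" for j g
    using G.central_int_pow[OF z(1), of j] that by (simp add: central_def)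
  have deg: "\<delta> (\<beta> f \<otimes> z [^] (j::int)) = j * \<delta> z" if "f \<in> carrier F" for f j
    using that zc by simp
  have "?h \<in> iso (F \<times>\<times> integer_group) (G\<lparr>carrier := H\<rparr>)"
  proof (rule isoI)
    show "?h \<in> hom (F \<times>\<times> integer_group) (G\<lparr>carrier := H\<rparr>)"
    proof (rule homI)
      fix x y assume "x \<in> carrier (F \<times>\<times> integer_group)" "y \<in> carrier (F \<times>\<times> integer_group)"
      then obtain f i f' j where xy: "x = (f, i)" "y = (f', j)" "f \<in> carrier F" "f' \<in> carrier F"
        by (cases x; cases y) auto
      have "\<beta> f \<otimes> (z [^] i \<otimes> \<beta> f') \<otimes> z [^] j = \<beta> f \<otimes> (\<beta> f' \<otimes> z [^] i) \<otimes> z [^] j"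
        using xy zcomm by simp
      thus "?h (x \<otimes>\<^bsub>F \<times>\<times> integer_group\<^esub> y) = ?h x \<otimes>\<^bsub>G\<lparr>carrier := H\<rparr>\<^esub> ?h y"
        using xy zc by (simp add: G.int_pow_mult G.m_assoc)
    qed (use zc in \<open>auto simp: H_def\<close>)
    show "bij_betw ?h (carrier (F \<times>\<times> integer_group)) (carrier (G\<lparr>carrier := H\<rparr>))"
      unfolding bij_betw_def
    proof
      show "inj_on ?h (carrier (F \<times>\<times> integer_group))"
      proof (rule inj_onI)
        fix x y assume "x \<in> carrier (F \<times>\<times> integer_group)" "y \<in> carrier (F \<times>\<times> integer_group)"
          and eq: "?h x = ?h y"
        then obtain f i f' j where xy: "x = (f, i)" "y = (f', j)" "f \<in> carrier F" "f' \<in> carrier F"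
          by (cases x; cases y) auto
        have "i * \<delta> z = j * \<delta> z" using deg[OF xy(3), of i] deg[OF xy(4), of j] eq xy by auto
        hence ij: "i = j" using z by auto
        hence "\<beta> f = \<beta> f'" using eq xy zc by simp
        thus "x = y" using xy ij beta_eq_iff by simp
      qed
      have "g \<in> ?h ` carrier (F \<times>\<times> integer_group)" if g: "g \<in> H" for g
        using degree_dvd_decomp[OF z, of g] g by (fastforce simp: H_def image_iff)
      thus "?h ` carrier (F \<times>\<times> integer_group) = carrier (G\<lparr>carrier := H\<rparr>)"
        using zc by (auto simp: H_def)
    qed
  qed
  thus ?thesis unfolding virtually_def is_iso_def using sub fin by blast
qed

text \<open>The generator of the factor of integers commutes with a subgroup of finite index, so it
  lies in the FC centre, which is the centre.\<close>

lemma central_if_virtually_product: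
  assumes "virtually G (F \<times>\<times> integer_group)"
  shows "\<exists>z. central G z \<and> z \<noteq> \<one>"
proof -
  obtain N h where N: "subgroup N G" "finite (rcosets N)"
    and h: "h \<in> iso (F \<times>\<times> integer_group) (G\<lparr>carrier := N\<rparr>)"
    using assms by (auto simp: virtually_def is_iso_def)
  interpret N: subgroup N G by (rule N)
  have hom: "h (x \<otimes>\<^bsub>F \<times>\<times> integer_group\<^esub> y) = h x \<otimes> h y"
    if "x \<in> carrier (F \<times>\<times> integer_group)" "y \<in> carrier (F \<times>\<times> integer_group)" for x y
    using h that by (auto simp: iso_def hom_def)
  have inj: "inj_on h (carrier (F \<times>\<times> integer_group))"
    and img: "h ` carrier (F \<times>\<times> integer_group) = N"
    using h by (auto simp: iso_def bij_betw_def)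
  define c where "c = h (\<one>\<^bsub>F\<^esub>, 1)"
  have cN: "c \<in> N" unfolding c_def using img by auto
  hence c: "c \<in> carrier G" by (rule N.mem_carrier)
  have comm: "n \<otimes> c = c \<otimes> n" if nN: "n \<in> N" for n
  proof -
    obtain f j where n: "f \<in> carrier F" "n = h (f, j)" using nN img by auto
    show ?thesis
      using hom[of "(f, j)" "(\<one>\<^bsub>F\<^esub>, 1)"] hom[of "(\<one>\<^bsub>F\<^esub>, 1)" "(f, j)"] n
      by (simp add: c_def add.commute)
  qed
  have "c \<noteq> \<one>"
  proof
    assume "c = \<one>"
    hence "h (\<one>\<^bsub>F\<^esub>, 2) = c" using hom[of "(\<one>\<^bsub>F\<^esub>, 1)" "(\<one>\<^bsub>F\<^esub>, 1)"] by (simp add: c_def)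
    thus False using inj_onD[OF inj, of "(\<one>\<^bsub>F\<^esub>, 2)" "(\<one>\<^bsub>F\<^esub>, 1)"] by (simp add: c_def)
  qed
  moreover have "c \<in> FC_center G"
  proof -
    let ?C = "centralizer G c"
    have sub: "subgroup ?C G"
      using c by (intro G.subgroupI)
        (auto simp: centralizer_def intro!: G.commute_mult G.commute_inv exI[of _ "\<one>"])
    \<comment> \<open>Since \<open>N\<close> lies in the centralizer, the cosets of the centralizer
      through the elements of one coset of \<open>N\<close> coincide, and every coset of the
      centralizer arises in this way.\<close>
    have "rcosets ?C \<subseteq> (\<lambda>A. \<Union>a\<in>A. ?C #> a) ` (rcosets N)"
    proof
      fix B assume "B \<in> rcosets ?C"
      then obtain g where g: "g \<in> carrier G" "B = ?C #> g" by (auto simp: RCOSETS_def)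
      have "?C #> (n \<otimes> g) = ?C #> g" if "n \<in> N" for n
      proof (rule G.repr_independence[OF _ g(1) sub, symmetric])
        show "n \<otimes> g \<in> ?C #> g"
        proof -
          have "n \<in> ?C" using comm[OF that] N.mem_carrier[OF that] by (simp add: centralizer_def)
          thus ?thesis by (auto simp: r_coset_def)
        qed
      qed
      hence "(\<Union>a\<in>N #> g. ?C #> a) = (\<Union>n\<in>N. ?C #> g)" by (simp add: r_coset_def)
      also have "N \<noteq> {}" using N.one_closed by blast
      hence "(\<Union>n\<in>N. ?C #> g) = B" using g(2) by simp
      finally have "(\<Union>a\<in>N #> g. ?C #> a) = B" .
      thus "B \<in> (\<lambda>A. \<Union>a\<in>A. ?C #> a) ` (rcosets N)"
        using G.rcosetsI[OF N.subset g(1)] by blast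
    qed
    hence "finite (rcosets ?C)" using N(2) finite_subset by blast
    thus ?thesis using c by (simp add: FC_center_def)
  qed
  ultimately show ?thesis by (auto simp: FC_center_eq)
qed

end

section \<open>A criterion for primitivity\<close>

locale right_ideal = ring R for R (structure) +
  fixes L :: "'a set"
  assumes subset: "L \<subseteq> carrier R"
    and zero_mem [simp, intro]: "\<zero> \<in> L"
    and add_mem: "x \<in> L \<Longrightarrow> y \<in> L \<Longrightarrow> x \<oplus> y \<in> L"
    and mult_mem: "x \<in> L \<Longrightarrow> r \<in> carrier R \<Longrightarrow> x \<otimes> r \<in> L"
begin

lemma mem_carrier [simp]: "x \<in> L \<Longrightarrow> x \<in> carrier R"
  using subset by blast

lemma minus_mem: "x \<in> L \<Longrightarrow> \<ominus> x \<in> L"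
  using mult_mem[of x "\<ominus> \<one>"] by (simp add: r_minus)

lemma abelian_subgroup: "abelian_subgroup L R"
proof (rule abelian_subgroupI3)
  show "additive_subgroup L R"
    by (intro additive_subgroup.intro add.subgroupI)
       (auto simp: minus_mem add_mem a_inv_def[symmetric] intro: exI[of _ \<zero>])
qed (rule abelian_group_axioms)

sublocale sub: abelian_subgroup L R
  by (rule abelian_subgroup)

lemma coset_eq_iff:
  assumes "a \<in> carrier R" "b \<in> carrier R"
  shows "L +> a = L +> b \<longleftrightarrow> a \<ominus> b \<in> L"
proof -
  have "L +> a = L +> b \<longleftrightarrow> a \<in> L +> b"
    using assms sub.a_repr_independence'[of a b] sub.a_rcos_self[of a] by auto
  also have "\<dots> \<longleftrightarrow> a \<ominus> b \<in> L"
    using sub.a_rcos_module[OF assms(2,1)] by (simp add: minus_eq)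
  finally show ?thesis .
qed

definition quot_module :: "('a, 'a set) module" where
  "quot_module = \<lparr>carrier = (\<lambda>a. L +> a) ` carrier R, monoid.mult = undefined, one = undefined,
     zero = L, add = (\<lambda>C D. C <+> D), smult = (\<lambda>r C. \<Union>c\<in>C. L +> (c \<otimes> r))\<rparr>"

lemma quot_carrier: "carrier quot_module = (\<lambda>a. L +> a) ` carrier R"
  by (simp add: quot_module_def)

lemma quot_zero: "\<zero>\<^bsub>quot_module\<^esub> = L +> \<zero>"
  using a_coset_join2[OF zero_closed sub.a_subgroup zero_mem] by (simp add: quot_module_def)

lemma quot_add:
  "a \<in> carrier R \<Longrightarrow> b \<in> carrier R \<Longrightarrow> (L +> a) \<oplus>\<^bsub>quot_module\<^esub> (L +> b) = L +> (a \<oplus> b)"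
  by (simp add: quot_module_def sub.a_rcos_sum)

lemma quot_smult:
  assumes "a \<in> carrier R" "r \<in> carrier R"
  shows "r \<odot>\<^bsub>quot_module\<^esub> (L +> a) = L +> (a \<otimes> r)"
proof -
  have "L +> (c \<otimes> r) = L +> (a \<otimes> r)" if "c \<in> L +> a" for c
  proof -
    obtain l where l: "l \<in> L" "c = l \<oplus> a" using \<open>c \<in> L +> a\<close> by (auto simp: a_r_coset_def')
    have "c \<otimes> r \<ominus> a \<otimes> r = l \<otimes> r"
      using l assms by (simp add: l_distr minus_eq a_assoc r_neg)
    thus ?thesis using l assms mult_mem by (subst coset_eq_iff) auto
  qed
  moreover have "L +> a \<noteq> {}" using sub.a_rcos_self[OF assms(1)] by blast
  ultimately show ?thesis by (simp add: quot_module_def)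
qed

lemma right_module_quot: "right_module R quot_module"
proof (intro right_module.intro right_module_axioms.intro ring_axioms abelian_groupI)
  fix x assume "x \<in> carrier quot_module"
  then obtain a where a: "a \<in> carrier R" "x = L +> a" by (auto simp: quot_carrier)
  show "\<exists>y\<in>carrier quot_module. y \<oplus>\<^bsub>quot_module\<^esub> x = \<zero>\<^bsub>quot_module\<^esub>"
    using a by (intro bexI[of _ "L +> (\<ominus> a)"]) (auto simp: quot_carrier quot_add quot_zero l_neg)
qed (auto simp: quot_carrier quot_zero quot_add quot_smult a_ac l_distr r_distr m_assoc)

end

lemma (in ring) exists_maximal_right_ideal:
  assumes "right_ideal R \<rho>" "\<one> \<notin> \<rho>"
  obtains L where "right_ideal R L" "\<rho> \<subseteq> L" "\<one> \<notin> L"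
    "\<And>L'. right_ideal R L' \<Longrightarrow> L \<subseteq> L' \<Longrightarrow> \<one> \<notin> L' \<Longrightarrow> L' = L"
proof -
  let ?A = "{L. right_ideal R L \<and> \<rho> \<subseteq> L \<and> \<one> \<notin> L}"
  have "\<exists>M\<in>?A. \<forall>X\<in>?A. M \<subseteq> X \<longrightarrow> X = M"
  proof (rule subset_Zorn_nonempty)
    show "?A \<noteq> {}" using assms by blast
    fix C assume C: "C \<noteq> {}" "subset.chain ?A C"
    have mem: "right_ideal R X" "\<rho> \<subseteq> X" "\<one> \<notin> X" if "X \<in> C" for X
      using C(2) that by (auto simp: subset_chain_def)
    have "right_ideal R (\<Union>C)"
    proof (intro right_ideal.intro right_ideal_axioms.intro ring_axioms)
      show "\<Union>C \<subseteq> carrier R" using mem(1) right_ideal.subset by blast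
      show "\<zero> \<in> \<Union>C" using C(1) mem(1) right_ideal.zero_mem by blast
      show "x \<oplus> y \<in> \<Union>C" if xy: "x \<in> \<Union>C" "y \<in> \<Union>C" for x y
      proof -
        obtain X Y where XY: "X \<in> C" "Y \<in> C" "x \<in> X" "y \<in> Y" using xy by blast
        hence "X \<subseteq> Y \<or> Y \<subseteq> X" using C(2) by (auto simp: subset_chain_def)
        thus ?thesis
        proof
          assume "X \<subseteq> Y"
          hence "x \<oplus> y \<in> Y" using XY by (intro right_ideal.add_mem[OF mem(1)]) auto
          thus ?thesis using XY by blast
        next
          assume "Y \<subseteq> X"
          hence "x \<oplus> y \<in> X" using XY by (intro right_ideal.add_mem[OF mem(1)]) auto
          thus ?thesis using XY by blast
        qed
      qed
      show "x \<otimes> r \<in> \<Union>C" if "x \<in> \<Union>C" "r \<in> carrier R" for x r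
        using that right_ideal.mult_mem[OF mem(1)] by blast
    qed
    thus "\<Union>C \<in> ?A" using mem C(1) by blast
  qed
  then obtain M where M: "right_ideal R M" "\<rho> \<subseteq> M" "\<one> \<notin> M"
      "\<forall>X. right_ideal R X \<and> \<rho> \<subseteq> X \<and> \<one> \<notin> X \<longrightarrow> M \<subseteq> X \<longrightarrow> X = M"
    by auto
  show thesis
    by (rule that[OF M(1-3)]) (use M(2,4) in blast)
qed

lemma (in ring) primitive_ringI_comaximal:
  assumes \<rho>: "right_ideal R \<rho>" "\<one> \<notin> \<rho>"
    and comaximal: "\<And>I. ideal I R \<Longrightarrow> I \<noteq> {\<zero>} \<Longrightarrow> \<exists>x\<in>I. \<exists>y\<in>\<rho>. x \<oplus> y = \<one>"
  shows "primitive_ring R"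
proof -
  obtain L where L: "right_ideal R L" "\<rho> \<subseteq> L" "\<one> \<notin> L"
    and max: "\<And>L'. right_ideal R L' \<Longrightarrow> L \<subseteq> L' \<Longrightarrow> \<one> \<notin> L' \<Longrightarrow> L' = L"
    using exists_maximal_right_ideal[OF \<rho>] by blast
  interpret L: right_ideal R L by (rule L)
  have coset_zero: "L +> a = L +> \<zero> \<longleftrightarrow> a \<in> L" if "a \<in> carrier R" for a
    using that by (simp add: L.coset_eq_iff minus_eq)
  \<comment> \<open>The annihilator of the quotient by \<open>L\<close>, a two-sided ideal inside
    \<open>L\<close>. If it were nonzero, comaximality with \<open>\<rho>\<close> would put
    \<open>\<one>\<close> into \<open>L\<close>.\<close>
  define I where "I = {r \<in> carrier R. \<forall>a\<in>carrier R. a \<otimes> r \<in> L}"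
  have "ideal I R"
  proof (rule idealI)
    show "subgroup I (add_monoid R)"
      by (rule add.subgroupI)
         (auto simp: I_def r_distr r_minus L.add_mem L.minus_mem a_inv_def[symmetric] intro: exI[of _ \<zero>])
    show "x \<otimes> a \<in> I" "a \<otimes> x \<in> I" if "a \<in> I" "x \<in> carrier R" for a x
      using that by (auto simp: I_def m_assoc[symmetric] L.mult_mem)
  qed (rule ring_axioms)
  moreover have "I \<subseteq> L"
  proof
    fix r assume "r \<in> I"
    hence "\<one> \<otimes> r \<in> L" "r \<in> carrier R" unfolding I_def by blast+
    thus "r \<in> L" by simp
  qed
  ultimately have I: "I = {\<zero>}"
    using comaximal[of I] L(2,3) L.add_mem by (metis subset_iff)
  have "faithful_right_module R L.quot_module"
    unfolding faithful_right_module_def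
  proof (intro conjI ballI impI L.right_module_quot)
    fix r assume r: "r \<in> carrier R"
      and ann: "\<forall>x\<in>carrier L.quot_module. r \<odot>\<^bsub>L.quot_module\<^esub> x = \<zero>\<^bsub>L.quot_module\<^esub>"
    have "a \<otimes> r \<in> L" if "a \<in> carrier R" for a
      using ann that r by (simp add: L.quot_carrier L.quot_smult L.quot_zero coset_zero)
    thus "r = \<zero>" using r I by (auto simp: I_def)
  qed
  moreover have "irreducible_right_module R L.quot_module"
    unfolding irreducible_right_module_def
  proof (intro conjI allI impI L.right_module_quot)
    show "carrier L.quot_module \<noteq> {\<zero>\<^bsub>L.quot_module\<^esub>}"
      using L(3) coset_zero[of \<one>] by (auto simp: L.quot_carrier L.quot_zero)
  next
    fix N assume "submodule N R L.quot_module"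
    then interpret N: submodule N R L.quot_module .
    have N0: "\<zero>\<^bsub>L.quot_module\<^esub> \<in> N" using N.one_closed by simp
    have Nc: "N \<subseteq> carrier L.quot_module" using N.subset by simp
    show "N = {\<zero>\<^bsub>L.quot_module\<^esub>} \<or> N = carrier L.quot_module"
    proof (cases "N = {\<zero>\<^bsub>L.quot_module\<^esub>}")
      case False
      then obtain C where C: "C \<in> N" "C \<noteq> \<zero>\<^bsub>L.quot_module\<^esub>" using N0 by blast
      then obtain a where a: "a \<in> carrier R" "C = L +> a" using Nc by (auto simp: L.quot_carrier)
      hence a: "a \<in> carrier R" "L +> a \<in> N" "a \<notin> L"
        using C coset_zero by (auto simp: L.quot_zero)
      \<comment> \<open>This is \<open>L + a R\<close>, which must contain \<open>\<one>\<close> by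
        maximality; the resulting equation shows that the coset of \<open>a\<close> generates the
        quotient.\<close>
      define L' where "L' = {l \<oplus> a \<otimes> r | l r. l \<in> L \<and> r \<in> carrier R}"
      have "right_ideal R L'"
      proof (intro right_ideal.intro right_ideal_axioms.intro ring_axioms)
        show "L' \<subseteq> carrier R" using a(1) by (auto simp: L'_def)
        show "\<zero> \<in> L'" using a(1) by (auto simp: L'_def intro!: exI[of _ \<zero>])
        show "x \<oplus> y \<in> L'" if xy: "x \<in> L'" "y \<in> L'" for x y
        proof -
          obtain l r l' r' where lr: "l \<in> L" "l' \<in> L" "r \<in> carrier R" "r' \<in> carrier R"
              "x = l \<oplus> a \<otimes> r" "y = l' \<oplus> a \<otimes> r'"
            using xy by (auto simp: L'_def)
          have "x \<oplus> y = (l \<oplus> l') \<oplus> a \<otimes> (r \<oplus> r')"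
            using lr a(1) L.mem_carrier by (simp add: r_distr a_ac)
          thus ?thesis using lr L.add_mem unfolding L'_def by blast
        qed
        show "x \<otimes> s \<in> L'" if x: "x \<in> L'" and s: "s \<in> carrier R" for x s
        proof -
          obtain l r where lr: "l \<in> L" "r \<in> carrier R" "x = l \<oplus> a \<otimes> r"
            using x by (auto simp: L'_def)
          have "x \<otimes> s = l \<otimes> s \<oplus> a \<otimes> (r \<otimes> s)"
            using lr a(1) s L.mem_carrier by (simp add: l_distr m_assoc)
          thus ?thesis using lr s L.mult_mem unfolding L'_def by blast
        qed
      qed
      moreover have "L \<subseteq> L'"
      proof
        fix l assume "l \<in> L"
        thus "l \<in> L'" using a(1) L.mem_carrier unfolding L'_def
          by (intro CollectI exI[of _ l] exI[of _ \<zero>]) simp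
      qed
      moreover have "a \<in> L'"
        using a(1) unfolding L'_def by (intro CollectI exI[of _ \<zero>] exI[of _ \<one>]) simp
      ultimately have "\<one> \<in> L'" using max a(3) by blast
      then obtain l r where lr: "l \<in> L" "r \<in> carrier R" "\<one> = l \<oplus> a \<otimes> r" by (auto simp: L'_def)
      have "L +> c \<in> N" if c: "c \<in> carrier R" for c
      proof -
        have "r \<otimes> c \<odot>\<^bsub>L.quot_module\<^esub> (L +> a) \<in> N"
          using a lr c by (intro N.smult_closed) auto
        hence "L +> (a \<otimes> (r \<otimes> c)) \<in> N" using a lr c by (simp add: L.quot_smult)
        moreover have "c \<ominus> a \<otimes> (r \<otimes> c) = l \<otimes> c"
        proof -
          have "c = (l \<oplus> a \<otimes> r) \<otimes> c" using c lr(3)[symmetric] by simp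
          also have "\<dots> = l \<otimes> c \<oplus> a \<otimes> (r \<otimes> c)"
            using lr a c L.mem_carrier by (simp add: l_distr m_assoc)
          finally show ?thesis using lr a c L.mem_carrier
            by (metis add.inv_solve_right minus_eq a_inv_closed m_closed minus_closed add.inv_solve_right')
        qed
        ultimately show ?thesis using a lr c L.mult_mem L.coset_eq_iff[of c "a \<otimes> (r \<otimes> c)"] by simp
      qed
      thus ?thesis using Nc by (auto simp: L.quot_carrier)
    qed blast
  qed
  ultimately show ?thesis by (rule primitive_ringI)
qed

section \<open>Group rings\<close>

context abelian_monoid
begin

lemmas finsum_mono_neutral = add.finprod_mono_neutral_cong_left

lemma finsum_single:
  assumes "finite A" "i \<in> A" "f i \<in> carrier G" "\<And>j. j \<in> A \<Longrightarrow> j \<noteq> i \<Longrightarrow> f j = \<zero>"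
  shows "finsum G f A = f i"
proof -
  have "finsum G f {i} = finsum G f A"
    using assms by (intro finsum_mono_neutral) force+
  thus ?thesis using assms by simp
qed

lemma finsum_eq_zero:
  assumes "\<And>i. i \<in> A \<Longrightarrow> f i = \<zero>"
  shows "finsum G f A = \<zero>"
  using assms finsum_cong'[of A A "\<lambda>_. \<zero>" f] by simp

lemma finsum_swap:
  assumes "finite A" "finite B" "\<And>x y. x \<in> A \<Longrightarrow> y \<in> B \<Longrightarrow> f x y \<in> carrier G"
  shows "(\<Oplus>x\<in>A. \<Oplus>y\<in>B. f x y) = (\<Oplus>y\<in>B. \<Oplus>x\<in>A. f x y)"
  using assms(1,3)
proof (induction A rule: finite_induct)
  case (insert a A)
  have "(\<Oplus>x\<in>insert a A. \<Oplus>y\<in>B. f x y) = (\<Oplus>y\<in>B. f a y) \<oplus> (\<Oplus>y\<in>B. \<Oplus>x\<in>A. f x y)"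
    using insert by (subst finsum_insert) (auto intro!: finsum_closed)
  also have "\<dots> = (\<Oplus>y\<in>B. f a y \<oplus> (\<Oplus>x\<in>A. f x y))"
    using insert by (subst finsum_addf) (auto intro!: finsum_closed)
  also have "\<dots> = (\<Oplus>y\<in>B. \<Oplus>x\<in>insert a A. f x y)"
    using insert by (intro finsum_cong') (auto intro!: finsum_closed)
  finally show ?case .
qed simp

end


lemma group_ring_sels:
  "carrier (group_ring K G) =
    {a. (\<forall>x. a x \<in> carrier K) \<and> finite {x. a x \<noteq> \<zero>\<^bsub>K\<^esub>} \<and> {x. a x \<noteq> \<zero>\<^bsub>K\<^esub>} \<subseteq> carrier G}"
  "a \<otimes>\<^bsub>group_ring K G\<^esub> b = (\<lambda>z. finsum K (\<lambda>(x, y). a x \<otimes>\<^bsub>K\<^esub> b y)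
    {(x, y). a x \<noteq> \<zero>\<^bsub>K\<^esub> \<and> b y \<noteq> \<zero>\<^bsub>K\<^esub> \<and> x \<otimes>\<^bsub>G\<^esub> y = z})"
  "\<one>\<^bsub>group_ring K G\<^esub> = (\<lambda>x. if x = \<one>\<^bsub>G\<^esub> then \<one>\<^bsub>K\<^esub> else \<zero>\<^bsub>K\<^esub>)"
  "\<zero>\<^bsub>group_ring K G\<^esub> = (\<lambda>x. \<zero>\<^bsub>K\<^esub>)"
  "a \<oplus>\<^bsub>group_ring K G\<^esub> b = (\<lambda>x. a x \<oplus>\<^bsub>K\<^esub> b x)"
  by (simp_all only: group_ring_def partial_object.simps monoid.simps ring.simps)

locale group_algebra = K: field K + G: group G
  for K :: "('k, 'n) ring_scheme" and G :: "('g, 'm) monoid_scheme"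
begin

abbreviation KG :: "('g \<Rightarrow> 'k) ring" where
  "KG \<equiv> group_ring K G"

definition supp :: "('g \<Rightarrow> 'k) \<Rightarrow> 'g set" where
  "supp a = {x. a x \<noteq> \<zero>\<^bsub>K\<^esub>}"

definition monom :: "'k \<Rightarrow> 'g \<Rightarrow> 'g \<Rightarrow> 'k" where
  "monom c g = (\<lambda>x. if x = g then c else \<zero>\<^bsub>K\<^esub>)"

lemma mem_KG:
  "a \<in> carrier KG \<longleftrightarrow> (\<forall>x. a x \<in> carrier K) \<and> finite (supp a) \<and> supp a \<subseteq> carrier G"
  by (simp add: group_ring_sels supp_def)

lemma KG_I:
  assumes "\<And>x. a x \<in> carrier K" "finite (supp a)" "supp a \<subseteq> carrier G"
  shows "a \<in> carrier KG"
  using assms by (simp add: mem_KG)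

lemma coeff_closed [simp, intro]: "a \<in> carrier KG \<Longrightarrow> a x \<in> carrier K"
  by (simp add: mem_KG)

lemma finite_supp [simp, intro]: "a \<in> carrier KG \<Longrightarrow> finite (supp a)"
  by (simp add: mem_KG)

lemma supp_carrier: "a \<in> carrier KG \<Longrightarrow> x \<in> supp a \<Longrightarrow> x \<in> carrier G"
  unfolding mem_KG by blast

lemma supp_subset: "a \<in> carrier KG \<Longrightarrow> supp a \<subseteq> carrier G"
  unfolding mem_KG by blast

lemma coeff_outside: "a \<in> carrier KG \<Longrightarrow> x \<notin> carrier G \<Longrightarrow> a x = \<zero>\<^bsub>K\<^esub>"
  unfolding mem_KG supp_def by blast

lemma not_in_supp: "x \<notin> supp a \<longleftrightarrow> a x = \<zero>\<^bsub>K\<^esub>"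
  by (simp add: supp_def)

lemma coeff_zero [simp]: "\<zero>\<^bsub>KG\<^esub> x = \<zero>\<^bsub>K\<^esub>"
  by (simp add: group_ring_sels)

lemma coeff_add [simp]: "(a \<oplus>\<^bsub>KG\<^esub> b) x = a x \<oplus>\<^bsub>K\<^esub> b x"
  by (simp add: group_ring_sels)

lemma one_eq_monom: "\<one>\<^bsub>KG\<^esub> = monom \<one>\<^bsub>K\<^esub> \<one>\<^bsub>G\<^esub>"
  by (simp add: group_ring_sels monom_def)

lemma monom_closed [simp, intro]: "c \<in> carrier K \<Longrightarrow> g \<in> carrier G \<Longrightarrow> monom c g \<in> carrier KG"
  by (rule KG_I) (auto simp: monom_def supp_def)

lemma KG_eqI:
  assumes "a \<in> carrier KG" "b \<in> carrier KG" "\<And>x. x \<in> carrier G \<Longrightarrow> a x = b x"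
  shows "a = b"
  using assms coeff_outside by (metis ext)

text \<open>The second factor is determined by the first, so the convolution is a sum over one
  variable. The freedom in \<open>A\<close> allows sums for different elements to be taken over a
  common range.\<close>

lemma coeff_mult:
  assumes a: "a \<in> carrier KG" and b: "b \<in> carrier KG" and z: "z \<in> carrier G"
    and A: "finite A" "supp a \<subseteq> A" "A \<subseteq> carrier G"
  shows "(a \<otimes>\<^bsub>KG\<^esub> b) z = (\<Oplus>\<^bsub>K\<^esub>x\<in>A. a x \<otimes>\<^bsub>K\<^esub> b (inv\<^bsub>G\<^esub> x \<otimes>\<^bsub>G\<^esub> z))"
proof -
  define S where "S = {x \<in> A. a x \<noteq> \<zero>\<^bsub>K\<^esub> \<and> b (inv\<^bsub>G\<^esub> x \<otimes>\<^bsub>G\<^esub> z) \<noteq> \<zero>\<^bsub>K\<^esub>}"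
  let ?f = "\<lambda>x. (x, inv\<^bsub>G\<^esub> x \<otimes>\<^bsub>G\<^esub> z)"
  have P: "{(x, y). a x \<noteq> \<zero>\<^bsub>K\<^esub> \<and> b y \<noteq> \<zero>\<^bsub>K\<^esub> \<and> x \<otimes>\<^bsub>G\<^esub> y = z} = ?f ` S" (is "?P = _")
  proof (intro equalityI subsetI)
    fix p assume "p \<in> ?P"
    then obtain x y where p: "p = (x, y)" "a x \<noteq> \<zero>\<^bsub>K\<^esub>" "b y \<noteq> \<zero>\<^bsub>K\<^esub>" "x \<otimes>\<^bsub>G\<^esub> y = z" by auto
    hence xy: "x \<in> carrier G" "y \<in> carrier G" using coeff_outside a b by blast+
    hence "y = inv\<^bsub>G\<^esub> x \<otimes>\<^bsub>G\<^esub> z" using p(4) by auto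
    thus "p \<in> ?f ` S" using p A by (auto simp: S_def supp_def)
  qed (use A z in \<open>auto simp: S_def\<close>)
  have "(a \<otimes>\<^bsub>KG\<^esub> b) z = finsum K (\<lambda>(x, y). a x \<otimes>\<^bsub>K\<^esub> b y) (?f ` S)"
    by (simp only: group_ring_sels P)
  also have "\<dots> = (\<Oplus>\<^bsub>K\<^esub>x\<in>S. a x \<otimes>\<^bsub>K\<^esub> b (inv\<^bsub>G\<^esub> x \<otimes>\<^bsub>G\<^esub> z))"
    using a b by (subst K.finsum_reindex) (auto intro: inj_onI)
  also have "\<dots> = (\<Oplus>\<^bsub>K\<^esub>x\<in>A. a x \<otimes>\<^bsub>K\<^esub> b (inv\<^bsub>G\<^esub> x \<otimes>\<^bsub>G\<^esub> z))"
    using a b A by (intro K.finsum_mono_neutral) (auto simp: S_def)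
  finally show ?thesis .
qed

lemma coeff_mult_outside:
  assumes "a \<in> carrier KG" "b \<in> carrier KG" "z \<notin> carrier G"
  shows "(a \<otimes>\<^bsub>KG\<^esub> b) z = \<zero>\<^bsub>K\<^esub>"
proof -
  have "{(x, y). a x \<noteq> \<zero>\<^bsub>K\<^esub> \<and> b y \<noteq> \<zero>\<^bsub>K\<^esub> \<and> x \<otimes>\<^bsub>G\<^esub> y = z} = {}"
    using assms coeff_outside by fastforce
  thus ?thesis by (simp only: group_ring_sels K.finsum_empty)
qed

lemma supp_mult:
  assumes a: "a \<in> carrier KG" and b: "b \<in> carrier KG"
  shows "supp (a \<otimes>\<^bsub>KG\<^esub> b) \<subseteq> (\<lambda>(x, y). x \<otimes>\<^bsub>G\<^esub> y) ` (supp a \<times> supp b)"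
proof
  fix z assume z: "z \<in> supp (a \<otimes>\<^bsub>KG\<^esub> b)"
  hence zc: "z \<in> carrier G" using coeff_mult_outside[OF a b] by (auto simp: supp_def)
  have "\<exists>x\<in>supp a. b (inv\<^bsub>G\<^esub> x \<otimes>\<^bsub>G\<^esub> z) \<noteq> \<zero>\<^bsub>K\<^esub>"
  proof (rule ccontr)
    assume "\<not> ?thesis"
    hence "(a \<otimes>\<^bsub>KG\<^esub> b) z = \<zero>\<^bsub>K\<^esub>"
      using a by (subst coeff_mult[OF a b zc finite_supp[OF a] subset_refl supp_subset[OF a]])
        (intro K.finsum_eq_zero, auto)
    thus False using z by (simp add: supp_def)
  qed
  then obtain x where x: "x \<in> supp a" "inv\<^bsub>G\<^esub> x \<otimes>\<^bsub>G\<^esub> z \<in> supp b" by (auto simp: supp_def)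
  thus "z \<in> (\<lambda>(x, y). x \<otimes>\<^bsub>G\<^esub> y) ` (supp a \<times> supp b)"
    using zc supp_carrier[OF a x(1)]
    by (intro image_eqI[of _ _ "(x, inv\<^bsub>G\<^esub> x \<otimes>\<^bsub>G\<^esub> z)"]) auto
qed

lemma mult_closed:
  assumes a: "a \<in> carrier KG" and b: "b \<in> carrier KG"
  shows "a \<otimes>\<^bsub>KG\<^esub> b \<in> carrier KG"
proof (rule KG_I)
  show "finite (supp (a \<otimes>\<^bsub>KG\<^esub> b))"
    using supp_mult[OF a b] a b by (meson finite_SigmaI finite_imageI finite_subset finite_supp)
  show "supp (a \<otimes>\<^bsub>KG\<^esub> b) \<subseteq> carrier G"
    using supp_mult[OF a b] supp_carrier[OF a] supp_carrier[OF b] by fastforce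
  show "(a \<otimes>\<^bsub>KG\<^esub> b) z \<in> carrier K" for z
  proof (cases "z \<in> carrier G")
    case True
    show ?thesis
      using a b by (subst coeff_mult[OF a b True finite_supp[OF a] subset_refl supp_subset[OF a]])
        (intro K.finsum_closed, auto)
  qed (simp add: coeff_mult_outside a b)
qed

lemma mult_assoc:
  assumes a: "a \<in> carrier KG" and b: "b \<in> carrier KG" and c: "c \<in> carrier KG"
  shows "a \<otimes>\<^bsub>KG\<^esub> b \<otimes>\<^bsub>KG\<^esub> c = a \<otimes>\<^bsub>KG\<^esub> (b \<otimes>\<^bsub>KG\<^esub> c)"
proof (rule KG_eqI)
  fix z assume z: "z \<in> carrier G"
  let ?A = "supp a" and ?AB = "(\<lambda>(x, y). x \<otimes>\<^bsub>G\<^esub> y) ` (supp a \<times> supp b)"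
  have A: "finite ?A" "?A \<subseteq> carrier G" using a by (auto simp: supp_carrier)
  have AB: "finite ?AB" "?AB \<subseteq> carrier G" using a b supp_carrier by auto
  have "(a \<otimes>\<^bsub>KG\<^esub> b \<otimes>\<^bsub>KG\<^esub> c) z =
      (\<Oplus>\<^bsub>K\<^esub>y\<in>?AB. (a \<otimes>\<^bsub>KG\<^esub> b) y \<otimes>\<^bsub>K\<^esub> c (inv\<^bsub>G\<^esub> y \<otimes>\<^bsub>G\<^esub> z))"
    by (rule coeff_mult[OF mult_closed[OF a b] c z AB(1) supp_mult[OF a b] AB(2)])
  also have "\<dots> = (\<Oplus>\<^bsub>K\<^esub>y\<in>?AB. \<Oplus>\<^bsub>K\<^esub>x\<in>?A. a x \<otimes>\<^bsub>K\<^esub> b (inv\<^bsub>G\<^esub> x \<otimes>\<^bsub>G\<^esub> y) \<otimes>\<^bsub>K\<^esub> c (inv\<^bsub>G\<^esub> y \<otimes>\<^bsub>G\<^esub> z))"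
  proof (rule K.finsum_cong'[OF HOL.refl])
    fix y assume y: "y \<in> ?AB"
    have "(a \<otimes>\<^bsub>KG\<^esub> b) y = (\<Oplus>\<^bsub>K\<^esub>x\<in>?A. a x \<otimes>\<^bsub>K\<^esub> b (inv\<^bsub>G\<^esub> x \<otimes>\<^bsub>G\<^esub> y))"
      using y AB(2) by (intro coeff_mult[OF a b _ A(1) subset_refl A(2)]) blast
    thus "(a \<otimes>\<^bsub>KG\<^esub> b) y \<otimes>\<^bsub>K\<^esub> c (inv\<^bsub>G\<^esub> y \<otimes>\<^bsub>G\<^esub> z) =
        (\<Oplus>\<^bsub>K\<^esub>x\<in>?A. a x \<otimes>\<^bsub>K\<^esub> b (inv\<^bsub>G\<^esub> x \<otimes>\<^bsub>G\<^esub> y) \<otimes>\<^bsub>K\<^esub> c (inv\<^bsub>G\<^esub> y \<otimes>\<^bsub>G\<^esub> z))"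
      using a b c A(1) by (simp add: K.finsum_ldistr)
  qed (use a b c in \<open>auto intro!: K.finsum_closed\<close>)
  also have "\<dots> = (\<Oplus>\<^bsub>K\<^esub>x\<in>?A. \<Oplus>\<^bsub>K\<^esub>y\<in>?AB. a x \<otimes>\<^bsub>K\<^esub> b (inv\<^bsub>G\<^esub> x \<otimes>\<^bsub>G\<^esub> y) \<otimes>\<^bsub>K\<^esub> c (inv\<^bsub>G\<^esub> y \<otimes>\<^bsub>G\<^esub> z))"
    using a b c A AB by (intro K.finsum_swap) auto
  also have "\<dots> = (\<Oplus>\<^bsub>K\<^esub>x\<in>?A. a x \<otimes>\<^bsub>K\<^esub> (b \<otimes>\<^bsub>KG\<^esub> c) (inv\<^bsub>G\<^esub> x \<otimes>\<^bsub>G\<^esub> z))"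
  proof (rule K.finsum_cong'[OF HOL.refl])
    fix x assume x: "x \<in> ?A"
    have xc: "x \<in> carrier G" using x A by blast
    \<comment> \<open>The substitution \<open>w = x^-1 y\<close>; the translated set contains the
      support of \<open>b\<close>, so the inner sum becomes a coefficient of
      \<open>b c\<close>.\<close>
    let ?B = "(\<lambda>y. inv\<^bsub>G\<^esub> x \<otimes>\<^bsub>G\<^esub> y) ` ?AB"
    have "supp b \<subseteq> ?B"
    proof
      fix w assume w: "w \<in> supp b"
      have "w = inv\<^bsub>G\<^esub> x \<otimes>\<^bsub>G\<^esub> (x \<otimes>\<^bsub>G\<^esub> w)" using xc supp_carrier[OF b w] by simp
      moreover have "x \<otimes>\<^bsub>G\<^esub> w \<in> ?AB" using x w by force
      ultimately show "w \<in> ?B" by blast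
    qed
    moreover have "?B \<subseteq> carrier G" using AB xc by blast
    ultimately have "(b \<otimes>\<^bsub>KG\<^esub> c) (inv\<^bsub>G\<^esub> x \<otimes>\<^bsub>G\<^esub> z) =
        (\<Oplus>\<^bsub>K\<^esub>w\<in>?B. b w \<otimes>\<^bsub>K\<^esub> c (inv\<^bsub>G\<^esub> w \<otimes>\<^bsub>G\<^esub> (inv\<^bsub>G\<^esub> x \<otimes>\<^bsub>G\<^esub> z)))"
      using AB(1) xc z by (intro coeff_mult[OF b c]) auto
    also have "\<dots> = (\<Oplus>\<^bsub>K\<^esub>y\<in>?AB. b (inv\<^bsub>G\<^esub> x \<otimes>\<^bsub>G\<^esub> y) \<otimes>\<^bsub>K\<^esub>
        c (inv\<^bsub>G\<^esub> (inv\<^bsub>G\<^esub> x \<otimes>\<^bsub>G\<^esub> y) \<otimes>\<^bsub>G\<^esub> (inv\<^bsub>G\<^esub> x \<otimes>\<^bsub>G\<^esub> z)))"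
    proof (rule K.finsum_reindex)
      show "inj_on (\<lambda>y. inv\<^bsub>G\<^esub> x \<otimes>\<^bsub>G\<^esub> y) ?AB"
      proof (rule inj_onI)
        fix y y' assume y: "y \<in> ?AB" "y' \<in> ?AB" and eq: "inv\<^bsub>G\<^esub> x \<otimes>\<^bsub>G\<^esub> y = inv\<^bsub>G\<^esub> x \<otimes>\<^bsub>G\<^esub> y'"
        have "y \<in> carrier G" "y' \<in> carrier G" using y AB(2) by blast+
        thus "y = y'" using eq xc by (metis G.inv_cancel(2))
      qed
    qed (use b c in auto)
    also have "\<dots> = (\<Oplus>\<^bsub>K\<^esub>y\<in>?AB. b (inv\<^bsub>G\<^esub> x \<otimes>\<^bsub>G\<^esub> y) \<otimes>\<^bsub>K\<^esub> c (inv\<^bsub>G\<^esub> y \<otimes>\<^bsub>G\<^esub> z))"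
    proof (rule K.finsum_cong'[OF HOL.refl])
      fix y assume "y \<in> ?AB"
      hence "y \<in> carrier G" using AB by blast
      hence "inv\<^bsub>G\<^esub> (inv\<^bsub>G\<^esub> x \<otimes>\<^bsub>G\<^esub> y) \<otimes>\<^bsub>G\<^esub> (inv\<^bsub>G\<^esub> x \<otimes>\<^bsub>G\<^esub> z) = inv\<^bsub>G\<^esub> y \<otimes>\<^bsub>G\<^esub> z"
        using xc z by (simp add: G.inv_mult_group G.m_assoc)
      thus "b (inv\<^bsub>G\<^esub> x \<otimes>\<^bsub>G\<^esub> y) \<otimes>\<^bsub>K\<^esub> c (inv\<^bsub>G\<^esub> (inv\<^bsub>G\<^esub> x \<otimes>\<^bsub>G\<^esub> y) \<otimes>\<^bsub>G\<^esub> (inv\<^bsub>G\<^esub> x \<otimes>\<^bsub>G\<^esub> z)) =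
          b (inv\<^bsub>G\<^esub> x \<otimes>\<^bsub>G\<^esub> y) \<otimes>\<^bsub>K\<^esub> c (inv\<^bsub>G\<^esub> y \<otimes>\<^bsub>G\<^esub> z)" by simp
    qed (use b c in auto)
    finally show "(\<Oplus>\<^bsub>K\<^esub>y\<in>?AB. a x \<otimes>\<^bsub>K\<^esub> b (inv\<^bsub>G\<^esub> x \<otimes>\<^bsub>G\<^esub> y) \<otimes>\<^bsub>K\<^esub> c (inv\<^bsub>G\<^esub> y \<otimes>\<^bsub>G\<^esub> z)) =
        a x \<otimes>\<^bsub>K\<^esub> (b \<otimes>\<^bsub>KG\<^esub> c) (inv\<^bsub>G\<^esub> x \<otimes>\<^bsub>G\<^esub> z)"
      using a b c AB(1) by (simp add: K.finsum_rdistr Pi_def K.m_assoc)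
  qed (use a b c mult_closed in \<open>auto intro!: K.finsum_closed\<close>)
  also have "\<dots> = (a \<otimes>\<^bsub>KG\<^esub> (b \<otimes>\<^bsub>KG\<^esub> c)) z"
    by (rule coeff_mult[OF a mult_closed[OF b c] z A(1) subset_refl A(2), symmetric])
  finally show "(a \<otimes>\<^bsub>KG\<^esub> b \<otimes>\<^bsub>KG\<^esub> c) z = (a \<otimes>\<^bsub>KG\<^esub> (b \<otimes>\<^bsub>KG\<^esub> c)) z" .
qed (use a b c mult_closed in auto)

lemma coeff_monom_mult:
  assumes "c \<in> carrier K" "g \<in> carrier G" "a \<in> carrier KG" "z \<in> carrier G"
  shows "(monom c g \<otimes>\<^bsub>KG\<^esub> a) z = c \<otimes>\<^bsub>K\<^esub> a (inv\<^bsub>G\<^esub> g \<otimes>\<^bsub>G\<^esub> z)"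
proof -
  have "(monom c g \<otimes>\<^bsub>KG\<^esub> a) z = (\<Oplus>\<^bsub>K\<^esub>x\<in>{g}. monom c g x \<otimes>\<^bsub>K\<^esub> a (inv\<^bsub>G\<^esub> x \<otimes>\<^bsub>G\<^esub> z))"
    using assms by (intro coeff_mult monom_closed) (auto simp: supp_def monom_def)
  thus ?thesis using assms by (simp add: monom_def)
qed

lemma coeff_mult_monom:
  assumes "c \<in> carrier K" "g \<in> carrier G" "a \<in> carrier KG" "z \<in> carrier G"
  shows "(a \<otimes>\<^bsub>KG\<^esub> monom c g) z = a (z \<otimes>\<^bsub>G\<^esub> inv\<^bsub>G\<^esub> g) \<otimes>\<^bsub>K\<^esub> c"
proof -
  let ?A = "insert (z \<otimes>\<^bsub>G\<^esub> inv\<^bsub>G\<^esub> g) (supp a)"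
  have eq: "inv\<^bsub>G\<^esub> x \<otimes>\<^bsub>G\<^esub> z = g \<longleftrightarrow> x = z \<otimes>\<^bsub>G\<^esub> inv\<^bsub>G\<^esub> g" if "x \<in> carrier G" for x
    using that assms by (metis G.inv_closed G.inv_solve_left' G.inv_solve_right G.m_closed)
  have "(a \<otimes>\<^bsub>KG\<^esub> monom c g) z = (\<Oplus>\<^bsub>K\<^esub>x\<in>?A. a x \<otimes>\<^bsub>K\<^esub> monom c g (inv\<^bsub>G\<^esub> x \<otimes>\<^bsub>G\<^esub> z))"
    using assms supp_carrier[OF assms(3)] by (intro coeff_mult) auto
  also have "\<dots> = a (z \<otimes>\<^bsub>G\<^esub> inv\<^bsub>G\<^esub> g) \<otimes>\<^bsub>K\<^esub>
      monom c g (inv\<^bsub>G\<^esub> (z \<otimes>\<^bsub>G\<^esub> inv\<^bsub>G\<^esub> g) \<otimes>\<^bsub>G\<^esub> z)"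
    using assms supp_carrier[OF assms(3)]
    by (intro K.finsum_single) (auto simp: monom_def eq)
  also have "\<dots> = a (z \<otimes>\<^bsub>G\<^esub> inv\<^bsub>G\<^esub> g) \<otimes>\<^bsub>K\<^esub> c"
    using assms by (simp add: monom_def eq)
  finally show ?thesis .
qed

lemma ring_KG: "ring KG"
proof (intro ringI abelian_groupI monoidI)
  show add: "a \<oplus>\<^bsub>KG\<^esub> b \<in> carrier KG" if "a \<in> carrier KG" "b \<in> carrier KG" for a b
  proof -
    have "supp (a \<oplus>\<^bsub>KG\<^esub> b) \<subseteq> supp a \<union> supp b" by (auto simp: supp_def)
    thus ?thesis using that supp_carrier
      by (intro KG_I) (auto intro: finite_subset)
  qed
  show "\<zero>\<^bsub>KG\<^esub> \<in> carrier KG" by (rule KG_I) (auto simp: supp_def)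
  show "\<exists>b\<in>carrier KG. b \<oplus>\<^bsub>KG\<^esub> a = \<zero>\<^bsub>KG\<^esub>" if a: "a \<in> carrier KG" for a
  proof
    have "supp (\<lambda>x. \<ominus>\<^bsub>K\<^esub> a x) \<subseteq> supp a" by (auto simp: supp_def)
    thus "(\<lambda>x. \<ominus>\<^bsub>K\<^esub> a x) \<in> carrier KG"
      using a supp_subset[OF a] by (intro KG_I) (auto intro: finite_subset)
    show "(\<lambda>x. \<ominus>\<^bsub>K\<^esub> a x) \<oplus>\<^bsub>KG\<^esub> a = \<zero>\<^bsub>KG\<^esub>"
      using a by (intro ext) (simp add: K.l_neg)
  qed
  show one: "\<one>\<^bsub>KG\<^esub> \<in> carrier KG" by (simp add: one_eq_monom)
  show "\<one>\<^bsub>KG\<^esub> \<otimes>\<^bsub>KG\<^esub> a = a" if "a \<in> carrier KG" for a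
    using that by (intro KG_eqI mult_closed one) (auto simp: one_eq_monom coeff_monom_mult)
  show "a \<otimes>\<^bsub>KG\<^esub> \<one>\<^bsub>KG\<^esub> = a" if "a \<in> carrier KG" for a
    using that by (intro KG_eqI mult_closed one) (auto simp: one_eq_monom coeff_mult_monom)
  show "(a \<oplus>\<^bsub>KG\<^esub> b) \<otimes>\<^bsub>KG\<^esub> c = a \<otimes>\<^bsub>KG\<^esub> c \<oplus>\<^bsub>KG\<^esub> b \<otimes>\<^bsub>KG\<^esub> c"
    if abc: "a \<in> carrier KG" "b \<in> carrier KG" "c \<in> carrier KG" for a b c
  proof (rule KG_eqI)
    fix z assume z: "z \<in> carrier G"
    let ?A = "supp a \<union> supp b"
    have A: "finite ?A" "?A \<subseteq> carrier G" "supp (a \<oplus>\<^bsub>KG\<^esub> b) \<subseteq> ?A"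
      using abc supp_subset by (simp, simp) (auto simp: supp_def)
    have "((a \<oplus>\<^bsub>KG\<^esub> b) \<otimes>\<^bsub>KG\<^esub> c) z =
        (\<Oplus>\<^bsub>K\<^esub>x\<in>?A. (a \<oplus>\<^bsub>KG\<^esub> b) x \<otimes>\<^bsub>K\<^esub> c (inv\<^bsub>G\<^esub> x \<otimes>\<^bsub>G\<^esub> z))"
      by (rule coeff_mult[OF add[OF abc(1,2)] abc(3) z A(1,3,2)])
    also have "\<dots> = (\<Oplus>\<^bsub>K\<^esub>x\<in>?A. a x \<otimes>\<^bsub>K\<^esub> c (inv\<^bsub>G\<^esub> x \<otimes>\<^bsub>G\<^esub> z)) \<oplus>\<^bsub>K\<^esub>
        (\<Oplus>\<^bsub>K\<^esub>x\<in>?A. b x \<otimes>\<^bsub>K\<^esub> c (inv\<^bsub>G\<^esub> x \<otimes>\<^bsub>G\<^esub> z))"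
      using abc by (simp add: K.l_distr K.finsum_addf)
    also have "\<dots> = (a \<otimes>\<^bsub>KG\<^esub> c \<oplus>\<^bsub>KG\<^esub> b \<otimes>\<^bsub>KG\<^esub> c) z"
      using abc z A(1,2) by (simp add: coeff_mult[of _ _ _ ?A])
    finally show "((a \<oplus>\<^bsub>KG\<^esub> b) \<otimes>\<^bsub>KG\<^esub> c) z = (a \<otimes>\<^bsub>KG\<^esub> c \<oplus>\<^bsub>KG\<^esub> b \<otimes>\<^bsub>KG\<^esub> c) z" .
  qed (use abc add mult_closed in auto)
  show "c \<otimes>\<^bsub>KG\<^esub> (a \<oplus>\<^bsub>KG\<^esub> b) = c \<otimes>\<^bsub>KG\<^esub> a \<oplus>\<^bsub>KG\<^esub> c \<otimes>\<^bsub>KG\<^esub> b"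
    if abc: "a \<in> carrier KG" "b \<in> carrier KG" "c \<in> carrier KG" for a b c
  proof (rule KG_eqI)
    fix z assume z: "z \<in> carrier G"
    have A: "supp c \<subseteq> carrier G" using abc supp_carrier by auto
    have "(c \<otimes>\<^bsub>KG\<^esub> (a \<oplus>\<^bsub>KG\<^esub> b)) z =
        (\<Oplus>\<^bsub>K\<^esub>x\<in>supp c. c x \<otimes>\<^bsub>K\<^esub> (a \<oplus>\<^bsub>KG\<^esub> b) (inv\<^bsub>G\<^esub> x \<otimes>\<^bsub>G\<^esub> z))"
      by (rule coeff_mult[OF abc(3) add[OF abc(1,2)] z finite_supp[OF abc(3)] subset_refl A])
    also have "\<dots> = (\<Oplus>\<^bsub>K\<^esub>x\<in>supp c. c x \<otimes>\<^bsub>K\<^esub> a (inv\<^bsub>G\<^esub> x \<otimes>\<^bsub>G\<^esub> z)) \<oplus>\<^bsub>K\<^esub>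
        (\<Oplus>\<^bsub>K\<^esub>x\<in>supp c. c x \<otimes>\<^bsub>K\<^esub> b (inv\<^bsub>G\<^esub> x \<otimes>\<^bsub>G\<^esub> z))"
      using abc by (simp add: K.r_distr K.finsum_addf)
    also have "\<dots> = (c \<otimes>\<^bsub>KG\<^esub> a \<oplus>\<^bsub>KG\<^esub> c \<otimes>\<^bsub>KG\<^esub> b) z"
      using abc z A by (simp add: coeff_mult[of _ _ _ "supp c"])
    finally show "(c \<otimes>\<^bsub>KG\<^esub> (a \<oplus>\<^bsub>KG\<^esub> b)) z = (c \<otimes>\<^bsub>KG\<^esub> a \<oplus>\<^bsub>KG\<^esub> c \<otimes>\<^bsub>KG\<^esub> b) z" .
  qed (use abc add mult_closed in auto)
qed (auto simp: mult_closed mult_assoc K.a_ac intro!: ext)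

sublocale R: ring KG
  by (rule ring_KG)

lemma coeff_finsum:
  assumes "finite A" "\<And>i. i \<in> A \<Longrightarrow> f i \<in> carrier KG"
  shows "(\<Oplus>\<^bsub>KG\<^esub>i\<in>A. f i) x = (\<Oplus>\<^bsub>K\<^esub>i\<in>A. f i x)"
  using assms
proof (induction A rule: finite_induct)
  case (insert i A)
  hence "(\<Oplus>\<^bsub>KG\<^esub>i\<in>insert i A. f i) x = (f i \<oplus>\<^bsub>KG\<^esub> (\<Oplus>\<^bsub>KG\<^esub>i\<in>A. f i)) x"
    by (subst R.finsum_insert) auto
  thus ?case using insert by (simp add: K.finsum_insert Pi_def)
qed simp

lemma monom_mult_monom:
  assumes "c \<in> carrier K" "d \<in> carrier K" "g \<in> carrier G" "h \<in> carrier G"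
  shows "monom c g \<otimes>\<^bsub>KG\<^esub> monom d h = monom (c \<otimes>\<^bsub>K\<^esub> d) (g \<otimes>\<^bsub>G\<^esub> h)"
proof (rule KG_eqI)
  fix z assume z: "z \<in> carrier G"
  have "inv\<^bsub>G\<^esub> g \<otimes>\<^bsub>G\<^esub> z = h \<longleftrightarrow> z = g \<otimes>\<^bsub>G\<^esub> h"
    using z assms(3,4) by (metis G.inv_cancel(1,2) G.m_closed)
  thus "(monom c g \<otimes>\<^bsub>KG\<^esub> monom d h) z = monom (c \<otimes>\<^bsub>K\<^esub> d) (g \<otimes>\<^bsub>G\<^esub> h) z"
    using assms z by (simp add: coeff_monom_mult) (simp add: monom_def)
qed (use assms in auto)

lemma coeff_minus [simp]: "a \<in> carrier KG \<Longrightarrow> (\<ominus>\<^bsub>KG\<^esub> a) x = \<ominus>\<^bsub>K\<^esub> a x"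
proof -
  assume a: "a \<in> carrier KG"
  have "(\<ominus>\<^bsub>KG\<^esub> a \<oplus>\<^bsub>KG\<^esub> a) x = \<zero>\<^bsub>K\<^esub>" using a by (simp add: R.l_neg del: coeff_add)
  thus ?thesis using a K.minus_equality[of "(\<ominus>\<^bsub>KG\<^esub> a) x" "a x"] by simp
qed

end

section \<open>A prefix code\<close>

abbreviation positive :: "'x word \<Rightarrow> bool" where
  "positive w \<equiv> (\<forall>l\<in>set w. snd l)"

lemma reduced_positive: "positive w \<Longrightarrow> reduced w"
  by (induction w rule: induct_list012) (auto simp: inv_letter_def)

text \<open>Each letter becomes a block of three positive letters that starts with \<open>p\<close>
  and records the sign in its last letter; a final \<open>q\<close> marks the end. The first letter
  at a block boundary thus tells whether the code continues.\<close>

definition prefix_code :: "'x \<Rightarrow> 'x \<Rightarrow> 'x word \<Rightarrow> 'x word" where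
  "prefix_code p q w =
     concat (map (\<lambda>(x, b). [(p, True), (x, True), (if b then p else q, True)]) w) @ [(q, True)]"

lemma positive_prefix_code: "positive (prefix_code p q w)"
  by (auto simp: prefix_code_def)

lemma prefix_code_words:
  assumes "p \<in> X" "q \<in> X" "w \<in> words X"
  shows "prefix_code p q w \<in> words X"
  using assms(3) by (induction w) (auto simp: prefix_code_def assms(1,2))

lemma prefix_code_prefix_free:
  assumes "p \<noteq> q" "prefix_code p q w @ u = prefix_code p q w' @ u'"
  shows "w = w'"
  using assms(2)
proof (induction w arbitrary: w')
  case Nil
  thus ?case using assms(1) by (cases w') (auto simp: prefix_code_def split: prod.splits)
next
  case (Cons l w)
  then obtain l' v' where w': "w' = l' # v'"
    using assms(1) by (cases w') (auto simp: prefix_code_def split: prod.splits)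
  have "l = l'" "prefix_code p q w @ u = prefix_code p q v' @ u'"
    using Cons.prems assms(1) by (auto simp: prefix_code_def w' split: prod.splits if_splits)
  thus ?case using Cons.IH w' by simp
qed

section \<open>Independent elements of the group ring\<close>

text \<open>Fewer than \<open>M\<close> letters of the left padding are cancelled by
  \<open>u\<close>, so its first letter survives. What is then to the left of the right padding is
  shorter than \<open>2 * M\<close> and cannot consume all \<open>3 * M\<close> letters.\<close>

lemma nf_pad:
  assumes "reduced u" "length u < M" "snd l"
  obtains w where "nf (replicate M l @ u @ replicate (3 * M) l) = w"
    "w \<noteq> []" "hd w = l" "last w = l"
proof -
  have red: "reduced (replicate n l)" for n
    using assms(3) by (intro reduced_positive) auto
  obtain k where k: "k \<le> length u" "nf (replicate M l @ u) = take (M - k) (replicate M l) @ drop k u"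
    using nf_append_reduced[OF red assms(1), of M] by auto
  define y where "y = nf (replicate M l @ u)"
  have y: "y = replicate (M - k) l @ drop k u" using k by (simp add: y_def)
  have "M - k > 0" using k(1) assms(2) by simp
  hence hy: "hd y = l" "y \<noteq> []" by (simp_all add: y hd_append)
  have ly: "length y < 3 * M" using assms(2) by (simp add: y)
  obtain k' where k': "k' \<le> length y"
      "nf (y @ replicate (3 * M) l) = take (length y - k') y @ drop k' (replicate (3 * M) l)"
    using nf_append_reduced[of y "replicate (3 * M) l"] red by (auto simp: y_def)
  have w: "nf (replicate M l @ u @ replicate (3 * M) l) = take (length y - k') y @ replicate (3 * M - k') l"
    using k' nf_nf_append_left[of "replicate M l @ u" "replicate (3 * M) l"] by (simp add: y_def)
  have pos: "3 * M - k' > 0" using k'(1) ly by simp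
  show thesis
  proof (rule that[OF w])
    show "hd (take (length y - k') y @ replicate (3 * M - k') l) = l"
      using pos hy by (cases "length y - k' = 0") (auto simp: hd_append)
  qed (use pos in auto)
qed

lemma ex_lex_max:
  fixes f :: "'b \<Rightarrow> nat" and g :: "'b \<Rightarrow> int"
  assumes "finite S" "S \<noteq> {}"
  shows "\<exists>s\<in>S. \<forall>t\<in>S. f t < f s \<or> f t = f s \<and> g t \<le> g s"
proof -
  define S' where "S' = {s \<in> S. f s = Max (f ` S)}"
  have "Max (f ` S) \<in> f ` S" using assms by simp
  hence "S' \<noteq> {}" by (auto simp: S'_def)
  moreover have "finite S'" using assms by (simp add: S'_def)
  ultimately have "Max (g ` S') \<in> g ` S'" by simp
  then obtain s where s: "s \<in> S'" "g s = Max (g ` S')" by auto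
  have "f t < f s \<or> f t = f s \<and> g t \<le> g s" if t: "t \<in> S" for t
  proof -
    have "f t \<le> f s" using s t assms by (simp add: S'_def)
    moreover have "g t \<le> g s" if "f t = f s"
      using that s t \<open>finite S'\<close> by (simp add: S'_def)
    ultimately show ?thesis by linarith
  qed
  thus ?thesis using s(1) unfolding S'_def by blast
qed

text \<open>\<open>H\<close> stands for \<open>F\<close>, or for \<open>F\<close> times the powers
  of a central \<open>z\<close>: \<open>wd\<close> is the word of the component in \<open>F\<close>,
  \<open>ex\<close> the exponent of \<open>z\<close>, and \<open>lift\<close> a section of
  \<open>wd\<close> with exponent zero.\<close>

locale coded_subgroup = group_algebra K G
  for K :: "('k, 'n) ring_scheme" and G :: "('g, 'm) monoid_scheme" +
  fixes X :: "'x set" and H :: "'g set" and wd :: "'g \<Rightarrow> 'x word" and ex :: "'g \<Rightarrow> int"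
    and lift :: "'x word \<Rightarrow> 'g" and p q :: 'x
    and E :: "('g \<Rightarrow> 'k) set" and code :: "('g \<Rightarrow> 'k) \<Rightarrow> 'x word"
  assumes H: "subgroup H G"
    and wd_closed: "h \<in> H \<Longrightarrow> wd h \<in> carrier (free_words X)"
    and wd_mult: "g \<in> H \<Longrightarrow> h \<in> H \<Longrightarrow> wd (g \<otimes>\<^bsub>G\<^esub> h) = nf (wd g @ wd h)"
    and ex_mult: "g \<in> H \<Longrightarrow> h \<in> H \<Longrightarrow> ex (g \<otimes>\<^bsub>G\<^esub> h) = ex g + ex h"
    and wd_ex_inj: "g \<in> H \<Longrightarrow> h \<in> H \<Longrightarrow> wd g = wd h \<Longrightarrow> ex g = ex h \<Longrightarrow> g = h"
    and lift: "w \<in> carrier (free_words X) \<Longrightarrow> lift w \<in> H \<and> wd (lift w) = w \<and> ex (lift w) = 0"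
    and pq: "p \<in> X" "q \<in> X" "p \<noteq> q"
    and E: "a \<in> E \<Longrightarrow> a \<in> carrier KG \<and> a \<noteq> \<zero>\<^bsub>KG\<^esub> \<and> supp a \<subseteq> H"
    and E_infinite: "infinite E"
    and code_closed: "a \<in> E \<Longrightarrow> code a \<in> words X \<and> positive (code a)"
    and code_prefix_free: "a \<in> E \<Longrightarrow> b \<in> E \<Longrightarrow> code a @ u = code b @ w \<Longrightarrow> a = b"
begin

interpretation H: subgroup H G by (rule H)

text \<open>The \<open>M\<close> of the construction. It must exceed the length of every word in the
  support, and the sum of these lengths is a convenient bound.\<close>

definition pad :: "('g \<Rightarrow> 'k) \<Rightarrow> nat" where
  "pad a = Suc (\<Sum>g\<in>supp a. length (wd g))"

definition left_word :: "('g \<Rightarrow> 'k) \<Rightarrow> 'x \<Rightarrow> 'x word" where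
  "left_word a l = code a @ [(l, True)] @ replicate (pad a) (p, True)"

definition right_word :: "('g \<Rightarrow> 'k) \<Rightarrow> 'x \<Rightarrow> 'x word" where
  "right_word a l = replicate (3 * pad a) (p, True) @ code a @ [(l, True)]"

text \<open>By \<open>nf_pad\<close> this begins and ends with a positive \<open>p\<close> for
  \<open>g\<close> in the support of \<open>a\<close>, so it does not cancel against the positive
  words around it.\<close>

definition hat :: "('g \<Rightarrow> 'k) \<Rightarrow> 'g \<Rightarrow> 'x word" where
  "hat a g = nf (replicate (pad a) (p, True) @ wd g @ replicate (3 * pad a) (p, True))"

definition sandwich :: "('g \<Rightarrow> 'k) \<Rightarrow> 'x \<Rightarrow> 'g \<Rightarrow> 'k" where
  "sandwich a l = monom \<one>\<^bsub>K\<^esub> (lift (left_word a l)) \<otimes>\<^bsub>KG\<^esub> a \<otimes>\<^bsub>KG\<^esub> monom \<one>\<^bsub>K\<^esub> (lift (right_word a l))"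

definition unit_plus :: "('g \<Rightarrow> 'k) \<Rightarrow> 'g \<Rightarrow> 'k" where
  "unit_plus a = \<one>\<^bsub>KG\<^esub> \<oplus>\<^bsub>KG\<^esub> (sandwich a p \<oplus>\<^bsub>KG\<^esub> sandwich a q)"

lemma length_wd_less_pad: "a \<in> E \<Longrightarrow> g \<in> supp a \<Longrightarrow> length (wd g) < pad a"
  using E by (auto simp: pad_def less_Suc_eq_le intro: member_le_sum)

lemma positive_closed: "w \<in> words X \<Longrightarrow> positive w \<Longrightarrow> w \<in> carrier (free_words X)"
  by (simp add: reduced_positive)

lemma left_word_closed: "a \<in> E \<Longrightarrow> l \<in> {p, q} \<Longrightarrow> left_word a l \<in> carrier (free_words X)"
  using code_closed[of a] pq
  by (intro positive_closed) (auto simp: left_word_def words_def)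

lemma right_word_closed: "a \<in> E \<Longrightarrow> l \<in> {p, q} \<Longrightarrow> right_word a l \<in> carrier (free_words X)"
  using code_closed[of a] pq
  by (intro positive_closed) (auto simp: right_word_def words_def)

lemma sandwich_closed: "a \<in> E \<Longrightarrow> l \<in> {p, q} \<Longrightarrow> sandwich a l \<in> carrier KG"
  unfolding sandwich_def using E lift[OF left_word_closed] lift[OF right_word_closed]
  by (intro mult_closed monom_closed) (auto intro: H.mem_carrier)

lemma unit_plus_closed: "a \<in> E \<Longrightarrow> unit_plus a \<in> carrier KG"
  unfolding unit_plus_def using sandwich_closed by (intro R.a_closed R.one_closed) auto

text \<open>The coefficient of \<open>sandwich a l \<otimes> r\<close> at \<open>v\<close> collects the factorisations \<open>v = L g R h\<close>
  with \<open>g\<close> in the support of \<open>a\<close>; the last factor \<open>h\<close> is \<open>cofactor a l g v\<close>.\<close>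

definition cofactor :: "('g \<Rightarrow> 'k) \<Rightarrow> 'x \<Rightarrow> 'g \<Rightarrow> 'g \<Rightarrow> 'g" where
  "cofactor a l g v = inv\<^bsub>G\<^esub> (lift (right_word a l)) \<otimes>\<^bsub>G\<^esub>
     (inv\<^bsub>G\<^esub> g \<otimes>\<^bsub>G\<^esub> (inv\<^bsub>G\<^esub> (lift (left_word a l)) \<otimes>\<^bsub>G\<^esub> v))"

lemma coeff_sandwich:
  assumes a: "a \<in> E" and l: "l \<in> {p, q}" and r: "r \<in> carrier KG" and v: "v \<in> carrier G"
  shows "(sandwich a l \<otimes>\<^bsub>KG\<^esub> r) v = (\<Oplus>\<^bsub>K\<^esub>g\<in>supp a. a g \<otimes>\<^bsub>K\<^esub> r (cofactor a l g v))"
proof -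
  let ?L = "lift (left_word a l)" and ?R = "lift (right_word a l)"
  have LR: "?L \<in> carrier G" "?R \<in> carrier G"
    using lift[OF left_word_closed[OF a l]] lift[OF right_word_closed[OF a l]] H.mem_carrier by auto
  have ac: "a \<in> carrier KG" using E[OF a] by simp
  have "(sandwich a l \<otimes>\<^bsub>KG\<^esub> r) v =
      (monom \<one>\<^bsub>K\<^esub> ?L \<otimes>\<^bsub>KG\<^esub> (a \<otimes>\<^bsub>KG\<^esub> (monom \<one>\<^bsub>K\<^esub> ?R \<otimes>\<^bsub>KG\<^esub> r))) v"
    using LR ac r by (simp add: sandwich_def R.m_assoc)
  also have "\<dots> = (a \<otimes>\<^bsub>KG\<^esub> (monom \<one>\<^bsub>K\<^esub> ?R \<otimes>\<^bsub>KG\<^esub> r)) (inv\<^bsub>G\<^esub> ?L \<otimes>\<^bsub>G\<^esub> v)"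
    using LR ac r v by (simp add: coeff_monom_mult)
  also have "\<dots> = (\<Oplus>\<^bsub>K\<^esub>g\<in>supp a. a g \<otimes>\<^bsub>K\<^esub>
      (monom \<one>\<^bsub>K\<^esub> ?R \<otimes>\<^bsub>KG\<^esub> r) (inv\<^bsub>G\<^esub> g \<otimes>\<^bsub>G\<^esub> (inv\<^bsub>G\<^esub> ?L \<otimes>\<^bsub>G\<^esub> v)))"
    using LR ac r v supp_subset[OF ac] by (intro coeff_mult) auto
  also have "\<dots> = (\<Oplus>\<^bsub>K\<^esub>g\<in>supp a. a g \<otimes>\<^bsub>K\<^esub> r (cofactor a l g v))"
    using LR ac r v supp_carrier[OF ac]
    by (intro K.finsum_cong') (auto simp: coeff_monom_mult cofactor_def)
  finally show ?thesis .
qed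

lemma cofactor_closed:
  assumes "a \<in> E" "l \<in> {p, q}" "g \<in> H" "v \<in> H"
  shows "cofactor a l g v \<in> H"
  unfolding cofactor_def
  using assms lift[OF left_word_closed[OF assms(1,2)]] lift[OF right_word_closed[OF assms(1,2)]]
  by (intro H.m_closed H.m_inv_closed) auto

lemma cofactor_eq_iff:
  assumes "a \<in> E" "l \<in> {p, q}" "g \<in> H" "v \<in> H" "h \<in> H"
  shows "cofactor a l g v = h \<longleftrightarrow>
    v = lift (left_word a l) \<otimes>\<^bsub>G\<^esub> (g \<otimes>\<^bsub>G\<^esub> (lift (right_word a l) \<otimes>\<^bsub>G\<^esub> h))"
proof -
  let ?L = "lift (left_word a l)" and ?R = "lift (right_word a l)"
  have LR: "?L \<in> carrier G" "?R \<in> carrier G" "g \<in> carrier G" "v \<in> carrier G" "h \<in> carrier G"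
    using lift[OF left_word_closed[OF assms(1,2)]] lift[OF right_word_closed[OF assms(1,2)]]
      H.mem_carrier assms by auto
  show ?thesis
  proof
    assume "cofactor a l g v = h"
    thus "v = ?L \<otimes>\<^bsub>G\<^esub> (g \<otimes>\<^bsub>G\<^esub> (?R \<otimes>\<^bsub>G\<^esub> h))" using LR by (auto simp: cofactor_def)
  next
    assume "v = ?L \<otimes>\<^bsub>G\<^esub> (g \<otimes>\<^bsub>G\<^esub> (?R \<otimes>\<^bsub>G\<^esub> h))"
    thus "cofactor a l g v = h" using LR by (simp add: cofactor_def)
  qed
qed

lemma wd_product:
  assumes a: "a \<in> E" and l: "l \<in> {p, q}" and gh: "g \<in> H" "h \<in> H"
  defines "v \<equiv> lift (left_word a l) \<otimes>\<^bsub>G\<^esub> (g \<otimes>\<^bsub>G\<^esub> (lift (right_word a l) \<otimes>\<^bsub>G\<^esub> h))"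
  shows "v \<in> H" "wd v = nf (code a @ (l, True) # hat a g @ code a @ (l, True) # wd h)"
    "ex v = ex g + ex h"
proof -
  note L = lift[OF left_word_closed[OF a l]] and R = lift[OF right_word_closed[OF a l]]
  show "v \<in> H" unfolding v_def using L R gh by simp
  show "ex v = ex g + ex h" unfolding v_def using L R gh by (simp add: ex_mult)
  have "wd v = nf (left_word a l @ wd g @ right_word a l @ wd h)"
    unfolding v_def using L R gh by (simp add: wd_mult)
  also have "\<dots> = nf ((code a @ [(l, True)]) @
      (replicate (pad a) (p, True) @ wd g @ replicate (3 * pad a) (p, True)) @
      (code a @ (l, True) # wd h))"
    by (simp add: left_word_def right_word_def)
  also have "\<dots> = nf ((code a @ [(l, True)]) @ hat a g @ (code a @ (l, True) # wd h))"
    unfolding hat_def by (intro nf_append_cong) simp_all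
  finally show "wd v = nf (code a @ (l, True) # hat a g @ code a @ (l, True) # wd h)" by simp
qed

text \<open>The multipliers may have support outside \<open>H\<close>; only their coefficients on
  \<open>H\<close> are examined. This is enough because the coefficient of the sum is read off at a
  point \<open>v\<close> of \<open>H\<close>, and by \<open>cofactor_closed\<close> all factors
  contributing there lie in \<open>H\<close>.\<close>

lemma independent_aux:
  assumes S: "finite S" "S \<subseteq> E" and r: "\<And>a. a \<in> S \<Longrightarrow> r a \<in> carrier KG"
    and nz: "a1 \<in> S" "h1 \<in> H" "r a1 h1 \<noteq> \<zero>\<^bsub>K\<^esub>"
  shows "(\<Oplus>\<^bsub>KG\<^esub>a\<in>S. unit_plus a \<otimes>\<^bsub>KG\<^esub> r a) \<noteq> \<zero>\<^bsub>KG\<^esub>"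
proof -
  \<comment> \<open>Elements of the support may share a longest padded word and differ only in
    \<open>ex\<close>, which therefore serves as tie breaker.\<close>
  have "\<forall>a\<in>E. \<exists>g\<in>supp a. \<forall>t\<in>supp a. length (hat a t) < length (hat a g) \<or>
      length (hat a t) = length (hat a g) \<and> ex t \<le> ex g"
  proof
    fix a assume a: "a \<in> E"
    have "supp a \<noteq> {}"
    proof
      assume "supp a = {}"
      hence "a = \<zero>\<^bsub>KG\<^esub>" by (intro ext) (auto simp: supp_def)
      thus False using E[OF a] by simp
    qed
    thus "\<exists>g\<in>supp a. \<forall>t\<in>supp a. length (hat a t) < length (hat a g) \<or>
        length (hat a t) = length (hat a g) \<and> ex t \<le> ex g"
      using E[OF a] by (intro ex_lex_max) auto
  qed
  then obtain top where top: "\<And>a. a \<in> E \<Longrightarrow> top a \<in> supp a"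
    "\<And>a t. a \<in> E \<Longrightarrow> t \<in> supp a \<Longrightarrow> length (hat a t) < length (hat a (top a)) \<or>
      length (hat a t) = length (hat a (top a)) \<and> ex t \<le> ex (top a)"
    by metis
  define P where "P = (SIGMA a:S. {h \<in> supp (r a). h \<in> H})"
  \<comment> \<open>The number of letters before any cancellation if \<open>g = top a\<close>, and
    an upper bound for every other \<open>g\<close> in the support.\<close>
  define weight where "weight = (\<lambda>(a, h). 2 * length (code a) + 2 + length (hat a (top a)) + length (wd h))"
  define exw where "exw = (\<lambda>(a, h). ex h + ex (top a))"
  have "finite P" using S r by (auto simp: P_def)
  moreover have "(a1, h1) \<in> P" using nz by (simp add: P_def supp_def)
  ultimately obtain s where s: "s \<in> P"
    "\<And>t. t \<in> P \<Longrightarrow> weight t < weight s \<or> weight t = weight s \<and> exw t \<le> exw s"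
    using ex_lex_max[of P weight exw] by blast
  obtain a0 h0 where s0: "s = (a0, h0)" by (cases s)
  have a0: "a0 \<in> S" "a0 \<in> E" "h0 \<in> H" "h0 \<in> supp (r a0)" using s(1) S by (auto simp: s0 P_def)
  define g0 where "g0 = top a0"
  have g0: "g0 \<in> supp a0" "g0 \<in> H" using top(1)[OF a0(2)] E[OF a0(2)] by (auto simp: g0_def)
  \<comment> \<open>The point of summing over two letters: the word of \<open>h0\<close> can begin
    with the inverse of at most one of them.\<close>
  have "\<exists>l0\<in>{p, q}. wd h0 = [] \<or> hd (wd h0) \<noteq> (l0, False)"
    using pq(3) by (cases "hd (wd h0) = (p, False)") auto
  then obtain l0 where l0: "l0 \<in> {p, q}" "wd h0 = [] \<or> hd (wd h0) \<noteq> (l0, False)" by blast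
  define v where "v = lift (left_word a0 l0) \<otimes>\<^bsub>G\<^esub> (g0 \<otimes>\<^bsub>G\<^esub> (lift (right_word a0 l0) \<otimes>\<^bsub>G\<^esub> h0))"
  define V where "V = code a0 @ (l0, True) # hat a0 g0 @ code a0 @ (l0, True) # wd h0"
  note vp = wd_product[OF a0(2) l0(1) g0(2) a0(3), folded v_def]
  have "reduced V"
  proof -
    obtain w where w: "hat a0 g0 = w" "w \<noteq> []" "hd w = (p, True)" "last w = (p, True)"
      using nf_pad[of "wd g0" "pad a0" "(p, True)"] wd_closed[OF g0(2)]
        length_wd_less_pad[OF a0(2) g0(1)] unfolding hat_def by auto
    have c: "reduced (code a0)" "code a0 \<noteq> [] \<Longrightarrow> snd (hd (code a0))" "code a0 \<noteq> [] \<Longrightarrow> snd (last (code a0))"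
      using code_closed[OF a0(2)] reduced_positive by auto
    have "reduced (hat a0 g0)" "reduced (wd h0)" using wd_closed[OF a0(3)] by (auto simp: hat_def)
    thus ?thesis unfolding V_def using w c l0(2)
      by (auto simp: successively_append_iff successively_Cons inv_letter_def hd_append)
  qed
  hence wv: "wd v = V" using vp(2) nf_reduced by (simp add: V_def)
  have lV: "length V = weight s" by (simp add: V_def weight_def s0 g0_def)
  \<comment> \<open>The summand \<open>1\<close> of \<open>unit_plus a\<close> contributes
    \<open>r a v\<close>. Were it nonzero, \<open>(a, v)\<close> would outweigh \<open>s\<close>,
    since the word of \<open>v\<close> alone already has length \<open>weight s\<close>.\<close>
  have center: "r a v = \<zero>\<^bsub>K\<^esub>" if a: "a \<in> S" for a
  proof (rule ccontr)
    assume "r a v \<noteq> \<zero>\<^bsub>K\<^esub>"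
    hence "(a, v) \<in> P" using a vp(1) by (simp add: P_def supp_def)
    hence "weight (a, v) \<le> weight s" using s(2) by fastforce
    thus False using wv lV by (simp add: weight_def)
  qed
  \<comment> \<open>A further contribution at \<open>v\<close> must attain the maximal weight
    without cancellation, so its unreduced word is \<open>V\<close> letter by letter. The prefix
    code reveals \<open>a\<close>, the next letter is \<open>l\<close>, equal lengths cut off
    \<open>hat a g\<close>, and the exponents settle \<open>g\<close>.\<close>
  have unique: "a = a0 \<and> l = l0 \<and> g = g0"
    if a: "a \<in> S" and l: "l \<in> {p, q}" and g: "g \<in> supp a" and nz: "r a (cofactor a l g v) \<noteq> \<zero>\<^bsub>K\<^esub>"
    for a l g
  proof -
    define h where "h = cofactor a l g v"
    have aE: "a \<in> E" using a S by blast
    have gH: "g \<in> H" using E[OF aE] g by blast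
    have hH: "h \<in> H" unfolding h_def by (rule cofactor_closed[OF aE l gH vp(1)])
    have veq: "v = lift (left_word a l) \<otimes>\<^bsub>G\<^esub> (g \<otimes>\<^bsub>G\<^esub> (lift (right_word a l) \<otimes>\<^bsub>G\<^esub> h))"
      using cofactor_eq_iff[OF aE l gH vp(1) hH] h_def by simp
    note vq = wd_product[OF aE l gH hH, folded veq]
    define W where "W = code a @ (l, True) # hat a g @ code a @ (l, True) # wd h"
    have "(a, h) \<in> P" using nz a hH by (simp add: P_def supp_def h_def)
    hence le: "weight (a, h) < weight s \<or> weight (a, h) = weight s \<and> exw (a, h) \<le> exw s" by (rule s(2))
    have lW: "length W \<le> weight (a, h)"
      using top(2)[OF aE g] by (auto simp: W_def weight_def)
    have "length (nf W) = weight s" using vq(2) wv lV by (simp add: W_def)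
    hence lens: "length (nf W) = length W" "length W = weight (a, h)" "weight (a, h) = weight s"
      using lW le length_nf[of W] by auto
    have "nf W = V" using vq(2) wv by (simp only: W_def)
    hence "W = V" using nf_eqI_length[OF lens(1)] by simp
    hence eq: "code a @ (l, True) # hat a g @ code a @ (l, True) # wd h =
        code a0 @ (l0, True) # hat a0 g0 @ code a0 @ (l0, True) # wd h0"
      by (simp add: W_def V_def)
    hence aa: "a = a0" using code_prefix_free[OF aE a0(2)] by blast
    have ll: "l = l0" and rest: "hat a0 g @ code a0 @ (l, True) # wd h = hat a0 g0 @ code a0 @ (l0, True) # wd h0"
      using eq by (auto simp: aa)
    have lh: "length (hat a0 g) = length (hat a0 g0)"
      using lens(2) by (simp add: W_def weight_def aa g0_def)
    hence hh: "hat a0 g = hat a0 g0" "wd h = wd h0" using rest by (auto simp: ll)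
    have "wd g = wd g0"
    proof -
      have "nf (wd g @ replicate (3 * pad a0) (p, True)) = nf (wd g0 @ replicate (3 * pad a0) (p, True))"
      proof -
        let ?P = "replicate (pad a0) (p, True)" and ?Q = "replicate (3 * pad a0) (p, True)"
        have "nf (inv_word ?P @ nf (?P @ wd g @ ?Q)) = nf (inv_word ?P @ nf (?P @ wd g0 @ ?Q))"
          using hh(1) by (simp only: hat_def)
        thus ?thesis
          using nf_cancel_left[of "[]" ?P "wd g @ ?Q"] nf_cancel_left[of "[]" ?P "wd g0 @ ?Q"] by simp
      qed
      hence "nf (wd g) = nf (wd g0)" by (rule nf_right_cancel)
      thus ?thesis using wd_closed gH g0(2) by (simp add: nf_reduced)
    qed
    moreover have "ex g = ex g0"
    proof -
      \<comment> \<open>Both exponents are bounded by their maximal counterparts and have the same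
        sum, so equality holds.\<close>
      have "ex g \<le> ex g0" using top(2)[OF aE g] lh by (auto simp: aa g0_def)
      moreover have "ex h + ex g0 \<le> ex h0 + ex g0"
        using le lens(3) by (simp add: exw_def s0 aa g0_def)
      moreover have "ex g + ex h = ex g0 + ex h0" using vp(3) vq(3) by simp
      ultimately show ?thesis by linarith
    qed
    ultimately show ?thesis using aa ll wd_ex_inj[OF gH g0(2)] by blast
  qed
  have cof: "cofactor a0 l0 g0 v = h0"
    using cofactor_eq_iff[OF a0(2) l0(1) g0(2) vp(1) a0(3)] v_def by simp
  have vG: "v \<in> carrier G" using vp(1) by simp
  have sand: "(sandwich a l \<otimes>\<^bsub>KG\<^esub> r a) v =
      (if a = a0 \<and> l = l0 then a0 g0 \<otimes>\<^bsub>K\<^esub> r a0 h0 else \<zero>\<^bsub>K\<^esub>)"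
    if a: "a \<in> S" and l: "l \<in> {p, q}" for a l
  proof -
    have aE: "a \<in> E" using a S by blast
    have ac: "a \<in> carrier KG" using E[OF aE] by simp
    have z: "a g \<otimes>\<^bsub>K\<^esub> r a (cofactor a l g v) = \<zero>\<^bsub>K\<^esub>"
      if "g \<in> supp a" "\<not> (a = a0 \<and> l = l0 \<and> g = g0)" for g
      using unique[OF a l that(1)] that(2) ac r[OF a] by (metis K.r_null coeff_closed)
    show ?thesis
    proof (cases "a = a0 \<and> l = l0")
      case True
      have "(\<Oplus>\<^bsub>K\<^esub>g\<in>supp a. a g \<otimes>\<^bsub>K\<^esub> r a (cofactor a l g v)) = a g0 \<otimes>\<^bsub>K\<^esub> r a (cofactor a l g0 v)"
        using True g0(1) ac r[OF a] z by (intro K.finsum_single) auto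
      thus ?thesis using True coeff_sandwich[OF aE l r[OF a] vG] cof by simp
    next
      case False
      hence "(\<Oplus>\<^bsub>K\<^esub>g\<in>supp a. a g \<otimes>\<^bsub>K\<^esub> r a (cofactor a l g v)) = \<zero>\<^bsub>K\<^esub>"
        using z by (intro K.finsum_eq_zero) auto
      thus ?thesis using False coeff_sandwich[OF aE l r[OF a] vG] by auto
    qed
  qed
  have nzc: "a0 g0 \<otimes>\<^bsub>K\<^esub> r a0 h0 \<noteq> \<zero>\<^bsub>K\<^esub>"
    using g0(1) a0 E r by (auto simp: supp_def K.integral_iff)
  have c0: "a0 g0 \<otimes>\<^bsub>K\<^esub> r a0 h0 \<in> carrier K" using a0 E r by auto
  have summand: "(unit_plus a \<otimes>\<^bsub>KG\<^esub> r a) v = (if a = a0 then a0 g0 \<otimes>\<^bsub>K\<^esub> r a0 h0 else \<zero>\<^bsub>K\<^esub>)"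
    if a: "a \<in> S" for a
  proof -
    have aE: "a \<in> E" using a S by blast
    have "unit_plus a \<otimes>\<^bsub>KG\<^esub> r a = r a \<oplus>\<^bsub>KG\<^esub>
        (sandwich a p \<otimes>\<^bsub>KG\<^esub> r a \<oplus>\<^bsub>KG\<^esub> sandwich a q \<otimes>\<^bsub>KG\<^esub> r a)"
      using sandwich_closed[OF aE] r[OF a] by (simp add: unit_plus_def R.l_distr)
    hence "(unit_plus a \<otimes>\<^bsub>KG\<^esub> r a) v = r a v \<oplus>\<^bsub>K\<^esub>
        ((sandwich a p \<otimes>\<^bsub>KG\<^esub> r a) v \<oplus>\<^bsub>K\<^esub> (sandwich a q \<otimes>\<^bsub>KG\<^esub> r a) v)"
      by simp
    thus ?thesis using center[OF a] sand[OF a] l0(1) pq(3) c0 by auto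
  qed
  have uc: "unit_plus a \<otimes>\<^bsub>KG\<^esub> r a \<in> carrier KG" if "a \<in> S" for a
    using that S r unit_plus_closed by (intro mult_closed) auto
  have "(\<Oplus>\<^bsub>KG\<^esub>a\<in>S. unit_plus a \<otimes>\<^bsub>KG\<^esub> r a) v = (\<Oplus>\<^bsub>K\<^esub>a\<in>S. (unit_plus a \<otimes>\<^bsub>KG\<^esub> r a) v)"
    using S(1) uc by (rule coeff_finsum)
  also have "\<dots> = (unit_plus a0 \<otimes>\<^bsub>KG\<^esub> r a0) v"
    using S(1) a0(1) summand c0 by (intro K.finsum_single) auto
  also have "\<dots> \<noteq> \<zero>\<^bsub>K\<^esub>" using nzc summand[OF a0(1)] by simp
  finally show ?thesis by auto
qed

text \<open>Right multiplication by \<open>h^-1\<close> moves a nonzero coefficient at an arbitrary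
  \<open>h\<close> to the identity, which lies in \<open>H\<close>; this places the relation within
  reach of \<open>independent_aux\<close>.\<close>

lemma independent:
  assumes S: "finite S" "S \<subseteq> E" and r: "\<And>a. a \<in> S \<Longrightarrow> r a \<in> carrier KG"
    and eq: "(\<Oplus>\<^bsub>KG\<^esub>a\<in>S. unit_plus a \<otimes>\<^bsub>KG\<^esub> r a) = \<zero>\<^bsub>KG\<^esub>" and a: "a \<in> S"
  shows "r a = \<zero>\<^bsub>KG\<^esub>"
proof (rule ccontr)
  assume ne: "r a \<noteq> \<zero>\<^bsub>KG\<^esub>"
  then obtain h where h: "r a h \<noteq> \<zero>\<^bsub>K\<^esub>" by (metis coeff_zero ext)
  have hG: "h \<in> carrier G" using h coeff_outside[OF r[OF a]] by blast
  let ?m = "monom \<one>\<^bsub>K\<^esub> (inv\<^bsub>G\<^esub> h)"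
  have m: "?m \<in> carrier KG" using hG by simp
  have "(\<Oplus>\<^bsub>KG\<^esub>a\<in>S. unit_plus a \<otimes>\<^bsub>KG\<^esub> (r a \<otimes>\<^bsub>KG\<^esub> ?m)) =
      (\<Oplus>\<^bsub>KG\<^esub>a\<in>S. (unit_plus a \<otimes>\<^bsub>KG\<^esub> r a) \<otimes>\<^bsub>KG\<^esub> ?m)"
    using S r m unit_plus_closed by (intro R.finsum_cong') (auto simp: R.m_assoc intro!: mult_closed)
  also have "\<dots> = (\<Oplus>\<^bsub>KG\<^esub>a\<in>S. unit_plus a \<otimes>\<^bsub>KG\<^esub> r a) \<otimes>\<^bsub>KG\<^esub> ?m"
    using S r m unit_plus_closed by (intro R.finsum_ldistr[symmetric]) (auto intro!: mult_closed)
  also have "\<dots> = \<zero>\<^bsub>KG\<^esub>" using eq m by simp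
  finally have "(\<Oplus>\<^bsub>KG\<^esub>a\<in>S. unit_plus a \<otimes>\<^bsub>KG\<^esub> (r a \<otimes>\<^bsub>KG\<^esub> ?m)) = \<zero>\<^bsub>KG\<^esub>" .
  moreover have "(r a \<otimes>\<^bsub>KG\<^esub> ?m) \<one>\<^bsub>G\<^esub> \<noteq> \<zero>\<^bsub>K\<^esub>"
    using h hG r[OF a] by (simp add: coeff_mult_monom)
  moreover have "r b \<otimes>\<^bsub>KG\<^esub> ?m \<in> carrier KG" if "b \<in> S" for b
    using that r m by (intro mult_closed)
  ultimately show False
    using independent_aux[OF S, of "\<lambda>a. r a \<otimes>\<^bsub>KG\<^esub> ?m" a "\<one>\<^bsub>G\<^esub>"] a H.one_closed by simp
qed

text \<open>The right ideal generated by the elements \<open>unit_plus a\<close>, to be used as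
  \<open>\<rho>\<close> in the comaximality criterion.\<close>

definition comax :: "('g \<Rightarrow> 'k) set" where
  "comax = {x. \<exists>S r. finite S \<and> S \<subseteq> E \<and> r \<in> E \<rightarrow> carrier KG \<and>
     x = (\<Oplus>\<^bsub>KG\<^esub>a\<in>S. unit_plus a \<otimes>\<^bsub>KG\<^esub> r a)}"

lemma term_closed: "r \<in> E \<rightarrow> carrier KG \<Longrightarrow> a \<in> E \<Longrightarrow> unit_plus a \<otimes>\<^bsub>KG\<^esub> r a \<in> carrier KG"
  using unit_plus_closed by (intro mult_closed) auto

lemma right_ideal_comax: "right_ideal KG comax"
proof (intro right_ideal.intro right_ideal_axioms.intro ring_KG)
  show "comax \<subseteq> carrier KG"
    using term_closed by (auto simp: comax_def intro!: R.finsum_closed)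
  show "\<zero>\<^bsub>KG\<^esub> \<in> comax"
    unfolding comax_def by (intro CollectI exI[of _ "{}"] exI[of _ "\<lambda>_. \<zero>\<^bsub>KG\<^esub>"]) auto
  show "x \<oplus>\<^bsub>KG\<^esub> y \<in> comax" if xy: "x \<in> comax" "y \<in> comax" for x y
  proof -
    obtain S r S' r' where S: "finite S" "S \<subseteq> E" "r \<in> E \<rightarrow> carrier KG"
        "x = (\<Oplus>\<^bsub>KG\<^esub>a\<in>S. unit_plus a \<otimes>\<^bsub>KG\<^esub> r a)"
      and S': "finite S'" "S' \<subseteq> E" "r' \<in> E \<rightarrow> carrier KG"
        "y = (\<Oplus>\<^bsub>KG\<^esub>a\<in>S'. unit_plus a \<otimes>\<^bsub>KG\<^esub> r' a)"
      using xy unfolding comax_def by blast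
    \<comment> \<open>Extension by zero, to bring both sums to the index set
      \<open>S \<union> S'\<close>.\<close>
    define f where "f S r a = (if a \<in> S then r a else \<zero>\<^bsub>KG\<^esub>)" for S and r :: "('g \<Rightarrow> 'k) \<Rightarrow> 'g \<Rightarrow> 'k" and a
    have fc: "f S r \<in> E \<rightarrow> carrier KG" "f S' r' \<in> E \<rightarrow> carrier KG"
      using S(3) S'(3) by (auto simp: f_def)
    have ext: "(\<Oplus>\<^bsub>KG\<^esub>a\<in>T. unit_plus a \<otimes>\<^bsub>KG\<^esub> s a) = (\<Oplus>\<^bsub>KG\<^esub>a\<in>S \<union> S'. unit_plus a \<otimes>\<^bsub>KG\<^esub> f T s a)"
      if "T \<subseteq> S \<union> S'" "s \<in> E \<rightarrow> carrier KG" for T s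
      using that S(1,2) S'(1,2) unit_plus_closed
      by (intro R.finsum_mono_neutral) (auto simp: f_def intro!: mult_closed)
    have "x \<oplus>\<^bsub>KG\<^esub> y = (\<Oplus>\<^bsub>KG\<^esub>a\<in>S \<union> S'. unit_plus a \<otimes>\<^bsub>KG\<^esub> f S r a \<oplus>\<^bsub>KG\<^esub> unit_plus a \<otimes>\<^bsub>KG\<^esub> f S' r' a)"
      unfolding S(4) S'(4) using ext[OF _ S(3)] ext[OF _ S'(3)] S(2) S'(2) term_closed[OF fc(1)] term_closed[OF fc(2)]
      by (simp, subst R.finsum_addf) auto
    also have "\<dots> = (\<Oplus>\<^bsub>KG\<^esub>a\<in>S \<union> S'. unit_plus a \<otimes>\<^bsub>KG\<^esub> (f S r a \<oplus>\<^bsub>KG\<^esub> f S' r' a))"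
      using S(2) S'(2) fc unit_plus_closed
      by (intro R.finsum_cong') (auto simp: R.r_distr Pi_iff subset_iff intro!: mult_closed)
    finally show ?thesis
      unfolding comax_def using S(1,2) S'(1,2) fc
      by (intro CollectI exI[of _ "S \<union> S'"] exI[of _ "\<lambda>a. f S r a \<oplus>\<^bsub>KG\<^esub> f S' r' a"]) auto
  qed
  show "x \<otimes>\<^bsub>KG\<^esub> s \<in> comax" if x: "x \<in> comax" and s: "s \<in> carrier KG" for x s
  proof -
    obtain S r where S: "finite S" "S \<subseteq> E" "r \<in> E \<rightarrow> carrier KG"
        "x = (\<Oplus>\<^bsub>KG\<^esub>a\<in>S. unit_plus a \<otimes>\<^bsub>KG\<^esub> r a)"
      using x unfolding comax_def by blast
    have "x \<otimes>\<^bsub>KG\<^esub> s = (\<Oplus>\<^bsub>KG\<^esub>a\<in>S. (unit_plus a \<otimes>\<^bsub>KG\<^esub> r a) \<otimes>\<^bsub>KG\<^esub> s)"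
      unfolding S(4) using S(1,2) s term_closed[OF S(3)] by (intro R.finsum_ldistr) auto
    also have "\<dots> = (\<Oplus>\<^bsub>KG\<^esub>a\<in>S. unit_plus a \<otimes>\<^bsub>KG\<^esub> (r a \<otimes>\<^bsub>KG\<^esub> s))"
      using S(2,3) s unit_plus_closed
      by (intro R.finsum_cong') (auto simp: R.m_assoc Pi_iff subset_iff intro!: mult_closed)
    finally show ?thesis
      unfolding comax_def using S s mult_closed
      by (intro CollectI exI[of _ S] exI[of _ "\<lambda>a. r a \<otimes>\<^bsub>KG\<^esub> s"]) auto
  qed
qed

text \<open>A relation \<open>1 = \<Sum>\<^sub>a (1 + sandwich a) r\<^sub>a\<close>, multiplied on the right by \<open>1 + sandwich b\<close> for a new \<open>b\<close>,
  would be a dependence.\<close>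

lemma one_notin_comax: "\<one>\<^bsub>KG\<^esub> \<notin> comax"
proof
  assume "\<one>\<^bsub>KG\<^esub> \<in> comax"
  then obtain S r where S: "finite S" "S \<subseteq> E" "r \<in> E \<rightarrow> carrier KG"
      "\<one>\<^bsub>KG\<^esub> = (\<Oplus>\<^bsub>KG\<^esub>a\<in>S. unit_plus a \<otimes>\<^bsub>KG\<^esub> r a)"
    unfolding comax_def by blast
  obtain b where b: "b \<in> E" "b \<notin> S" using E_infinite S(1) by (meson ex_new_if_finite finite_subset subsetI)
  note bc = unit_plus_closed[OF b(1)]
  define r' where "r' a = (if a = b then \<ominus>\<^bsub>KG\<^esub> \<one>\<^bsub>KG\<^esub> else r a \<otimes>\<^bsub>KG\<^esub> unit_plus b)" for a
  have r': "r' a \<in> carrier KG" if "a \<in> insert b S" for a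
    using that S(2,3) bc by (auto simp: r'_def intro!: mult_closed)
  have "(\<Oplus>\<^bsub>KG\<^esub>a\<in>S. unit_plus a \<otimes>\<^bsub>KG\<^esub> r' a) = (\<Oplus>\<^bsub>KG\<^esub>a\<in>S. (unit_plus a \<otimes>\<^bsub>KG\<^esub> r a) \<otimes>\<^bsub>KG\<^esub> unit_plus b)"
    using S(2,3) b bc unit_plus_closed
    by (intro R.finsum_cong') (auto simp: r'_def R.m_assoc Pi_iff subset_iff intro!: mult_closed)
  also have "\<dots> = (\<Oplus>\<^bsub>KG\<^esub>a\<in>S. unit_plus a \<otimes>\<^bsub>KG\<^esub> r a) \<otimes>\<^bsub>KG\<^esub> unit_plus b"
    using S(1,2) bc term_closed[OF S(3)] by (intro R.finsum_ldistr[symmetric]) auto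
  also have "\<dots> = unit_plus b" using S(4)[symmetric] bc by simp
  finally have "(\<Oplus>\<^bsub>KG\<^esub>a\<in>S. unit_plus a \<otimes>\<^bsub>KG\<^esub> r' a) = unit_plus b" .
  moreover have "unit_plus b \<otimes>\<^bsub>KG\<^esub> r' b = \<ominus>\<^bsub>KG\<^esub> unit_plus b"
    using bc by (simp add: r'_def R.r_minus)
  moreover have "unit_plus a \<otimes>\<^bsub>KG\<^esub> r' a \<in> carrier KG" if "a \<in> insert b S" for a
    using that r' b S(2) unit_plus_closed by (intro mult_closed) auto
  ultimately have "(\<Oplus>\<^bsub>KG\<^esub>a\<in>insert b S. unit_plus a \<otimes>\<^bsub>KG\<^esub> r' a) = \<zero>\<^bsub>KG\<^esub>"
    using S(1) b(2) bc by (subst R.finsum_insert) (auto simp: R.l_neg)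
  hence "r' b = \<zero>\<^bsub>KG\<^esub>"
    using independent[of "insert b S" r' b] S(1,2) b r' by simp
  hence "(\<ominus>\<^bsub>KG\<^esub> \<one>\<^bsub>KG\<^esub>) \<one>\<^bsub>G\<^esub> = \<zero>\<^bsub>K\<^esub>" by (simp add: r'_def)
  thus False by (simp add: one_eq_monom) (simp add: monom_def)
qed

theorem primitive_KG:
  assumes meets: "\<And>I. ideal I KG \<Longrightarrow> I \<noteq> {\<zero>\<^bsub>KG\<^esub>} \<Longrightarrow> I \<inter> E \<noteq> {}"
  shows "primitive_ring KG"
proof (rule R.primitive_ringI_comaximal[OF right_ideal_comax one_notin_comax])
  fix I assume I: "ideal I KG" "I \<noteq> {\<zero>\<^bsub>KG\<^esub>}"
  then interpret I: ideal I KG by simp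
  obtain a where a: "a \<in> I" "a \<in> E" using meets[OF I] by blast
  let ?e = "sandwich a p \<oplus>\<^bsub>KG\<^esub> sandwich a q"
  have "sandwich a l \<in> I" if "l \<in> {p, q}" for l
  proof -
    have "lift (left_word a l) \<in> carrier G" "lift (right_word a l) \<in> carrier G"
      using lift[OF left_word_closed[OF a(2) that]] lift[OF right_word_closed[OF a(2) that]]
      by (blast intro: H.mem_carrier)+
    thus ?thesis
      unfolding sandwich_def by (intro I.I_r_closed[OF I.I_l_closed[OF a(1)]] monom_closed K.one_closed)
  qed
  hence e: "\<ominus>\<^bsub>KG\<^esub> ?e \<in> I" "?e \<in> carrier KG"
    using I.a_closed I.a_inv_closed sandwich_closed[OF a(2)] by auto
  have "unit_plus a \<in> comax"
    unfolding comax_def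
  proof (intro CollectI exI conjI)
    show "unit_plus a = (\<Oplus>\<^bsub>KG\<^esub>b\<in>{a}. unit_plus b \<otimes>\<^bsub>KG\<^esub> \<one>\<^bsub>KG\<^esub>)"
      using unit_plus_closed[OF a(2)] by simp
  qed (use a(2) in auto)
  \<comment> \<open>The decomposition \<open>1 = - e + (1 + e)\<close>, where \<open>e\<close> lies
    in \<open>I\<close> because \<open>a\<close> does.\<close>
  moreover have "\<ominus>\<^bsub>KG\<^esub> ?e \<oplus>\<^bsub>KG\<^esub> unit_plus a = \<one>\<^bsub>KG\<^esub>"
    using e(2) by (simp add: unit_plus_def R.a_lcomm[of "\<ominus>\<^bsub>KG\<^esub> ?e" "\<one>\<^bsub>KG\<^esub>" ?e] R.l_neg)
  ultimately show "\<exists>x\<in>I. \<exists>y\<in>comax. x \<oplus>\<^bsub>KG\<^esub> y = \<one>\<^bsub>KG\<^esub>" using e(1) by blast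
qed

end

section \<open>Cardinalities\<close>

lemma times_lepoll_infinite: "infinite A \<Longrightarrow> A \<times> A \<lesssim> A"
  using card_of_Times_same_infinite eqpoll_iff_card_of_ordIso eqpoll_imp_lepoll by blast

lemma times_lepoll:
  assumes "infinite C" "A \<lesssim> C" "B \<lesssim> C"
  shows "A \<times> B \<lesssim> C"
  using times_lepoll_mono[OF assms(2,3)] times_lepoll_infinite[OF assms(1)] lepoll_trans by blast

text \<open>An injective pairing is folded over the list. The result need not determine the length,
  so the length is recorded with it.\<close>

lemma lists_lepoll:
  assumes A: "infinite A"
  shows "lists A \<lesssim> A"
proof -
  obtain pr where pr: "inj_on pr (A \<times> A)" "pr ` (A \<times> A) \<subseteq> A"
    using times_lepoll_infinite[OF A] by (auto simp: lepoll_def)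
  obtain a0 where a0: "a0 \<in> A" using A by fastforce
  define enc where "enc = foldr (\<lambda>x y. pr (x, y))"
  have mem: "enc xs a0 \<in> A" if "xs \<in> lists A" for xs
    using that pr(2) a0 by (induction xs) (auto simp: enc_def)
  have inj: "xs = ys"
    if "xs \<in> lists A" "ys \<in> lists A" "length xs = length ys" "enc xs a0 = enc ys a0" for xs ys
    using that(3,1,2,4)
  proof (induction rule: list_induct2)
    case (Cons x xs y ys)
    have "xs \<in> lists A" "ys \<in> lists A" "x \<in> A" "y \<in> A" using Cons.prems by auto
    moreover have "pr (x, enc xs a0) = pr (y, enc ys a0)" using Cons.prems by (simp add: enc_def)
    ultimately have "x = y" "enc xs a0 = enc ys a0"
      using inj_onD[OF pr(1), of "(x, enc xs a0)" "(y, enc ys a0)"] mem by auto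
    thus ?case using Cons by auto
  qed simp
  have "inj_on (\<lambda>xs. (length xs, enc xs a0)) (lists A)"
    by (rule inj_onI) (auto intro: inj)
  moreover have "(\<lambda>xs. (length xs, enc xs a0)) ` lists A \<subseteq> UNIV \<times> A" using mem by auto
  ultimately have "lists A \<lesssim> (UNIV :: nat set) \<times> A" by (auto simp: lepoll_def)
  moreover have "(UNIV :: nat set) \<times> A \<lesssim> A"
    using A by (intro times_lepoll) (auto simp: infinite_le_lepoll)
  ultimately show ?thesis by (rule lepoll_trans)
qed

lemma finite_subsets_lepoll:
  fixes C :: "'a set" and B :: "'b set"
  assumes "infinite B" "C \<lesssim> B"
  shows "{S. finite S \<and> S \<subseteq> C} \<lesssim> B"
proof -
  define f where "f S = (SOME xs. set xs = S)" for S :: "'a set"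
  have f: "set (f S) = S" if "finite S" for S
    unfolding f_def using finite_list[OF that] by (rule someI_ex)
  have "inj_on f {S. finite S \<and> S \<subseteq> C}"
    by (rule inj_onI) (metis (mono_tags) f mem_Collect_eq)
  moreover have "f ` {S. finite S \<and> S \<subseteq> C} \<subseteq> lists C" using f by (auto simp: lists_eq_set)
  ultimately have "{S. finite S \<and> S \<subseteq> C} \<lesssim> lists C" by (auto simp: lepoll_def)
  also have "lists C \<lesssim> lists B" by (rule lists_lepoll_mono[OF assms(2)])
  also have "lists B \<lesssim> B" by (rule lists_lepoll[OF assms(1)])
  finally show ?thesis .
qed

lemma finite_fibres_lepoll:
  fixes A :: "'a set" and B :: "'b set"
  assumes "infinite B" "f ` A \<subseteq> B" "\<And>b. finite {a \<in> A. f a = b}"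
  shows "A \<lesssim> B"
proof -
  have "\<forall>b. \<exists>e :: 'a \<Rightarrow> nat. inj_on e {a \<in> A. f a = b}"
    using finite_imp_inj_to_nat_seg[OF assms(3)] by blast
  then obtain e :: "'b \<Rightarrow> 'a \<Rightarrow> nat" where e: "\<And>b. inj_on (e b) {a \<in> A. f a = b}" by metis
  have "inj_on (\<lambda>a. (f a, e (f a) a)) A"
    by (rule inj_onI) (use inj_onD[OF e] in fastforce)
  moreover have "(\<lambda>a. (f a, e (f a) a)) ` A \<subseteq> B \<times> UNIV" using assms(2) by auto
  ultimately have "A \<lesssim> B \<times> (UNIV :: nat set)" by (auto simp: lepoll_def)
  also have "B \<times> (UNIV :: nat set) \<lesssim> B"
    using assms(1) by (intro times_lepoll) (auto simp: infinite_le_lepoll)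
  finally show ?thesis .
qed

section \<open>Nonzero ideals contain small elements\<close>

context group_algebra
begin

text \<open>An element is determined by the graph of its restriction to its support, a finite subset
  of \<open>carrier G \<times> D\<close>.\<close>

lemma finite_support_lepoll:
  assumes B: "infinite B" "carrier G \<lesssim> B" "D \<lesssim> B"
  shows "{a \<in> carrier KG. \<forall>x. a x \<in> D} \<lesssim> B"
proof -
  define gr where "gr a = (\<lambda>x. (x, a x)) ` supp a" for a
  let ?A = "{a \<in> carrier KG. \<forall>x. a x \<in> D}"
  have "inj_on gr ?A"
  proof (rule inj_onI, rule ext)
    fix a b x assume "gr a = gr b"
    hence "(x, y) \<in> gr a \<longleftrightarrow> (x, y) \<in> gr b" for y by simp
    hence "x \<in> supp a \<and> y = a x \<longleftrightarrow> x \<in> supp b \<and> y = b x" for y by (auto simp: gr_def)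
    thus "a x = b x" unfolding supp_def by (metis mem_Collect_eq)
  qed
  moreover have "gr ` ?A \<subseteq> {S. finite S \<and> S \<subseteq> carrier G \<times> D}"
    using supp_carrier by (auto simp: gr_def)
  ultimately have "?A \<lesssim> {S. finite S \<and> S \<subseteq> carrier G \<times> D}" by (auto simp: lepoll_def)
  also have "\<dots> \<lesssim> B" by (intro finite_subsets_lepoll times_lepoll B)
  finally show ?thesis .
qed

lemma scalar_central:
  assumes "c \<in> carrier K" "a \<in> carrier KG"
  shows "monom c \<one>\<^bsub>G\<^esub> \<otimes>\<^bsub>KG\<^esub> a = a \<otimes>\<^bsub>KG\<^esub> monom c \<one>\<^bsub>G\<^esub>"
  using assms
  by (intro KG_eqI mult_closed) (auto simp: coeff_monom_mult coeff_mult_monom K.m_comm)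

lemma coeff_scalar:
  assumes "c \<in> carrier K" "a \<in> carrier KG"
  shows "(monom c \<one>\<^bsub>G\<^esub> \<otimes>\<^bsub>KG\<^esub> a) x = c \<otimes>\<^bsub>K\<^esub> a x"
  using assms coeff_outside[of a x] coeff_outside[of "monom c \<one>\<^bsub>G\<^esub> \<otimes>\<^bsub>KG\<^esub> a" x] mult_closed
  by (cases "x \<in> carrier G") (auto simp: coeff_monom_mult)

lemma coeff_triple:
  assumes u: "u \<in> carrier KG" and a: "a \<in> carrier KG" and x: "x \<in> carrier G" and v: "v \<in> carrier G"
  shows "(u \<otimes>\<^bsub>KG\<^esub> (monom \<one>\<^bsub>K\<^esub> x \<otimes>\<^bsub>KG\<^esub> a)) v =
    (\<Oplus>\<^bsub>K\<^esub>g\<in>supp u. u g \<otimes>\<^bsub>K\<^esub> a (inv\<^bsub>G\<^esub> x \<otimes>\<^bsub>G\<^esub> (inv\<^bsub>G\<^esub> g \<otimes>\<^bsub>G\<^esub> v)))"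
proof -
  have "(u \<otimes>\<^bsub>KG\<^esub> (monom \<one>\<^bsub>K\<^esub> x \<otimes>\<^bsub>KG\<^esub> a)) v =
      (\<Oplus>\<^bsub>K\<^esub>g\<in>supp u. u g \<otimes>\<^bsub>K\<^esub> (monom \<one>\<^bsub>K\<^esub> x \<otimes>\<^bsub>KG\<^esub> a) (inv\<^bsub>G\<^esub> g \<otimes>\<^bsub>G\<^esub> v))"
    using u a x v supp_subset[OF u] by (intro coeff_mult mult_closed) auto
  also have "\<dots> = (\<Oplus>\<^bsub>K\<^esub>g\<in>supp u. u g \<otimes>\<^bsub>K\<^esub> a (inv\<^bsub>G\<^esub> x \<otimes>\<^bsub>G\<^esub> (inv\<^bsub>G\<^esub> g \<otimes>\<^bsub>G\<^esub> v)))"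
    using u a x v supp_carrier[OF u] by (intro K.finsum_cong') (auto simp: coeff_monom_mult)
  finally show ?thesis .
qed

text \<open>Uniqueness leaves only the summand of \<open>g\<close> in the convolution. The points
  \<open>g\<close> and \<open>h\<close> may lie outside the supports, where both sides vanish; the
  later comparison of coefficients uses such points.\<close>

lemma coeff_triple_unique:
  assumes u: "u \<in> carrier KG" and a: "a \<in> carrier KG"
    and x: "x \<in> carrier G" and gh: "g \<in> carrier G" "h \<in> carrier G"
    and uniq: "\<And>g' h'. g' \<in> supp u \<Longrightarrow> h' \<in> supp a \<Longrightarrow>
      g' \<otimes>\<^bsub>G\<^esub> x \<otimes>\<^bsub>G\<^esub> h' = g \<otimes>\<^bsub>G\<^esub> x \<otimes>\<^bsub>G\<^esub> h \<Longrightarrow> g' = g"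
  shows "(u \<otimes>\<^bsub>KG\<^esub> (monom \<one>\<^bsub>K\<^esub> x \<otimes>\<^bsub>KG\<^esub> a)) (g \<otimes>\<^bsub>G\<^esub> x \<otimes>\<^bsub>G\<^esub> h) = u g \<otimes>\<^bsub>K\<^esub> a h"
proof -
  let ?v = "g \<otimes>\<^bsub>G\<^esub> x \<otimes>\<^bsub>G\<^esub> h"
  let ?f = "\<lambda>g. u g \<otimes>\<^bsub>K\<^esub> a (inv\<^bsub>G\<^esub> x \<otimes>\<^bsub>G\<^esub> (inv\<^bsub>G\<^esub> g \<otimes>\<^bsub>G\<^esub> ?v))"
  have v: "?v \<in> carrier G" using x gh by simp
  have fg: "?f g = u g \<otimes>\<^bsub>K\<^esub> a h" using x gh by (simp add: G.m_assoc)
  have z: "?f g' = \<zero>\<^bsub>K\<^esub>" if g': "g' \<in> supp u" "g' \<noteq> g" for g'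
  proof -
    let ?h' = "inv\<^bsub>G\<^esub> x \<otimes>\<^bsub>G\<^esub> (inv\<^bsub>G\<^esub> g' \<otimes>\<^bsub>G\<^esub> ?v)"
    have "g' \<otimes>\<^bsub>G\<^esub> x \<otimes>\<^bsub>G\<^esub> ?h' = ?v" using supp_carrier[OF u g'(1)] x v by (simp add: G.m_assoc)
    hence "?h' \<notin> supp a" using uniq[OF g'(1)] g'(2) by blast
    hence "a ?h' = \<zero>\<^bsub>K\<^esub>" by (simp only: not_in_supp)
    thus ?thesis using u by simp
  qed
  have "(u \<otimes>\<^bsub>KG\<^esub> (monom \<one>\<^bsub>K\<^esub> x \<otimes>\<^bsub>KG\<^esub> a)) ?v = (\<Oplus>\<^bsub>K\<^esub>g\<in>insert g (supp u). ?f g)"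
    unfolding coeff_triple[OF u a x v] using u a gh
    by (intro K.finsum_mono_neutral) (auto simp: not_in_supp)
  also have "\<dots> = ?f g" using u a z by (intro K.finsum_single) auto
  finally show ?thesis using fg by simp
qed

lemma supp_triple:
  assumes "u \<in> carrier KG" "a \<in> carrier KG" "x \<in> carrier G"
    and v: "v \<in> supp (u \<otimes>\<^bsub>KG\<^esub> (monom \<one>\<^bsub>K\<^esub> x \<otimes>\<^bsub>KG\<^esub> a))"
  obtains g h where "g \<in> supp u" "h \<in> supp a" "v = g \<otimes>\<^bsub>G\<^esub> x \<otimes>\<^bsub>G\<^esub> h"
proof -
  have m: "monom \<one>\<^bsub>K\<^esub> x \<in> carrier KG" using assms(3) by simp
  obtain g y where g: "g \<in> supp u" "y \<in> supp (monom \<one>\<^bsub>K\<^esub> x \<otimes>\<^bsub>KG\<^esub> a)" "v = g \<otimes>\<^bsub>G\<^esub> y"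
    using supp_mult[OF assms(1) mult_closed[OF m assms(2)]] v by auto
  obtain x' h where h: "x' \<in> supp (monom \<one>\<^bsub>K\<^esub> x)" "h \<in> supp a" "y = x' \<otimes>\<^bsub>G\<^esub> h"
    using supp_mult[OF m assms(2)] g(2) by auto
  have "x' = x" using h(1) by (auto simp: supp_def monom_def split: if_splits)
  hence "v = g \<otimes>\<^bsub>G\<^esub> x \<otimes>\<^bsub>G\<^esub> h"
    using g h supp_carrier[OF assms(1) g(1)] supp_carrier[OF assms(2) h(2)] assms(3)
    by (simp add: G.m_assoc)
  thus thesis using that g h by blast
qed

lemma supp_minus:
  assumes "a \<in> carrier KG" "b \<in> carrier KG"
  shows "supp (a \<ominus>\<^bsub>KG\<^esub> b) \<subseteq> supp a \<union> supp b"
  using assms by (auto simp: supp_def R.minus_eq)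

lemma supp_empty_iff: "a \<in> carrier KG \<Longrightarrow> supp a = {} \<longleftrightarrow> a = \<zero>\<^bsub>KG\<^esub>"
  by (auto simp: supp_def)

lemma monom_decomposition:
  assumes a: "a \<in> carrier KG"
  shows "a = (\<Oplus>\<^bsub>KG\<^esub>g\<in>supp a. monom (a g) \<one>\<^bsub>G\<^esub> \<otimes>\<^bsub>KG\<^esub> monom \<one>\<^bsub>K\<^esub> g)"
proof (rule ext)
  fix x
  have "(\<Oplus>\<^bsub>KG\<^esub>g\<in>supp a. monom (a g) \<one>\<^bsub>G\<^esub> \<otimes>\<^bsub>KG\<^esub> monom \<one>\<^bsub>K\<^esub> g) x =
      (\<Oplus>\<^bsub>K\<^esub>g\<in>supp a. (monom (a g) \<one>\<^bsub>G\<^esub> \<otimes>\<^bsub>KG\<^esub> monom \<one>\<^bsub>K\<^esub> g) x)"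
    using a supp_carrier[OF a] by (intro coeff_finsum) auto
  also have "\<dots> = (\<Oplus>\<^bsub>K\<^esub>g\<in>supp a. if x = g then a g else \<zero>\<^bsub>K\<^esub>)"
  proof (rule K.finsum_cong'[OF HOL.refl])
    fix g assume g: "g \<in> supp a"
    show "(monom (a g) \<one>\<^bsub>G\<^esub> \<otimes>\<^bsub>KG\<^esub> monom \<one>\<^bsub>K\<^esub> g) x = (if x = g then a g else \<zero>\<^bsub>K\<^esub>)"
      using a supp_carrier[OF a g] by (simp add: coeff_scalar) (simp add: monom_def)
  qed (use a in auto)
  also have "\<dots> = a x"
  proof (cases "x \<in> supp a")
    case True
    thus ?thesis using a K.finsum_single[of "supp a" x "\<lambda>g. if x = g then a g else \<zero>\<^bsub>K\<^esub>"] by simp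
  next
    case False
    hence "(\<Oplus>\<^bsub>K\<^esub>g\<in>supp a. if x = g then a g else \<zero>\<^bsub>K\<^esub>) = \<zero>\<^bsub>K\<^esub>"
      by (intro K.finsum_eq_zero) auto
    thus ?thesis using False by (simp add: not_in_supp)
  qed
  finally show "a x = (\<Oplus>\<^bsub>KG\<^esub>g\<in>supp a. monom (a g) \<one>\<^bsub>G\<^esub> \<otimes>\<^bsub>KG\<^esub> monom \<one>\<^bsub>K\<^esub> g) x" by simp
qed

end

lemma (in ring) add_minus_cancel:
  "a \<in> carrier R \<Longrightarrow> b \<in> carrier R \<Longrightarrow> a \<oplus> b \<ominus> b = a"
  by (simp add: minus_eq a_assoc r_neg)

lemma (in ring) minus_zero_imp_eq:
  assumes "a \<in> carrier R" "b \<in> carrier R" "a \<ominus> b = \<zero>"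
  shows "a = b"
proof -
  have "a = (a \<ominus> b) \<oplus> b" using assms(1,2) by (simp add: minus_eq a_assoc l_neg)
  thus ?thesis using assms by simp
qed

lemma (in ring) add_add_minus_cancel:
  assumes "a \<in> carrier R" "b \<in> carrier R" "c \<in> carrier R"
  shows "(a \<oplus> b) \<ominus> (a \<oplus> c) = b \<ominus> c"
proof -
  have "(a \<oplus> b) \<ominus> (a \<oplus> c) = b \<oplus> (a \<oplus> (\<ominus> a \<oplus> \<ominus> c))"
    using assms by (simp add: minus_eq minus_add a_assoc a_comm[of a b])
  thus ?thesis using assms by (simp add: minus_eq r_neg2)
qed

locale hnn_algebra = free_ascending_ext F G \<phi> \<beta> t \<delta> + group_algebra K G
  for F :: "('a, 'm) monoid_scheme" and G :: "('g, 'n) monoid_scheme" (structure)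
    and \<phi> \<beta> t \<delta> and K :: "('k, 'l) ring_scheme"
begin

text \<open>The equation \<open>g' x h' = g x h\<close> reads \<open>x u = v x\<close> with
  \<open>u = h h'^-1\<close> and \<open>v = g^-1 g'\<close>. An \<open>x\<close> separating all such
  pairs with noncentral \<open>u\<close> leaves only central \<open>u\<close>, and then
  \<open>u = v\<close>.\<close>

lemma separating_products:
  assumes S: "finite S" "S \<subseteq> carrier G"
  obtains x where "x \<in> carrier F"
    "\<And>g g' h h'. \<lbrakk>g \<in> S; g' \<in> S; h \<in> S; h' \<in> S; g' \<otimes> \<beta> x \<otimes> h' = g \<otimes> \<beta> x \<otimes> h\<rbrakk> \<Longrightarrow>
      \<exists>c. central G c \<and> g' = g \<otimes> c \<and> h = c \<otimes> h'"
proof -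
  define I where "I = {(u, v) \<in> (\<lambda>(h, h'). h \<otimes> inv h') ` (S \<times> S) \<times> (\<lambda>(g, g'). inv g \<otimes> g') ` (S \<times> S).
    \<not> central G u}"
  have "finite I"
    by (rule finite_subset[of _ "(\<lambda>(h, h'). h \<otimes> inv h') ` (S \<times> S) \<times> (\<lambda>(g, g'). inv g \<otimes> g') ` (S \<times> S)"])
       (use S(1) in \<open>auto simp: I_def\<close>)
  moreover have "u \<in> carrier G \<and> v \<in> carrier G \<and> \<not> central G u" if "(u, v) \<in> I" for u v
    using that S(2) by (auto simp: I_def)
  ultimately obtain x where x: "x \<in> carrier F" "\<forall>(u, v)\<in>I. \<beta> x \<otimes> u \<noteq> v \<otimes> \<beta> x"
    using separating_element by blast
  have "\<exists>c. central G c \<and> g' = g \<otimes> c \<and> h = c \<otimes> h'"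
    if gh: "g \<in> S" "g' \<in> S" "h \<in> S" "h' \<in> S" and eq: "g' \<otimes> \<beta> x \<otimes> h' = g \<otimes> \<beta> x \<otimes> h" for g g' h h'
  proof -
    have c: "g \<in> carrier G" "g' \<in> carrier G" "h \<in> carrier G" "h' \<in> carrier G" "\<beta> x \<in> carrier G"
      using gh S(2) x(1) by auto
    define u v where "u = h \<otimes> inv h'" and "v = inv g \<otimes> g'"
    have uv: "u \<in> carrier G" "v \<in> carrier G" using c by (auto simp: u_def v_def)
    have "\<beta> x \<otimes> u = inv g \<otimes> (g \<otimes> \<beta> x \<otimes> h) \<otimes> inv h'" using c by (simp add: u_def G.m_assoc)
    also have "\<dots> = v \<otimes> \<beta> x" using c by (simp add: eq[symmetric] v_def G.m_assoc)
    finally have xu: "\<beta> x \<otimes> u = v \<otimes> \<beta> x" .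
    have "central G u"
    proof (rule ccontr)
      assume "\<not> central G u"
      hence "(u, v) \<in> I" using gh by (force simp: I_def u_def v_def)
      thus False using x(2) xu by blast
    qed
    moreover from this have "u \<otimes> \<beta> x = v \<otimes> \<beta> x" using xu c by (simp add: central_def)
    hence "u = v" using uv c by simp
    moreover have "g' = g \<otimes> v" "h = u \<otimes> h'" using c by (auto simp: u_def v_def G.m_assoc)
    ultimately show ?thesis by blast
  qed
  thus thesis using that x(1) by blast
qed

lemma ideal_minus_closed:
  assumes "ideal I KG" "a \<in> I" "b \<in> I"
  shows "a \<ominus>\<^bsub>KG\<^esub> b \<in> I"
proof -
  interpret I: ideal I KG by fact
  show ?thesis using assms(2,3) by (simp add: R.minus_eq I.a_closed I.a_inv_closed)
qed

lemma ideal_commutator: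
  assumes I: "ideal I KG" and a: "a \<in> I" and u: "u \<in> carrier KG" and x: "x \<in> carrier KG"
  shows "u \<otimes>\<^bsub>KG\<^esub> (x \<otimes>\<^bsub>KG\<^esub> a) \<ominus>\<^bsub>KG\<^esub> a \<otimes>\<^bsub>KG\<^esub> (x \<otimes>\<^bsub>KG\<^esub> u) \<in> I"
proof -
  interpret I: ideal I KG by fact
  show ?thesis using a u x
    by (intro ideal_minus_closed[OF I] I.I_l_closed I.I_r_closed[OF a] mult_closed)
qed

text \<open>Take a nonzero element \<open>\<Sum>\<^sub>i l\<^sub>i u\<^sub>i\<close> of the ideal, where every \<open>u\<^sub>i\<close> has coefficients in \<open>D\<close> and a
  support of constant degree, with the least number of summands. Then \<open>u\<^sub>i x a = a x u\<^sub>i\<close> for all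
  \<open>x \<in> F\<close>, and a separating \<open>x\<close> shows that \<open>a\<close> is a scalar multiple of \<open>u\<^sub>i\<close>.\<close>

lemma ideal_contains_homogeneous:
  assumes centerless: "\<And>z. central G z \<Longrightarrow> z = \<one>"
    and D: "D \<subseteq> carrier K" "\<zero>\<^bsub>K\<^esub> \<in> D" "\<one>\<^bsub>K\<^esub> \<in> D"
      "\<And>c d. c \<in> D \<Longrightarrow> d \<in> D \<Longrightarrow> c \<otimes>\<^bsub>K\<^esub> d \<in> D"
      "\<And>c d. c \<in> D \<Longrightarrow> d \<in> D \<Longrightarrow> c \<oplus>\<^bsub>K\<^esub> d \<in> D" "\<And>c. c \<in> D \<Longrightarrow> \<ominus>\<^bsub>K\<^esub> c \<in> D"
    and I: "ideal I KG" "I \<noteq> {\<zero>\<^bsub>KG\<^esub>}"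
  shows "\<exists>u\<in>I. \<exists>d. u \<noteq> \<zero>\<^bsub>KG\<^esub> \<and> (\<forall>x. u x \<in> D) \<and> (\<forall>g\<in>supp u. \<delta> g = d)"
proof -
  interpret I: ideal I KG by (rule I)
  define hom where "hom d = {u \<in> carrier KG. (\<forall>x. u x \<in> D) \<and> (\<forall>g\<in>supp u. \<delta> g = d)}" for d
  \<comment> \<open>Indices are group elements because the first representation of an element is
    indexed by its support, with monomials as the \<open>u i\<close>. The scalars come from
    \<open>K\<close>, the \<open>u i\<close> have coefficients in \<open>D\<close>.\<close>
  define rep where "rep T a l u e \<longleftrightarrow> finite T \<and> a \<in> I \<and> a \<noteq> \<zero>\<^bsub>KG\<^esub> \<and>
    (\<forall>i\<in>T. l i \<in> carrier K \<and> u i \<in> hom (e i)) \<and>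
    a = (\<Oplus>\<^bsub>KG\<^esub>i\<in>T. monom (l i) \<one> \<otimes>\<^bsub>KG\<^esub> u i)"
    for T :: "'g set" and a l u and e :: "'g \<Rightarrow> int"
  have sumD: "(\<Oplus>\<^bsub>K\<^esub>i\<in>A. f i) \<in> D" if "finite A" "\<And>i. i \<in> A \<Longrightarrow> f i \<in> D" for A :: "'g set" and f
    using that
  proof (induction A rule: finite_induct)
    case (insert i A)
    moreover have "f \<in> A \<rightarrow> carrier K" "f i \<in> carrier K" using insert.prems D(1) by auto
    ultimately show ?case using D(5) by (simp add: K.finsum_insert)
  qed (simp add: D)
  have hom_triple: "u \<otimes>\<^bsub>KG\<^esub> (monom \<one>\<^bsub>K\<^esub> (\<beta> x) \<otimes>\<^bsub>KG\<^esub> w) \<in> hom (d + e)"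
    if "u \<in> hom d" "w \<in> hom e" "x \<in> carrier F" for u w d e x
  proof -
    have uw: "u \<in> carrier KG" "w \<in> carrier KG" using that by (auto simp: hom_def)
    have bx: "\<beta> x \<in> carrier G" using that by simp
    let ?p = "u \<otimes>\<^bsub>KG\<^esub> (monom \<one>\<^bsub>K\<^esub> (\<beta> x) \<otimes>\<^bsub>KG\<^esub> w)"
    have pc: "?p \<in> carrier KG" using uw bx by (intro mult_closed monom_closed) auto
    moreover have "?p v \<in> D" for v
    proof (cases "v \<in> carrier G")
      case True
      show ?thesis unfolding coeff_triple[OF uw bx True]
        using that uw by (intro sumD D(4)) (auto simp: hom_def)
    qed (use coeff_outside[OF pc] D(2) in auto)
    moreover have "\<delta> v = d + e" if v: "v \<in> supp ?p" for v
    proof -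
      obtain g h where gh: "g \<in> supp u" "h \<in> supp w" "v = g \<otimes> \<beta> x \<otimes> h"
        by (rule supp_triple[OF uw bx v])
      moreover have "g \<in> carrier G" "h \<in> carrier G" using gh supp_carrier uw by auto
      ultimately show ?thesis using \<open>u \<in> hom d\<close> \<open>w \<in> hom e\<close> \<open>x \<in> carrier F\<close>
        by (auto simp: hom_def)
    qed
    ultimately show ?thesis by (simp add: hom_def)
  qed
  have hom_minus: "u \<ominus>\<^bsub>KG\<^esub> w \<in> hom d" if "u \<in> hom d" "w \<in> hom d" for u w d
    using that supp_minus[of u w] D(5,6)
    by (auto simp: hom_def R.minus_eq subset_iff)
  obtain a0 where a0: "a0 \<in> I" "a0 \<noteq> \<zero>\<^bsub>KG\<^esub>" using I.zero_closed I(2) by blast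
  have a0c: "a0 \<in> carrier KG" using a0 I.Icarr by blast
  have "rep (supp a0) a0 a0 (monom \<one>\<^bsub>K\<^esub>) \<delta>"
    unfolding rep_def using a0 a0c monom_decomposition[OF a0c] supp_carrier[OF a0c] D
    by (auto simp: hom_def) (auto simp: monom_def supp_def split: if_splits)
  hence ex: "\<exists>T a l u e. rep T a l u e" by blast
  define n where "n = (LEAST n. \<exists>T a l u e. rep T a l u e \<and> card T = n)"
  have "\<exists>T a l u e. rep T a l u e \<and> card T = n"
    unfolding n_def by (rule LeastI_ex) (use ex in blast)
  then obtain T a l u e where r: "rep T a l u e" "card T = n" by blast
  have least: "n \<le> card T'" if "rep T' a' l' u' e'" for T' a' l' u' e'
    unfolding n_def by (rule Least_le) (use that in blast)
  have T: "finite T" and a: "a \<in> I" "a \<noteq> \<zero>\<^bsub>KG\<^esub>"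
    and lu: "\<And>i. i \<in> T \<Longrightarrow> l i \<in> carrier K" "\<And>i. i \<in> T \<Longrightarrow> u i \<in> hom (e i)"
    and aeq: "a = (\<Oplus>\<^bsub>KG\<^esub>i\<in>T. monom (l i) \<one> \<otimes>\<^bsub>KG\<^esub> u i)"
    using r(1) unfolding rep_def by blast+
  have ac: "a \<in> carrier KG" using a I.Icarr by blast
  have uc: "u i \<in> carrier KG" if "i \<in> T" for i using lu(2)[OF that] by (simp add: hom_def)
  have lc: "monom (l i) \<one> \<in> carrier KG" if "i \<in> T" for i using lu(1)[OF that] by simp
  have "T \<noteq> {}" using aeq a(2) by auto
  then obtain i where i: "i \<in> T" by blast
  have ui: "u i \<noteq> \<zero>\<^bsub>KG\<^esub>"
  proof
    assume z: "u i = \<zero>\<^bsub>KG\<^esub>"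
    have "(\<Oplus>\<^bsub>KG\<^esub>i\<in>T - {i}. monom (l i) \<one> \<otimes>\<^bsub>KG\<^esub> u i) = a"
      unfolding aeq using T i z lc uc
      by (intro R.finsum_mono_neutral) (auto intro!: mult_closed)
    hence "rep (T - {i}) a l u e" unfolding rep_def using T a lu by auto
    hence "n \<le> card (T - {i})" by (rule least)
    thus False using r(2) T i by (metis card_Diff1_less leD)
  qed
  \<comment> \<open>The difference is the sum of \<open>l j (u i x u j - u j x u i)\<close>, an
    expression of the same shape with unchanged scalars. Its term for \<open>j = i\<close> vanishes,
    so a nonzero difference would contradict minimality.\<close>
  have comm: "u i \<otimes>\<^bsub>KG\<^esub> (monom \<one>\<^bsub>K\<^esub> (\<beta> x) \<otimes>\<^bsub>KG\<^esub> a) = a \<otimes>\<^bsub>KG\<^esub> (monom \<one>\<^bsub>K\<^esub> (\<beta> x) \<otimes>\<^bsub>KG\<^esub> u i)"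
    (is "?l = ?r") if x: "x \<in> carrier F" for x
  proof (rule ccontr)
    let ?X = "monom \<one>\<^bsub>K\<^esub> (\<beta> x)"
    let ?w = "\<lambda>j. u i \<otimes>\<^bsub>KG\<^esub> (?X \<otimes>\<^bsub>KG\<^esub> u j) \<ominus>\<^bsub>KG\<^esub> u j \<otimes>\<^bsub>KG\<^esub> (?X \<otimes>\<^bsub>KG\<^esub> u i)"
    assume "?l \<noteq> ?r"
    have X: "?X \<in> carrier KG" using x by simp
    have lrc: "?l \<in> carrier KG" "?r \<in> carrier KG" using X uc[OF i] ac by (auto intro!: mult_closed)
    have wc: "?w j \<in> carrier KG" if "j \<in> T" for j
      using X uc[OF i] uc[OF that] by (auto intro!: R.minus_closed mult_closed)
    have "?l = (\<Oplus>\<^bsub>KG\<^esub>j\<in>T. monom (l j) \<one> \<otimes>\<^bsub>KG\<^esub> (u i \<otimes>\<^bsub>KG\<^esub> (?X \<otimes>\<^bsub>KG\<^esub> u j)))"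
    proof -
      have "?l = (u i \<otimes>\<^bsub>KG\<^esub> ?X) \<otimes>\<^bsub>KG\<^esub> a" using X uc[OF i] ac by (simp add: R.m_assoc)
      also have "\<dots> = (\<Oplus>\<^bsub>KG\<^esub>j\<in>T. (u i \<otimes>\<^bsub>KG\<^esub> ?X) \<otimes>\<^bsub>KG\<^esub> (monom (l j) \<one> \<otimes>\<^bsub>KG\<^esub> u j))"
        unfolding aeq using T X uc lc i by (intro R.finsum_rdistr) (auto intro!: mult_closed)
      also have "\<dots> = (\<Oplus>\<^bsub>KG\<^esub>j\<in>T. monom (l j) \<one> \<otimes>\<^bsub>KG\<^esub> (u i \<otimes>\<^bsub>KG\<^esub> (?X \<otimes>\<^bsub>KG\<^esub> u j)))"
      proof (rule R.finsum_cong'[OF HOL.refl])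
        fix j assume j: "j \<in> T"
        have "(u i \<otimes>\<^bsub>KG\<^esub> ?X) \<otimes>\<^bsub>KG\<^esub> (monom (l j) \<one> \<otimes>\<^bsub>KG\<^esub> u j) =
            ((u i \<otimes>\<^bsub>KG\<^esub> ?X) \<otimes>\<^bsub>KG\<^esub> monom (l j) \<one>) \<otimes>\<^bsub>KG\<^esub> u j"
          using X uc[OF i] uc[OF j] lc[OF j] by (simp add: R.m_assoc)
        also have "\<dots> = (monom (l j) \<one> \<otimes>\<^bsub>KG\<^esub> (u i \<otimes>\<^bsub>KG\<^esub> ?X)) \<otimes>\<^bsub>KG\<^esub> u j"
          using scalar_central[OF lu(1)[OF j], of "u i \<otimes>\<^bsub>KG\<^esub> ?X"] X uc[OF i] by simp
        also have "\<dots> = monom (l j) \<one> \<otimes>\<^bsub>KG\<^esub> (u i \<otimes>\<^bsub>KG\<^esub> (?X \<otimes>\<^bsub>KG\<^esub> u j))"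
          using X uc[OF i] uc[OF j] lc[OF j] by (simp add: R.m_assoc)
        finally show "(u i \<otimes>\<^bsub>KG\<^esub> ?X) \<otimes>\<^bsub>KG\<^esub> (monom (l j) \<one> \<otimes>\<^bsub>KG\<^esub> u j) =
            monom (l j) \<one> \<otimes>\<^bsub>KG\<^esub> (u i \<otimes>\<^bsub>KG\<^esub> (?X \<otimes>\<^bsub>KG\<^esub> u j))" .
      qed (use X uc lc i in \<open>auto intro!: mult_closed\<close>)
      finally show ?thesis .
    qed
    moreover have "?r = (\<Oplus>\<^bsub>KG\<^esub>j\<in>T. monom (l j) \<one> \<otimes>\<^bsub>KG\<^esub> (u j \<otimes>\<^bsub>KG\<^esub> (?X \<otimes>\<^bsub>KG\<^esub> u i)))"
    proof -
      have "?r = (\<Oplus>\<^bsub>KG\<^esub>j\<in>T. (monom (l j) \<one> \<otimes>\<^bsub>KG\<^esub> u j) \<otimes>\<^bsub>KG\<^esub> (?X \<otimes>\<^bsub>KG\<^esub> u i))"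
        unfolding aeq using T X uc lc i by (intro R.finsum_ldistr) (auto intro!: mult_closed)
      also have "\<dots> = (\<Oplus>\<^bsub>KG\<^esub>j\<in>T. monom (l j) \<one> \<otimes>\<^bsub>KG\<^esub> (u j \<otimes>\<^bsub>KG\<^esub> (?X \<otimes>\<^bsub>KG\<^esub> u i)))"
        using X uc lc i by (intro R.finsum_cong') (auto simp: R.m_assoc intro!: mult_closed)
      finally show ?thesis .
    qed
    ultimately have "?l \<ominus>\<^bsub>KG\<^esub> ?r = (\<Oplus>\<^bsub>KG\<^esub>j\<in>T. monom (l j) \<one> \<otimes>\<^bsub>KG\<^esub> ?w j)"
      (is "_ = ?sum")
    proof -
      assume lr: "?l = (\<Oplus>\<^bsub>KG\<^esub>j\<in>T. monom (l j) \<one> \<otimes>\<^bsub>KG\<^esub> (u i \<otimes>\<^bsub>KG\<^esub> (?X \<otimes>\<^bsub>KG\<^esub> u j)))"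
        "?r = (\<Oplus>\<^bsub>KG\<^esub>j\<in>T. monom (l j) \<one> \<otimes>\<^bsub>KG\<^esub> (u j \<otimes>\<^bsub>KG\<^esub> (?X \<otimes>\<^bsub>KG\<^esub> u i)))"
      have "?sum \<oplus>\<^bsub>KG\<^esub> ?r = (\<Oplus>\<^bsub>KG\<^esub>j\<in>T. monom (l j) \<one> \<otimes>\<^bsub>KG\<^esub> ?w j \<oplus>\<^bsub>KG\<^esub>
          monom (l j) \<one> \<otimes>\<^bsub>KG\<^esub> (u j \<otimes>\<^bsub>KG\<^esub> (?X \<otimes>\<^bsub>KG\<^esub> u i)))"
        unfolding lr(2) using X uc lc i wc
        by (intro R.finsum_addf[symmetric]) (auto intro!: mult_closed)
      also have "\<dots> = ?l"
        unfolding lr(1)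
      proof (rule R.finsum_cong'[OF HOL.refl])
        fix j assume j: "j \<in> T"
        let ?A = "u i \<otimes>\<^bsub>KG\<^esub> (?X \<otimes>\<^bsub>KG\<^esub> u j)" and ?B = "u j \<otimes>\<^bsub>KG\<^esub> (?X \<otimes>\<^bsub>KG\<^esub> u i)"
        have AB: "?A \<in> carrier KG" "?B \<in> carrier KG" using X uc[OF i] uc[OF j] by (auto intro!: mult_closed)
        have "monom (l j) \<one> \<otimes>\<^bsub>KG\<^esub> ?w j \<oplus>\<^bsub>KG\<^esub> monom (l j) \<one> \<otimes>\<^bsub>KG\<^esub> ?B =
            monom (l j) \<one> \<otimes>\<^bsub>KG\<^esub> (?w j \<oplus>\<^bsub>KG\<^esub> ?B)"
          using AB lc[OF j] by (simp add: R.r_distr)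
        also have "?w j \<oplus>\<^bsub>KG\<^esub> ?B = ?A" using AB by (simp add: R.minus_eq R.a_assoc R.l_neg)
        finally show "monom (l j) \<one> \<otimes>\<^bsub>KG\<^esub> ?w j \<oplus>\<^bsub>KG\<^esub> monom (l j) \<one> \<otimes>\<^bsub>KG\<^esub> ?B =
            monom (l j) \<one> \<otimes>\<^bsub>KG\<^esub> ?A" .
      qed (use X uc lc i in \<open>auto intro!: mult_closed\<close>)
      finally have eq: "?sum \<oplus>\<^bsub>KG\<^esub> ?r = ?l" .
      have sc: "?sum \<in> carrier KG" using lc wc by (intro R.finsum_closed) (auto intro!: mult_closed)
      show ?thesis using R.add_minus_cancel[OF sc lrc(2)] by (simp only: eq)
    qed
    also have "\<dots> = (\<Oplus>\<^bsub>KG\<^esub>j\<in>T - {i}. monom (l j) \<one> \<otimes>\<^bsub>KG\<^esub> ?w j)"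
    proof (rule R.finsum_mono_neutral[symmetric])
      show "monom (l j) \<one> \<otimes>\<^bsub>KG\<^esub> ?w j = \<zero>\<^bsub>KG\<^esub>" if "j \<in> T - (T - {i})" for j
      proof -
        have "j = i" using that by blast
        hence "?w j = \<zero>\<^bsub>KG\<^esub>" using X uc[OF i] by (simp add: R.minus_eq R.r_neg)
        thus ?thesis using lc[of j] that by simp
      qed
    qed (use T X uc lc wc i in \<open>auto intro!: mult_closed\<close>)
    finally have eq: "?l \<ominus>\<^bsub>KG\<^esub> ?r = (\<Oplus>\<^bsub>KG\<^esub>j\<in>T - {i}. monom (l j) \<one> \<otimes>\<^bsub>KG\<^esub> ?w j)" .
    have "?w j \<in> hom (e i + e j)" if "j \<in> T" for j
      using hom_minus[OF hom_triple[OF lu(2)[OF i] lu(2)[OF that] x]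
          hom_triple[OF lu(2)[OF that] lu(2)[OF i] x, unfolded add.commute[of "e j"]]] .
    moreover have "?l \<ominus>\<^bsub>KG\<^esub> ?r \<in> I" by (rule ideal_commutator[OF I(1) a(1) uc[OF i] X])
    moreover have "?l \<ominus>\<^bsub>KG\<^esub> ?r \<noteq> \<zero>\<^bsub>KG\<^esub>" 
      using \<open>?l \<noteq> ?r\<close> R.minus_zero_imp_eq[OF lrc] by blast
    ultimately have "rep (T - {i}) (?l \<ominus>\<^bsub>KG\<^esub> ?r) l ?w (\<lambda>j. e i + e j)"
      unfolding rep_def using T lu(1) eq by auto
    hence "n \<le> card (T - {i})" by (rule least)
    thus False using r(2) T i by (metis card_Diff1_less leD)
  qed
  obtain g where g: "g \<in> supp (u i)" using ui supp_empty_iff[OF uc[OF i]] by blast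
  have S: "finite (supp (u i) \<union> supp a)" "supp (u i) \<union> supp a \<subseteq> carrier G"
    using uc[OF i] ac supp_subset by auto
  obtain x where x: "x \<in> carrier F"
    "\<And>g g' h h'. \<lbrakk>g \<in> supp (u i) \<union> supp a; g' \<in> supp (u i) \<union> supp a; h \<in> supp (u i) \<union> supp a;
      h' \<in> supp (u i) \<union> supp a; g' \<otimes> \<beta> x \<otimes> h' = g \<otimes> \<beta> x \<otimes> h\<rbrakk> \<Longrightarrow>
      \<exists>c. central G c \<and> g' = g \<otimes> c \<and> h = c \<otimes> h'"
    using separating_products[OF S] by blast
  have uniq: "g' = g" if mem: "g \<in> supp (u i) \<union> supp a" "g' \<in> supp (u i) \<union> supp a" "h \<in> supp (u i) \<union> supp a"
      "h' \<in> supp (u i) \<union> supp a" "g' \<otimes> \<beta> x \<otimes> h' = g \<otimes> \<beta> x \<otimes> h" for g g' h h'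
  proof -
    obtain c where c: "central G c" "g' = g \<otimes> c" using x(2)[OF mem] by blast
    have "g \<in> carrier G" using mem(1) S(2) by blast
    thus ?thesis using c(2) centerless[OF c(1)] by simp
  qed
  \<comment> \<open>Both sides of \<open>comm\<close> are read at \<open>g x h\<close>, where the
    separating \<open>x\<close> makes the factorisation unique.\<close>
  have proportional: "u i g \<otimes>\<^bsub>K\<^esub> a h = a g \<otimes>\<^bsub>K\<^esub> u i h" if h: "h \<in> supp (u i) \<union> supp a" for h
  proof -
    have gh: "g \<in> carrier G" "h \<in> carrier G" "\<beta> x \<in> carrier G" using g h S(2) x(1) by auto
    have "u i g \<otimes>\<^bsub>K\<^esub> a h = (u i \<otimes>\<^bsub>KG\<^esub> (monom \<one>\<^bsub>K\<^esub> (\<beta> x) \<otimes>\<^bsub>KG\<^esub> a)) (g \<otimes> \<beta> x \<otimes> h)"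
      using g h uniq by (intro coeff_triple_unique[symmetric] uc[OF i] ac gh) blast
    also have "\<dots> = (a \<otimes>\<^bsub>KG\<^esub> (monom \<one>\<^bsub>K\<^esub> (\<beta> x) \<otimes>\<^bsub>KG\<^esub> u i)) (g \<otimes> \<beta> x \<otimes> h)"
      by (simp only: comm[OF x(1)])
    also have "\<dots> = a g \<otimes>\<^bsub>K\<^esub> u i h"
      using g h uniq by (intro coeff_triple_unique uc[OF i] ac gh) blast
    finally show ?thesis .
  qed
  have ug: "u i g \<in> carrier K" "u i g \<noteq> \<zero>\<^bsub>K\<^esub>" using g uc[OF i] by (auto simp: supp_def)
  have ag: "a g \<in> carrier K" "a g \<noteq> \<zero>\<^bsub>K\<^esub>"
  proof -
    obtain h where h: "h \<in> supp a" using a(2) supp_empty_iff[OF ac] by blast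
    have "u i g \<otimes>\<^bsub>K\<^esub> a h \<noteq> \<zero>\<^bsub>K\<^esub>"
      using h ug ac by (simp add: supp_def K.integral_iff)
    thus "a g \<noteq> \<zero>\<^bsub>K\<^esub>" using proportional[of h] h uc[OF i] by auto
  qed (use ac in simp)
  have inv_ag: "inv\<^bsub>K\<^esub> (a g) \<in> carrier K" "inv\<^bsub>K\<^esub> (a g) \<otimes>\<^bsub>K\<^esub> a g = \<one>\<^bsub>K\<^esub>"
    using ag K.field_Units by (auto intro: K.Units_l_inv)
  define c where "c = inv\<^bsub>K\<^esub> (a g) \<otimes>\<^bsub>K\<^esub> u i g"
  have c: "c \<in> carrier K" using inv_ag ug by (simp add: c_def)
  have "u i = monom c \<one> \<otimes>\<^bsub>KG\<^esub> a"
  proof (rule KG_eqI)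
    fix h
    have "u i h = c \<otimes>\<^bsub>K\<^esub> a h"
    proof (cases "h \<in> supp (u i) \<union> supp a")
      case True
      have "c \<otimes>\<^bsub>K\<^esub> a h = inv\<^bsub>K\<^esub> (a g) \<otimes>\<^bsub>K\<^esub> (a g \<otimes>\<^bsub>K\<^esub> u i h)"
        using proportional[OF True] inv_ag ug ac by (simp add: c_def K.m_assoc)
      also have "\<dots> = u i h" using inv_ag ag uc[OF i] by (simp add: K.m_assoc[symmetric])
      finally show ?thesis by simp
    next
      case False
      thus ?thesis using c by (auto simp: not_in_supp)
    qed
    thus "u i h = (monom c \<one> \<otimes>\<^bsub>KG\<^esub> a) h" using coeff_scalar[OF c ac] by simp
  qed (use uc[OF i] c ac in \<open>auto intro!: mult_closed\<close>)
  moreover have "monom c \<one> \<otimes>\<^bsub>KG\<^esub> a \<in> I" using a(1) c by (intro I.I_l_closed) auto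
  ultimately have "u i \<in> I" by simp
  thus ?thesis using lu(2)[OF i] ui by (auto simp: hom_def)
qed

lemma coeff_shift:
  assumes a: "a \<in> carrier KG" and gh: "g \<in> carrier G" "h \<in> carrier G" and x: "x \<in> carrier G"
  shows "(monom \<one>\<^bsub>K\<^esub> g \<otimes>\<^bsub>KG\<^esub> a \<otimes>\<^bsub>KG\<^esub> monom \<one>\<^bsub>K\<^esub> h) x = a (inv g \<otimes> x \<otimes> inv h)"
  using assms by (simp add: coeff_mult_monom coeff_monom_mult mult_closed G.m_assoc)

lemma shift_in_ideal:
  assumes I: "ideal I KG" and a: "a \<in> I" "a \<noteq> \<zero>\<^bsub>KG\<^esub>" and gh: "g \<in> carrier G" "h \<in> carrier G"
  defines "b \<equiv> monom \<one>\<^bsub>K\<^esub> g \<otimes>\<^bsub>KG\<^esub> a \<otimes>\<^bsub>KG\<^esub> monom \<one>\<^bsub>K\<^esub> h"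
  shows "b \<in> I" "b \<noteq> \<zero>\<^bsub>KG\<^esub>" "supp b = (\<lambda>x. g \<otimes> x \<otimes> h) ` supp a" "range b \<subseteq> insert \<zero>\<^bsub>K\<^esub> (range a)"
proof -
  interpret I: ideal I KG by (rule I)
  have ac: "a \<in> carrier KG" using a(1) I.Icarr by blast
  show bI: "b \<in> I" unfolding b_def using a gh
    by (intro I.I_r_closed[OF I.I_l_closed[OF a(1)]] monom_closed K.one_closed)
  hence bc: "b \<in> carrier KG" using I.Icarr by blast
  have co: "b x = a (inv g \<otimes> x \<otimes> inv h)" if "x \<in> carrier G" for x
    unfolding b_def by (rule coeff_shift[OF ac gh that])
  show supp: "supp b = (\<lambda>x. g \<otimes> x \<otimes> h) ` supp a"
  proof (intro equalityI subsetI)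
    fix x assume x: "x \<in> supp b"
    hence xc: "x \<in> carrier G" using supp_carrier[OF bc] by blast
    hence "inv g \<otimes> x \<otimes> inv h \<in> supp a" using x co by (simp add: supp_def)
    moreover have "x = g \<otimes> (inv g \<otimes> x \<otimes> inv h) \<otimes> h" using xc gh by (simp add: G.m_assoc)
    ultimately show "x \<in> (\<lambda>x. g \<otimes> x \<otimes> h) ` supp a" by blast
  next
    fix x assume "x \<in> (\<lambda>x. g \<otimes> x \<otimes> h) ` supp a"
    then obtain y where y: "y \<in> supp a" "x = g \<otimes> y \<otimes> h" by blast
    have yc: "y \<in> carrier G" using supp_carrier[OF ac y(1)] .
    have "b x = a y" using co[of x] y yc gh by (simp add: G.m_assoc)
    thus "x \<in> supp b" using y by (simp add: supp_def)
  qed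
  show "b \<noteq> \<zero>\<^bsub>KG\<^esub>"
    using supp a(2) supp_empty_iff[OF ac] supp_empty_iff[OF bc] by auto
  show "range b \<subseteq> insert \<zero>\<^bsub>K\<^esub> (range a)"
    using co coeff_outside[OF bc] by (metis image_subsetI insertCI rangeI)
qed

text \<open>A power of \<open>t\<close> on the right shifts a homogeneous element to degree zero,
  and one conjugation by a large \<open>t^k\<close> carries its finite support into
  \<open>F\<close>. Coefficients are only moved, so they stay in \<open>D\<close>.\<close>

lemma ideal_meets_base:
  assumes centerless: "\<And>z. central G z \<Longrightarrow> z = \<one>"
    and D: "D \<subseteq> carrier K" "\<zero>\<^bsub>K\<^esub> \<in> D" "\<one>\<^bsub>K\<^esub> \<in> D"
      "\<And>c d. c \<in> D \<Longrightarrow> d \<in> D \<Longrightarrow> c \<otimes>\<^bsub>K\<^esub> d \<in> D"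
      "\<And>c d. c \<in> D \<Longrightarrow> d \<in> D \<Longrightarrow> c \<oplus>\<^bsub>K\<^esub> d \<in> D" "\<And>c. c \<in> D \<Longrightarrow> \<ominus>\<^bsub>K\<^esub> c \<in> D"
    and I: "ideal I KG" "I \<noteq> {\<zero>\<^bsub>KG\<^esub>}"
  shows "\<exists>a\<in>I. a \<noteq> \<zero>\<^bsub>KG\<^esub> \<and> (\<forall>x. a x \<in> D) \<and> supp a \<subseteq> \<beta> ` carrier F"
proof -
  interpret I: ideal I KG by (rule I)
  obtain u d where u: "u \<in> I" "u \<noteq> \<zero>\<^bsub>KG\<^esub>" "\<And>x. u x \<in> D" "\<And>g. g \<in> supp u \<Longrightarrow> \<delta> g = d"
    using ideal_contains_homogeneous[OF assms] by blast
  have uc: "u \<in> carrier KG" using u(1) I.Icarr by blast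
  have "\<exists>n. \<forall>k::nat. k \<ge> n \<longrightarrow> (\<exists>f\<in>carrier F. inv (t [^] k) \<otimes> (g \<otimes> t [^] (- d)) \<otimes> t [^] k = \<beta> f)"
    if g: "g \<in> supp u" for g
    using g u(4)[OF g] supp_carrier[OF uc g] by (intro degree_zero_conj) auto
  then obtain N where N: "\<And>g k. g \<in> supp u \<Longrightarrow> k \<ge> N g \<Longrightarrow>
      \<exists>f\<in>carrier F. inv (t [^] (k::nat)) \<otimes> (g \<otimes> t [^] (- d)) \<otimes> t [^] k = \<beta> f"
    by metis
  define k where "k = (\<Sum>g\<in>supp u. N g)"
  have k: "N g \<le> k" if "g \<in> supp u" for g
    unfolding k_def using that uc by (intro member_le_sum) auto
  let ?g = "inv (t [^] k)" and ?h = "t [^] (- d) \<otimes> t [^] k"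
  let ?b = "monom \<one>\<^bsub>K\<^esub> ?g \<otimes>\<^bsub>KG\<^esub> u \<otimes>\<^bsub>KG\<^esub> monom \<one>\<^bsub>K\<^esub> ?h"
  have gh: "?g \<in> carrier G" "?h \<in> carrier G" by auto
  note b = shift_in_ideal[OF I(1) u(1,2) gh]
  have "?g \<otimes> x \<otimes> ?h \<in> \<beta> ` carrier F" if x: "x \<in> supp u" for x
    using N[OF x k[OF x]] supp_carrier[OF uc x] by (auto simp: G.m_assoc)
  hence "supp ?b \<subseteq> \<beta> ` carrier F" unfolding b(3) by blast
  moreover have "?b x \<in> D" for x
  proof -
    have "?b x \<in> insert \<zero>\<^bsub>K\<^esub> (range u)" using b(4) by blast
    thus ?thesis using u(3) D(2) by auto
  qed
  ultimately show ?thesis using b(1,2) by blast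
qed

text \<open>If the centre is generated by \<open>z\<close>, the degree modulo \<open>\<delta> z\<close> takes the role of the degree.\<close>

lemma ideal_meets_central_extension:
  assumes z: "central G z" "\<delta> z > 0" "\<And>w. central G w \<Longrightarrow> \<delta> z dvd \<delta> w"
    and I: "ideal I KG" "I \<noteq> {\<zero>\<^bsub>KG\<^esub>}"
  shows "\<exists>a\<in>I. a \<noteq> \<zero>\<^bsub>KG\<^esub> \<and> (\<forall>g\<in>supp a. \<delta> z dvd \<delta> g)"
proof -
  interpret I: ideal I KG by (rule I)
  define cls where "cls a = (\<lambda>g. \<delta> g mod \<delta> z) ` supp a" for a :: "'g \<Rightarrow> 'k"
  define n where "n = (LEAST n. \<exists>a\<in>I. a \<noteq> \<zero>\<^bsub>KG\<^esub> \<and> card (cls a) = n)"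
  have "\<exists>a\<in>I. a \<noteq> \<zero>\<^bsub>KG\<^esub>" using I.zero_closed I(2) by blast
  hence "\<exists>n. \<exists>a\<in>I. a \<noteq> \<zero>\<^bsub>KG\<^esub> \<and> card (cls a) = n" by blast
  hence "\<exists>a\<in>I. a \<noteq> \<zero>\<^bsub>KG\<^esub> \<and> card (cls a) = n"
    unfolding n_def by (rule LeastI_ex)
  then obtain a where a: "a \<in> I" "a \<noteq> \<zero>\<^bsub>KG\<^esub>" "card (cls a) = n" by blast
  have least: "n \<le> card (cls b)" if "b \<in> I" "b \<noteq> \<zero>\<^bsub>KG\<^esub>" for b
    unfolding n_def by (rule Least_le) (use that in blast)
  have ac: "a \<in> carrier KG" using a I.Icarr by blast
  obtain g1 where g1: "g1 \<in> supp a" using a(2) supp_empty_iff[OF ac] by blast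
  define d where "d = \<delta> g1"
  have hom: "\<delta> g mod \<delta> z = d mod \<delta> z" if g: "g \<in> supp a" for g
  proof (rule ccontr)
    assume ne: "\<delta> g mod \<delta> z \<noteq> d mod \<delta> z"
    define u where "u x = (if x \<in> carrier G \<and> \<delta> x mod \<delta> z = d mod \<delta> z then a x else \<zero>\<^bsub>K\<^esub>)" for x
    have su: "supp u = {x \<in> supp a. \<delta> x mod \<delta> z = d mod \<delta> z}"
      using supp_carrier[OF ac] by (auto simp: supp_def u_def)
    have uc: "u \<in> carrier KG"
      using ac supp_carrier[OF ac] by (intro KG_I) (auto simp: su, auto simp: u_def)
    define w where "w = a \<ominus>\<^bsub>KG\<^esub> u"
    have wc: "w \<in> carrier KG" using ac uc by (simp add: w_def)
    have sw: "supp w = {x \<in> supp a. \<delta> x mod \<delta> z \<noteq> d mod \<delta> z}"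
    proof -
      have "w x = (if x \<in> carrier G \<and> \<delta> x mod \<delta> z = d mod \<delta> z then \<zero>\<^bsub>K\<^esub> else a x)" for x
        using ac uc by (auto simp: w_def R.minus_eq u_def K.r_neg)
      thus ?thesis using supp_carrier[OF ac] by (auto simp: supp_def)
    qed
    have aw: "a = u \<oplus>\<^bsub>KG\<^esub> w"
      using ac uc by (simp add: w_def R.minus_eq R.a_lcomm R.r_neg)
    \<comment> \<open>With \<open>a = u + w\<close> the difference is \<open>u x w - w x u\<close>.
      Its classes are among those of \<open>w\<close> translated by \<open>d\<close>, fewer than
      those of \<open>a\<close>, so minimality makes it zero.\<close>
    have comm: "u \<otimes>\<^bsub>KG\<^esub> (monom \<one>\<^bsub>K\<^esub> (\<beta> x) \<otimes>\<^bsub>KG\<^esub> a) = a \<otimes>\<^bsub>KG\<^esub> (monom \<one>\<^bsub>K\<^esub> (\<beta> x) \<otimes>\<^bsub>KG\<^esub> u)"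
      (is "?l = ?r") if x: "x \<in> carrier F" for x
    proof (rule ccontr)
      assume lr: "?l \<noteq> ?r"
      let ?X = "monom \<one>\<^bsub>K\<^esub> (\<beta> x)"
      have X: "?X \<in> carrier KG" and bx: "\<beta> x \<in> carrier G" using x by auto
      let ?uu = "u \<otimes>\<^bsub>KG\<^esub> (?X \<otimes>\<^bsub>KG\<^esub> u)" and ?uw = "u \<otimes>\<^bsub>KG\<^esub> (?X \<otimes>\<^bsub>KG\<^esub> w)"
        and ?wu = "w \<otimes>\<^bsub>KG\<^esub> (?X \<otimes>\<^bsub>KG\<^esub> u)"
      have c: "?uu \<in> carrier KG" "?uw \<in> carrier KG" "?wu \<in> carrier KG" "?l \<in> carrier KG" "?r \<in> carrier KG"
        using X uc wc ac by (auto intro!: mult_closed)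
      have "?l = ?uu \<oplus>\<^bsub>KG\<^esub> ?uw"
        using X uc wc by (subst aw) (simp add: R.r_distr)
      moreover have "?r = ?uu \<oplus>\<^bsub>KG\<^esub> ?wu"
        using X uc wc by (subst aw) (simp add: R.l_distr mult_closed)
      ultimately have eq: "?l \<ominus>\<^bsub>KG\<^esub> ?r = ?uw \<ominus>\<^bsub>KG\<^esub> ?wu"
        using c R.add_add_minus_cancel[of ?uu ?uw ?wu] by simp
      have mem: "?l \<ominus>\<^bsub>KG\<^esub> ?r \<in> I" by (rule ideal_commutator[OF I(1) a(1) uc X])
      have "?l \<ominus>\<^bsub>KG\<^esub> ?r \<noteq> \<zero>\<^bsub>KG\<^esub>" using lr R.minus_zero_imp_eq[OF c(4,5)] by blast
      hence "n \<le> card (cls (?l \<ominus>\<^bsub>KG\<^esub> ?r))" using mem by (intro least)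
      also have "\<dots> \<le> card ((\<lambda>r. (d + r) mod \<delta> z) ` (cls a - {d mod \<delta> z}))"
      proof (rule card_mono)
        show "cls (?l \<ominus>\<^bsub>KG\<^esub> ?r) \<subseteq> (\<lambda>r. (d + r) mod \<delta> z) ` (cls a - {d mod \<delta> z})"
        proof
          fix r assume "r \<in> cls (?l \<ominus>\<^bsub>KG\<^esub> ?r)"
          then obtain v where v: "v \<in> supp (?uw \<ominus>\<^bsub>KG\<^esub> ?wu)" "r = \<delta> v mod \<delta> z"
            unfolding eq by (auto simp: cls_def)
          have key: "r \<in> (\<lambda>r. (d + r) mod \<delta> z) ` (cls a - {d mod \<delta> z})"
            if "g \<in> supp u" "h \<in> supp w" "\<delta> v = \<delta> g + \<delta> h" for g h
          proof (rule image_eqI)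
            show "\<delta> h mod \<delta> z \<in> cls a - {d mod \<delta> z}" using that(2) by (auto simp: cls_def sw)
            have "\<delta> g mod \<delta> z = d mod \<delta> z" using that(1) by (simp add: su)
            thus "r = (d + \<delta> h mod \<delta> z) mod \<delta> z"
              unfolding v(2) that(3) by (metis mod_add_cong mod_mod_trivial)
          qed
          have "v \<in> supp ?uw \<or> v \<in> supp ?wu" using v(1) supp_minus[OF c(2,3)] by blast
          thus "r \<in> (\<lambda>r. (d + r) mod \<delta> z) ` (cls a - {d mod \<delta> z})"
          proof
            assume "v \<in> supp ?uw"
            then obtain g h where gh: "g \<in> supp u" "h \<in> supp w" "v = g \<otimes> \<beta> x \<otimes> h"
              by (rule supp_triple[OF uc wc bx])
            thus ?thesis using supp_carrier[OF uc gh(1)] supp_carrier[OF wc gh(2)] x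
              by (intro key[of g h]) auto
          next
            assume "v \<in> supp ?wu"
            then obtain g h where gh: "g \<in> supp w" "h \<in> supp u" "v = g \<otimes> \<beta> x \<otimes> h"
              by (rule supp_triple[OF wc uc bx])
            thus ?thesis using supp_carrier[OF wc gh(1)] supp_carrier[OF uc gh(2)] x
              by (intro key[of h g]) auto
          qed
        qed
      qed (use ac in \<open>simp add: cls_def\<close>)
      also have "\<dots> \<le> card (cls a - {d mod \<delta> z})" using ac by (intro card_image_le) (simp add: cls_def)
      also have "\<dots> < card (cls a)"
        using ac g1 by (intro card_Diff1_less) (auto simp: cls_def d_def)
      finally show False using a(3) by simp
    qed
    have fin: "finite (supp u)" "finite (supp w)" using uc wc by auto
    have "supp u \<noteq> {}" using g1 by (auto simp: su d_def)
    \<comment> \<open>Factorisations of \<open>g0 x h0\<close> are ambiguous up to a central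
      \<open>c\<close>. Taking \<open>g0\<close> and \<open>h0\<close> of maximal degree in their
      supports removes this: a nontrivial \<open>c\<close> would raise one of the two
      degrees.\<close>
    have "Max (\<delta> ` supp u) \<in> \<delta> ` supp u" using fin \<open>supp u \<noteq> {}\<close> by simp
    then obtain g0 where g0: "g0 \<in> supp u" "\<delta> g0 = Max (\<delta> ` supp u)" by auto
    have g0max: "\<delta> g' \<le> \<delta> g0" if "g' \<in> supp u" for g' using that fin g0 by simp
    have "supp w \<noteq> {}" using g ne by (auto simp: sw)
    hence "Max (\<delta> ` supp w) \<in> \<delta> ` supp w" using fin by simp
    then obtain h0 where h0: "h0 \<in> supp w" "\<delta> h0 = Max (\<delta> ` supp w)" by auto
    have h0max: "\<delta> h' \<le> \<delta> h0" if "h' \<in> supp w" for h' using that fin h0 by simp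
    have S: "finite (supp a)" "supp a \<subseteq> carrier G" using ac supp_subset by auto
    obtain x where x: "x \<in> carrier F"
      "\<And>g g' h h'. \<lbrakk>g \<in> supp a; g' \<in> supp a; h \<in> supp a; h' \<in> supp a; g' \<otimes> \<beta> x \<otimes> h' = g \<otimes> \<beta> x \<otimes> h\<rbrakk> \<Longrightarrow>
        \<exists>c. central G c \<and> g' = g \<otimes> c \<and> h = c \<otimes> h'"
      using separating_products[OF S] by blast
    have mem: "g0 \<in> supp a" "h0 \<in> supp a" using g0(1) h0(1) by (auto simp: su sw)
    have gh: "\<beta> x \<in> carrier G" "g0 \<in> carrier G" "h0 \<in> carrier G" using x(1) mem S by auto
    let ?v = "g0 \<otimes> \<beta> x \<otimes> h0"
    have fact: "\<exists>c. central G c \<and> c \<in> carrier G \<and> h' \<in> carrier G \<and> g' = g0 \<otimes> c \<and> h0 = c \<otimes> h' \<and>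
        \<delta> h0 mod \<delta> z = \<delta> h' mod \<delta> z"
      if m: "g' \<in> supp a" "h' \<in> supp a" "g' \<otimes> \<beta> x \<otimes> h' = ?v" for g' h'
    proof -
      obtain c where c: "central G c" "g' = g0 \<otimes> c" "h0 = c \<otimes> h'"
        using x(2)[OF mem(1) m(1) mem(2) m(2,3)] by blast
      have cc: "c \<in> carrier G" "h' \<in> carrier G" using c m(2) S by (auto simp: central_def)
      have "\<delta> h0 = \<delta> c + \<delta> h'" using c(3) cc by simp
      moreover obtain q where "\<delta> c = \<delta> z * q" using z(3)[OF c(1)] by blast
      ultimately have "\<delta> h0 mod \<delta> z = \<delta> h' mod \<delta> z" by simp
      thus ?thesis using c cc by blast
    qed
    have "(u \<otimes>\<^bsub>KG\<^esub> (monom \<one>\<^bsub>K\<^esub> (\<beta> x) \<otimes>\<^bsub>KG\<^esub> a)) ?v = u g0 \<otimes>\<^bsub>K\<^esub> a h0"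
    proof (rule coeff_triple_unique[OF uc ac gh])
      fix g' h' assume m: "g' \<in> supp u" "h' \<in> supp a" "g' \<otimes> \<beta> x \<otimes> h' = ?v"
      have "g' \<in> supp a" using m(1) by (simp add: su)
      then obtain c where c: "central G c" "c \<in> carrier G" "h' \<in> carrier G" "g' = g0 \<otimes> c" "h0 = c \<otimes> h'"
          "\<delta> h0 mod \<delta> z = \<delta> h' mod \<delta> z"
        using fact[OF _ m(2,3)] by blast
      have "h' \<in> supp w" using m(2) c(6) h0(1) by (simp add: sw)
      hence "\<delta> c \<ge> 0" using h0max[of h'] c by simp
      moreover have "\<delta> c \<le> 0" using g0max[OF m(1)] c gh by simp
      ultimately have "c = \<one>" using central_degree_zero[OF c(1)] by simp
      thus "g' = g0" using c(4) gh by simp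
    qed
    \<comment> \<open>On this side a contribution needs \<open>h'\<close> in the support of
      \<open>u\<close>, but in the degree class of \<open>h0\<close>, which belongs to
      \<open>w\<close>.\<close>
    moreover have "(a \<otimes>\<^bsub>KG\<^esub> (monom \<one>\<^bsub>K\<^esub> (\<beta> x) \<otimes>\<^bsub>KG\<^esub> u)) ?v = \<zero>\<^bsub>K\<^esub>"
    proof (rule ccontr)
      assume "\<not> ?thesis"
      hence "?v \<in> supp (a \<otimes>\<^bsub>KG\<^esub> (monom \<one>\<^bsub>K\<^esub> (\<beta> x) \<otimes>\<^bsub>KG\<^esub> u))" by (simp add: supp_def)
      then obtain g' h' where m: "g' \<in> supp a" "h' \<in> supp u" "?v = g' \<otimes> \<beta> x \<otimes> h'"
        by (rule supp_triple[OF ac uc gh(1)])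
      have "h' \<in> supp a" using m(2) by (simp add: su)
      hence "\<delta> h0 mod \<delta> z = \<delta> h' mod \<delta> z" using fact[OF m(1) _ m(3)[symmetric]] by blast
      thus False using m(2) h0(1) by (simp add: su sw)
    qed
    moreover have "u g0 \<otimes>\<^bsub>K\<^esub> a h0 \<noteq> \<zero>\<^bsub>K\<^esub>"
      using g0(1) mem(2) uc ac by (simp add: supp_def K.integral_iff)
    ultimately show False using comm[OF x(1)] by simp
  qed
  have gh: "\<one> \<in> carrier G" "t [^] (- d) \<in> carrier G" by auto
  note b = shift_in_ideal[OF I(1) a(1,2) gh]
  have "\<delta> z dvd \<delta> g" if g: "g \<in> supp (monom \<one>\<^bsub>K\<^esub> \<one> \<otimes>\<^bsub>KG\<^esub> a \<otimes>\<^bsub>KG\<^esub> monom \<one>\<^bsub>K\<^esub> (t [^] (- d)))" for g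
  proof -
    obtain x where x: "x \<in> supp a" "g = \<one> \<otimes> x \<otimes> t [^] (- d)" using g unfolding b(3) by blast
    hence "\<delta> g = \<delta> x - d" using supp_carrier[OF ac x(1)] by simp
    thus ?thesis using hom[OF x(1)] by (simp add: mod_eq_dvd_iff)
  qed
  thus ?thesis using b(1,2) by blast
qed

end

section \<open>The sufficient condition\<close>

text \<open>Every word in the letter \<open>p\<close> and its inverse commutes with
  \<open>p\<close>, so transitivity of commutation through \<open>p\<close> applies.\<close>

lemma words_one_letter_commute:
  assumes w: "u \<in> words {p}" "v \<in> words {p}"
  shows "nf (u @ v) = nf (v @ u)"
proof -
  let ?l = "(p, True)"
  have comm: "nf (w @ [?l]) = nf ([?l] @ w)" if "w \<in> words {p}" for w
    using that
  proof (induction w)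
    case (Cons m w)
    have w: "w \<in> words {p}" using Cons.prems by simp
    have m: "nf ([m] @ [?l]) = nf ([?l] @ [m])"
      using Cons.prems by (cases m; cases "snd m") (auto simp: nf_def inv_letter_def)
    have "nf ([m] @ (w @ [?l])) = nf (([m] @ [?l]) @ w)"
      using nf_append_cong[OF HOL.refl Cons.IH[OF w], of "[m]"] by simp
    also have "\<dots> = nf (([?l] @ [m]) @ w)" by (rule nf_append_cong[OF m HOL.refl])
    finally show ?case by simp
  qed simp
  show ?thesis
    by (rule commute_trans_nf[OF _ _ comm[OF w(1)] comm[OF w(2)]]) simp_all
qed

context hnn_algebra
begin

lemma infinite_F: "infinite (carrier F)"
proof -
  obtain p q where pq: "p \<in> carrier F" "q \<in> carrier F" "p \<otimes>\<^bsub>F\<^esub> q \<noteq> q \<otimes>\<^bsub>F\<^esub> p" by (rule noncommuting)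
  hence p1: "p \<noteq> \<one>\<^bsub>F\<^esub>" by auto
  have "inj (\<lambda>n::nat. p [^]\<^bsub>F\<^esub> n)"
  proof (rule linorder_injI)
    fix m n :: nat assume "m < n"
    show "p [^]\<^bsub>F\<^esub> m \<noteq> p [^]\<^bsub>F\<^esub> n"
    proof
      assume eq: "p [^]\<^bsub>F\<^esub> m = p [^]\<^bsub>F\<^esub> n"
      have "p [^]\<^bsub>F\<^esub> (n - m) \<otimes>\<^bsub>F\<^esub> p [^]\<^bsub>F\<^esub> m = p [^]\<^bsub>F\<^esub> n"
        using pq(1) \<open>m < n\<close> by (simp add: F.nat_pow_mult)
      hence "p [^]\<^bsub>F\<^esub> (n - m) \<otimes>\<^bsub>F\<^esub> p [^]\<^bsub>F\<^esub> m = p [^]\<^bsub>F\<^esub> m" by (simp only: eq)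
      hence "p [^]\<^bsub>F\<^esub> (n - m) = \<one>\<^bsub>F\<^esub>" using pq(1) F.r_cancel_one' by (metis F.nat_pow_closed)
      thus False using free_group_pow_neq_one[OF free pq(1) p1, of "n - m"] \<open>m < n\<close> by simp
    qed
  qed
  moreover have "range (\<lambda>n::nat. p [^]\<^bsub>F\<^esub> n) \<subseteq> carrier F" using pq by auto
  ultimately show ?thesis using finite_subset range_inj_infinite by blast
qed

lemma G_lepoll_F: "carrier G \<lesssim> carrier F"
proof -
  have "carrier G \<subseteq> (\<lambda>((m::nat, n::nat), f). t [^] m \<otimes> \<beta> f \<otimes> inv (t [^] n)) ` ((UNIV \<times> UNIV) \<times> carrier F)"
  proof
    fix g assume "g \<in> carrier G"
    then obtain m n :: nat and f where f: "f \<in> carrier F" "g = t [^] m \<otimes> \<beta> f \<otimes> inv (t [^] n)"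
      using normal_form by blast
    thus "g \<in> (\<lambda>((m::nat, n::nat), f). t [^] m \<otimes> \<beta> f \<otimes> inv (t [^] n)) ` ((UNIV \<times> UNIV) \<times> carrier F)"
      by (intro image_eqI[of _ _ "((m, n), f)"]) auto
  qed
  hence "carrier G \<lesssim> ((UNIV :: nat set) \<times> (UNIV :: nat set)) \<times> carrier F" by (rule subset_image_lepoll)
  also have "\<dots> \<lesssim> carrier F"
    using infinite_F by (intro times_lepoll) (auto simp: infinite_le_lepoll)
  finally show ?thesis .
qed

lemma two_generators:
  obtains X :: "'a set" and \<omega> p q
  where "\<omega> \<in> iso F (free_words X)" "p \<in> X" "q \<in> X" "p \<noteq> q"
proof -
  obtain X :: "'a set" and \<omega> where \<omega>: "\<omega> \<in> iso F (free_words X)"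
    by (rule free_group_iso_words[OF free])
  have inj: "inj_on \<omega> (carrier F)" and hom: "\<omega> \<in> hom F (free_words X)"
    using \<omega> by (auto simp: iso_def bij_betw_def)
  have "\<exists>p\<in>X. \<exists>q\<in>X. p \<noteq> q"
  proof (rule ccontr)
    assume "\<not> ?thesis"
    then obtain p where X: "X \<subseteq> {p}" by blast
    obtain a b where ab: "a \<in> carrier F" "b \<in> carrier F" "a \<otimes>\<^bsub>F\<^esub> b \<noteq> b \<otimes>\<^bsub>F\<^esub> a" by (rule noncommuting)
    have "words X \<subseteq> words {p}" using X by (auto simp: words_def)
    hence "\<omega> a \<in> words {p}" "\<omega> b \<in> words {p}" using hom_in_carrier[OF hom] ab by auto
    hence "nf (\<omega> a @ \<omega> b) = nf (\<omega> b @ \<omega> a)" by (rule words_one_letter_commute)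
    hence "\<omega> (a \<otimes>\<^bsub>F\<^esub> b) = \<omega> (b \<otimes>\<^bsub>F\<^esub> a)" using hom_mult[OF hom] ab by simp
    thus False using inj_onD[OF inj] ab F.m_closed by metis
  qed
  thus thesis using that \<omega> by blast
qed

text \<open>The common frame of the two cases. \<open>E\<close> is injected into \<open>F\<close>,
  and the reduced word of the image is what gets encoded; the monomials on \<open>F\<close> make
  \<open>E\<close> infinite.\<close>

lemma primitive_if_meets:
  fixes bs :: "'g \<Rightarrow> 'a" and ex :: "'g \<Rightarrow> int"
  assumes H: "subgroup H G"
    and bs: "\<And>g. g \<in> H \<Longrightarrow> bs g \<in> carrier F"
      "\<And>g h. g \<in> H \<Longrightarrow> h \<in> H \<Longrightarrow> bs (g \<otimes> h) = bs g \<otimes>\<^bsub>F\<^esub> bs h"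
    and ex: "\<And>g h. g \<in> H \<Longrightarrow> h \<in> H \<Longrightarrow> ex (g \<otimes> h) = ex g + ex h"
    and inj: "\<And>g h. g \<in> H \<Longrightarrow> h \<in> H \<Longrightarrow> bs g = bs h \<Longrightarrow> ex g = ex h \<Longrightarrow> g = h"
    and base: "\<And>f. f \<in> carrier F \<Longrightarrow> \<beta> f \<in> H \<and> bs (\<beta> f) = f \<and> ex (\<beta> f) = 0"
    and E: "\<And>a. a \<in> E \<Longrightarrow> a \<in> carrier KG \<and> a \<noteq> \<zero>\<^bsub>KG\<^esub> \<and> supp a \<subseteq> H"
      "\<And>f. f \<in> carrier F \<Longrightarrow> monom \<one>\<^bsub>K\<^esub> (\<beta> f) \<in> E" "E \<lesssim> carrier F"
    and meets: "\<And>I. ideal I KG \<Longrightarrow> I \<noteq> {\<zero>\<^bsub>KG\<^esub>} \<Longrightarrow> I \<inter> E \<noteq> {}"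
  shows "primitive_ring KG"
proof -
  obtain X :: "'a set" and \<omega> p q where \<omega>: "\<omega> \<in> iso F (free_words X)"
    and pq: "p \<in> X" "q \<in> X" "p \<noteq> q" by (rule two_generators)
  have winj: "inj_on \<omega> (carrier F)" and wimg: "\<omega> ` carrier F = carrier (free_words X)"
    and whom: "\<omega> \<in> hom F (free_words X)"
    using \<omega> by (auto simp: iso_def bij_betw_def)
  have wmem: "\<omega> f \<in> carrier (free_words X)" if "f \<in> carrier F" for f using wimg that by blast
  obtain e where e: "inj_on e E" "e ` E \<subseteq> carrier F" using E(3) by (auto simp: lepoll_def)
  define code where "code a = prefix_code p q (\<omega> (e a))" for a
  have "coded_subgroup K G X H (\<lambda>g. \<omega> (bs g)) ex (\<lambda>w. \<beta> (inv_into (carrier F) \<omega> w)) p q E code"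
  proof (intro coded_subgroup.intro group_algebra_axioms coded_subgroup_axioms.intro H pq ex E(1))
    show "\<omega> (bs h) \<in> carrier (free_words X)" if "h \<in> H" for h using bs(1)[OF that] by (rule wmem)
    show "\<omega> (bs (g \<otimes> h)) = nf (\<omega> (bs g) @ \<omega> (bs h))" if "g \<in> H" "h \<in> H" for g h
      using bs that hom_mult[OF whom] by simp
    show "g = h" if "g \<in> H" "h \<in> H" "\<omega> (bs g) = \<omega> (bs h)" "ex g = ex h" for g h
      using that inj bs(1) inj_onD[OF winj] by metis
    show "\<beta> (inv_into (carrier F) \<omega> w) \<in> H \<and> \<omega> (bs (\<beta> (inv_into (carrier F) \<omega> w))) = w \<and>
        ex (\<beta> (inv_into (carrier F) \<omega> w)) = 0" if "w \<in> carrier (free_words X)" for w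
    proof -
      have "w \<in> \<omega> ` carrier F" using that wimg by blast
      hence "inv_into (carrier F) \<omega> w \<in> carrier F" "\<omega> (inv_into (carrier F) \<omega> w) = w"
        by (rule inv_into_into, rule f_inv_into_f)
      thus ?thesis using base by simp
    qed
    show "infinite E"
    proof
      assume "finite E"
      moreover have "(\<lambda>f. monom \<one>\<^bsub>K\<^esub> (\<beta> f)) ` carrier F \<subseteq> E" using E(2) by blast
      ultimately have "finite ((\<lambda>f. monom \<one>\<^bsub>K\<^esub> (\<beta> f)) ` carrier F)" by (rule finite_subset[rotated])
      moreover have "inj_on (\<lambda>f. monom \<one>\<^bsub>K\<^esub> (\<beta> f)) (carrier F)"
      proof (rule inj_onI)
        fix f f' assume f: "f \<in> carrier F" "f' \<in> carrier F" and "monom \<one>\<^bsub>K\<^esub> (\<beta> f) = monom \<one>\<^bsub>K\<^esub> (\<beta> f')"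
        hence "monom \<one>\<^bsub>K\<^esub> (\<beta> f) (\<beta> f) = monom \<one>\<^bsub>K\<^esub> (\<beta> f') (\<beta> f)" by simp
        hence "\<beta> f = \<beta> f'" by (auto simp: monom_def split: if_splits)
        thus "f = f'" using f beta_eq_iff by simp
      qed
      ultimately show False using infinite_F finite_imageD by blast
    qed
    show "code a \<in> words X \<and> positive (code a)" if "a \<in> E" for a
      using that e(2) wmem pq by (auto simp: code_def positive_prefix_code intro!: prefix_code_words)
    show "a = b" if ab: "a \<in> E" "b \<in> E" and eq: "code a @ u = code b @ w" for a b u w
    proof -
      have "\<omega> (e a) = \<omega> (e b)" using prefix_code_prefix_free[OF pq(3)] eq by (simp add: code_def)
      hence "e a = e b" using inj_onD[OF winj] e(2) ab by blast
      thus ?thesis using inj_onD[OF e(1)] ab by blast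
    qed
  qed
  then interpret coded_subgroup K G X H "\<lambda>g. \<omega> (bs g)" ex "\<lambda>w. \<beta> (inv_into (carrier F) \<omega> w)" p q E code .
  show ?thesis by (rule primitive_KG[OF meets])
qed

lemma supp_monom_one: "supp (monom \<one>\<^bsub>K\<^esub> g) = {g}"
  by (auto simp: supp_def monom_def)

lemma monom_one_neq_zero: "monom \<one>\<^bsub>K\<^esub> g \<noteq> \<zero>\<^bsub>KG\<^esub>"
proof
  assume "monom \<one>\<^bsub>K\<^esub> g = \<zero>\<^bsub>KG\<^esub>"
  hence "monom \<one>\<^bsub>K\<^esub> g g = \<zero>\<^bsub>K\<^esub>" by simp
  thus False by (simp add: monom_def)
qed

lemma primitive_if_centerless:
  assumes centerless: "\<And>z. central G z \<Longrightarrow> z = \<one>"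
  shows "primitive_ring KG"
proof -
  \<comment> \<open>The image of the integers is countable, which keeps \<open>E\<close> within the
    size of \<open>F\<close> however large \<open>K\<close> is.\<close>
  define D where "D = range (\<lambda>n::int. add_pow K n \<one>\<^bsub>K\<^esub>)"
  have D: "D \<subseteq> carrier K" "\<zero>\<^bsub>K\<^esub> \<in> D" "\<one>\<^bsub>K\<^esub> \<in> D"
      "\<And>c d. c \<in> D \<Longrightarrow> d \<in> D \<Longrightarrow> c \<otimes>\<^bsub>K\<^esub> d \<in> D"
      "\<And>c d. c \<in> D \<Longrightarrow> d \<in> D \<Longrightarrow> c \<oplus>\<^bsub>K\<^esub> d \<in> D" "\<And>c. c \<in> D \<Longrightarrow> \<ominus>\<^bsub>K\<^esub> c \<in> D"
  proof -
    show "D \<subseteq> carrier K" by (auto simp: D_def)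
    show "\<zero>\<^bsub>K\<^esub> \<in> D" unfolding D_def by (rule range_eqI[of _ _ 0]) (simp add: add_pow_def)
    show "\<one>\<^bsub>K\<^esub> \<in> D" unfolding D_def by (rule range_eqI[of _ _ 1]) simp
    show "c \<otimes>\<^bsub>K\<^esub> d \<in> D" if cd: "c \<in> D" "d \<in> D" for c d
    proof -
      obtain m n :: int where "c = add_pow K m \<one>\<^bsub>K\<^esub>" "d = add_pow K n \<one>\<^bsub>K\<^esub>"
        using cd by (auto simp: D_def)
      hence "c \<otimes>\<^bsub>K\<^esub> d = add_pow K (n * m) \<one>\<^bsub>K\<^esub>"
        by (simp add: K.add_pow_ldistr_int K.add.int_pow_pow)
      thus ?thesis by (simp add: D_def)
    qed
    show "c \<oplus>\<^bsub>K\<^esub> d \<in> D" if cd: "c \<in> D" "d \<in> D" for c d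
    proof -
      obtain m n :: int where "c = add_pow K m \<one>\<^bsub>K\<^esub>" "d = add_pow K n \<one>\<^bsub>K\<^esub>"
        using cd by (auto simp: D_def)
      hence "c \<oplus>\<^bsub>K\<^esub> d = add_pow K (m + n) \<one>\<^bsub>K\<^esub>"
        by (simp add: K.add.int_pow_mult)
      thus ?thesis by (simp add: D_def)
    qed
    show "\<ominus>\<^bsub>K\<^esub> c \<in> D" if c: "c \<in> D" for c
    proof -
      obtain m :: int where "c = add_pow K m \<one>\<^bsub>K\<^esub>" using c by (auto simp: D_def)
      hence "\<ominus>\<^bsub>K\<^esub> c = add_pow K (- m) \<one>\<^bsub>K\<^esub>" by (simp add: K.add.int_pow_neg)
      thus ?thesis by (simp add: D_def)
    qed
  qed
  have Dle: "D \<lesssim> carrier F"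
  proof -
    have "D \<subseteq> range (\<lambda>n::nat. add_pow K (int_decode n) \<one>\<^bsub>K\<^esub>)"
      unfolding D_def by (auto intro: range_eqI[of _ _ "int_encode _"])
    hence "D \<lesssim> (UNIV :: nat set)" by (rule subset_image_lepoll)
    thus ?thesis using infinite_F lepoll_trans by (auto simp: infinite_le_lepoll)
  qed
  define E where "E = {a \<in> carrier KG. a \<noteq> \<zero>\<^bsub>KG\<^esub> \<and> (\<forall>x. a x \<in> D) \<and> supp a \<subseteq> \<beta> ` carrier F}"
  show ?thesis
  proof (rule primitive_if_meets[of "\<beta> ` carrier F" "inv_into (carrier F) \<beta>" "\<lambda>_. 0" E])
    show "subgroup (\<beta> ` carrier F) G" by (rule beta.img_is_subgroup)
    show "E \<lesssim> carrier F"
    proof -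
      have "E \<subseteq> {a \<in> carrier KG. \<forall>x. a x \<in> D}" by (auto simp: E_def)
      thus ?thesis using finite_support_lepoll[OF infinite_F G_lepoll_F Dle]
        by (meson lepoll_trans subset_imp_lepoll)
    qed
    show "monom \<one>\<^bsub>K\<^esub> (\<beta> f) \<in> E" if "f \<in> carrier F" for f
      using that D(2,3) supp_monom_one monom_one_neq_zero by (auto simp: E_def) (auto simp: monom_def)
    show "I \<inter> E \<noteq> {}" if I: "ideal I KG" "I \<noteq> {\<zero>\<^bsub>KG\<^esub>}" for I
    proof -
      obtain a where a: "a \<in> I" "a \<noteq> \<zero>\<^bsub>KG\<^esub>" "\<forall>x. a x \<in> D" "supp a \<subseteq> \<beta> ` carrier F"
        using ideal_meets_base[OF centerless D I] by blast
      have "a \<in> carrier KG" using ideal.Icarr[OF I(1) a(1)] .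
      thus ?thesis using a by (auto simp: E_def)
    qed
  qed (use beta_inj in \<open>auto simp: E_def inv_into_f_f beta.hom_mult[symmetric] simp del: beta.hom_mult\<close>)
qed

text \<open>Elements of degree divisible by \<open>\<delta> z\<close> have the unique form
  \<open>f z^j\<close>, which provides \<open>bs\<close> and \<open>ex\<close>. The bound on
  \<open>K\<close> is what makes all nonzero elements supported there an admissible
  \<open>E\<close>.\<close>

lemma primitive_if_small:
  assumes K: "carrier K \<lesssim> carrier F" and z0: "central G z0" "z0 \<noteq> \<one>"
  shows "primitive_ring KG"
proof -
  obtain z where z: "central G z" "\<delta> z > 0" "\<And>w. central G w \<Longrightarrow> \<delta> z dvd \<delta> w"
    using central_generator[OF z0] by blast
  have zc: "z \<in> carrier G" using z by (simp add: central_def)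
  define H where "H = {g \<in> carrier G. \<delta> z dvd \<delta> g}"
  define ex where "ex g = \<delta> g div \<delta> z" for g
  define bs where "bs g = inv_into (carrier F) \<beta> (g \<otimes> z [^] (- ex g))" for g
  have bsb: "bs g \<in> carrier F" "g = \<beta> (bs g) \<otimes> z [^] ex g" if g: "g \<in> H" for g
  proof -
    obtain f where f: "f \<in> carrier F" "g = \<beta> f \<otimes> z [^] ex g"
      using degree_dvd_decomp[OF z(1,2), of g] g by (auto simp: H_def ex_def)
    have "g \<otimes> z [^] (- ex g) = (\<beta> f \<otimes> z [^] ex g) \<otimes> inv (z [^] ex g)"
      using zc by (simp only: f(2)[symmetric] G.int_pow_neg)
    also have "\<dots> = \<beta> f" using f(1) zc by (simp add: G.m_assoc)
    finally have "g \<otimes> z [^] (- ex g) = \<beta> f" .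
    hence "bs g = f" using f(1) beta_inj by (simp add: bs_def inv_into_f_f)
    thus "bs g \<in> carrier F" "g = \<beta> (bs g) \<otimes> z [^] ex g" using f by auto
  qed
  have bs_unique: "bs g = f" if "g \<in> H" "f \<in> carrier F" "g = \<beta> f \<otimes> z [^] ex g" for g f
  proof -
    have "\<beta> (bs g) \<otimes> z [^] ex g = \<beta> f \<otimes> z [^] ex g" using bsb(2)[OF that(1)] that(3) by simp
    thus ?thesis using bsb(1)[OF that(1)] that(2) zc beta_eq_iff by simp
  qed
  have zcomm: "z [^] (j::int) \<otimes> g = g \<otimes> z [^] j" if "g \<in> carrier G" for j g
    using G.central_int_pow[OF z(1), of j] that by (simp add: central_def)
  have sub: "subgroup H G"
    by (rule G.subgroupI) (auto simp: H_def intro: exI[of _ "\<one>"])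
  have exm: "ex (g \<otimes> h) = ex g + ex h" if "g \<in> H" "h \<in> H" for g h
    using that by (auto simp: H_def ex_def elim!: dvdE)
  define E where "E = {a \<in> carrier KG. a \<noteq> \<zero>\<^bsub>KG\<^esub> \<and> supp a \<subseteq> H}"
  show ?thesis
  proof (rule primitive_if_meets[of H bs ex E, OF sub bsb(1) _ exm])
    show "bs (g \<otimes> h) = bs g \<otimes>\<^bsub>F\<^esub> bs h" if gh: "g \<in> H" "h \<in> H" for g h
    proof (rule bs_unique)
      show "g \<otimes> h \<in> H" using subgroup.m_closed[OF sub gh] .
      show "bs g \<otimes>\<^bsub>F\<^esub> bs h \<in> carrier F" using bsb(1) gh by simp
      have c: "\<beta> (bs g) \<in> carrier G" "\<beta> (bs h) \<in> carrier G" using bsb(1) gh by auto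
      have "g \<otimes> h = (\<beta> (bs g) \<otimes> z [^] ex g) \<otimes> (\<beta> (bs h) \<otimes> z [^] ex h)"
        using bsb(2)[OF gh(1)] bsb(2)[OF gh(2)] by simp
      also have "\<dots> = \<beta> (bs g) \<otimes> (z [^] ex g \<otimes> \<beta> (bs h)) \<otimes> z [^] ex h"
        using c zc by (simp add: G.m_assoc)
      also have "\<dots> = \<beta> (bs g) \<otimes> (\<beta> (bs h) \<otimes> z [^] ex g) \<otimes> z [^] ex h"
        by (simp only: zcomm[OF c(2)])
      also have "\<dots> = \<beta> (bs g \<otimes>\<^bsub>F\<^esub> bs h) \<otimes> z [^] ex (g \<otimes> h)"
        using c zc bsb(1) gh by (simp add: G.m_assoc exm G.int_pow_mult)
      finally show "g \<otimes> h = \<beta> (bs g \<otimes>\<^bsub>F\<^esub> bs h) \<otimes> z [^] ex (g \<otimes> h)" .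
    qed
    show "g = h" if "g \<in> H" "h \<in> H" "bs g = bs h" "ex g = ex h" for g h
      using bsb(2)[OF that(1)] bsb(2)[OF that(2)] that(3,4) by simp
    show "\<beta> f \<in> H \<and> bs (\<beta> f) = f \<and> ex (\<beta> f) = 0" if f: "f \<in> carrier F" for f
    proof -
      have "\<beta> f \<in> H" "ex (\<beta> f) = 0" using f by (auto simp: H_def ex_def)
      moreover have "bs (\<beta> f) = f" using f calculation by (intro bs_unique) auto
      ultimately show ?thesis by simp
    qed
    show "E \<lesssim> carrier F"
    proof -
      have "E \<subseteq> {a \<in> carrier KG. \<forall>x. a x \<in> carrier K}" by (auto simp: E_def)
      thus ?thesis using finite_support_lepoll[OF infinite_F G_lepoll_F K]
        by (meson lepoll_trans subset_imp_lepoll)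
    qed
    show "monom \<one>\<^bsub>K\<^esub> (\<beta> f) \<in> E" if "f \<in> carrier F" for f
      using that supp_monom_one monom_one_neq_zero by (auto simp: E_def H_def)
    show "I \<inter> E \<noteq> {}" if I: "ideal I KG" "I \<noteq> {\<zero>\<^bsub>KG\<^esub>}" for I
    proof -
      obtain a where a: "a \<in> I" "a \<noteq> \<zero>\<^bsub>KG\<^esub>" "\<forall>g\<in>supp a. \<delta> z dvd \<delta> g"
        using ideal_meets_central_extension[OF z I] by blast
      have "a \<in> carrier KG" using ideal.Icarr[OF I(1) a(1)] .
      thus ?thesis using a supp_carrier by (auto simp: E_def H_def)
    qed
  qed (auto simp: E_def)
qed

end

section \<open>The necessary condition\<close>

text \<open>Gaussian elimination with more unknowns than equations: equation \<open>y\<close> is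
  solved for the unknown at a pivot \<open>d\<close>, and \<open>r'\<close> holds the coefficients
  that remain in the other equations.\<close>

lemma (in field) linear_dependence:
  assumes "finite S" "finite A" "card S < card A"
    and "\<And>c x. c \<in> A \<Longrightarrow> x \<in> S \<Longrightarrow> r c x \<in> carrier R"
  shows "\<exists>\<kappa>. (\<forall>c\<in>A. \<kappa> c \<in> carrier R) \<and> (\<exists>c\<in>A. \<kappa> c \<noteq> \<zero>) \<and> (\<forall>x\<in>S. (\<Oplus>c\<in>A. \<kappa> c \<otimes> r c x) = \<zero>)"
  using assms
proof (induction S arbitrary: A r rule: finite_induct)
  case empty
  then obtain c where "c \<in> A" by fastforce
  thus ?case by (intro exI[of _ "\<lambda>_. \<one>"]) auto
next
  case (insert y S)
  show ?case
  proof (cases "\<forall>c\<in>A. r c y = \<zero>")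
    case True
    obtain \<kappa> where \<kappa>: "\<forall>c\<in>A. \<kappa> c \<in> carrier R" "\<exists>c\<in>A. \<kappa> c \<noteq> \<zero>" "\<forall>x\<in>S. (\<Oplus>c\<in>A. \<kappa> c \<otimes> r c x) = \<zero>"
      using insert.IH[of A r] insert.prems insert.hyps by auto
    have "(\<Oplus>c\<in>A. \<kappa> c \<otimes> r c y) = \<zero>" using True \<kappa>(1) by (intro finsum_eq_zero) auto
    thus ?thesis using \<kappa> by (intro exI[of _ \<kappa>]) auto
  next
    case False
    then obtain d where d: "d \<in> A" "r d y \<noteq> \<zero>" by blast
    have dc: "r d y \<in> carrier R" using insert.prems d by auto
    define i where "i = inv (r d y)"
    have i: "i \<in> carrier R" "i \<otimes> r d y = \<one>" using dc d field_Units by (auto simp: i_def intro: Units_l_inv)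
    define r' where "r' c x = r c x \<ominus> r c y \<otimes> i \<otimes> r d x" for c x
    have rc: "r c x \<in> carrier R" if "c \<in> A" "x \<in> insert y S" for c x using insert.prems(3) that by blast
    have "card S < card (A - {d})" using insert.prems insert.hyps d by simp
    moreover have "r' c x \<in> carrier R" if "c \<in> A - {d}" "x \<in> S" for c x
      using that rc d(1) i by (simp add: r'_def)
    ultimately obtain \<kappa> where \<kappa>: "\<forall>c\<in>A - {d}. \<kappa> c \<in> carrier R" "\<exists>c\<in>A - {d}. \<kappa> c \<noteq> \<zero>"
        "\<forall>x\<in>S. (\<Oplus>c\<in>A - {d}. \<kappa> c \<otimes> r' c x) = \<zero>"
      using insert.IH[of "A - {d}" r'] insert.prems(1) by auto
    define m where "m = (\<Oplus>c\<in>A - {d}. \<kappa> c \<otimes> (r c y \<otimes> i))"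
    have mc: "m \<in> carrier R" unfolding m_def using \<kappa>(1) rc i by (intro finsum_closed) auto
    define \<kappa>' where "\<kappa>' c = (if c = d then \<ominus> m else \<kappa> c)" for c
    have sum: "(\<Oplus>c\<in>A. \<kappa>' c \<otimes> r c x) = (\<Oplus>c\<in>A - {d}. \<kappa> c \<otimes> r' c x)" if x: "x \<in> insert y S" for x
    proof -
      have k: "\<kappa> c \<in> carrier R" if "c \<in> A - {d}" for c using \<kappa>(1) that by blast
      have fin: "finite (A - {d})" using insert.prems(1) by simp
      have r'c: "r' c x \<in> carrier R" if "c \<in> A - {d}" for c
        using that rc[OF _ x] rc[of c y] d(1) i by (simp add: r'_def)
      have "(\<Oplus>c\<in>A - {d}. \<kappa> c \<otimes> r c x) =
          (\<Oplus>c\<in>A - {d}. \<kappa> c \<otimes> r' c x \<oplus> \<kappa> c \<otimes> (r c y \<otimes> i) \<otimes> r d x)"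
      proof (rule finsum_cong'[OF HOL.refl])
        fix c assume c: "c \<in> A - {d}"
        have "r c x \<in> carrier R" "r c y \<in> carrier R" "r d x \<in> carrier R" using c d(1) rc x by auto
        thus "\<kappa> c \<otimes> r c x = \<kappa> c \<otimes> r' c x \<oplus> \<kappa> c \<otimes> (r c y \<otimes> i) \<otimes> r d x"
          using k[OF c] i(1) by (simp add: r'_def minus_eq r_distr r_minus m_assoc a_assoc l_neg)
      qed (use k r'c rc x d(1) i in auto)
      also have "\<dots> = (\<Oplus>c\<in>A - {d}. \<kappa> c \<otimes> r' c x) \<oplus> (\<Oplus>c\<in>A - {d}. \<kappa> c \<otimes> (r c y \<otimes> i) \<otimes> r d x)"
        using k r'c rc x d(1) i by (intro finsum_addf) auto
      also have "(\<Oplus>c\<in>A - {d}. \<kappa> c \<otimes> (r c y \<otimes> i) \<otimes> r d x) = m \<otimes> r d x"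
        unfolding m_def using fin k rc x d(1) i by (intro finsum_ldistr[symmetric]) auto
      finally have eq: "(\<Oplus>c\<in>A - {d}. \<kappa> c \<otimes> r c x) = (\<Oplus>c\<in>A - {d}. \<kappa> c \<otimes> r' c x) \<oplus> m \<otimes> r d x" .
      have "(\<Oplus>c\<in>A. \<kappa>' c \<otimes> r c x) = (\<Oplus>c\<in>insert d (A - {d}). \<kappa>' c \<otimes> r c x)"
        using d(1) by (simp add: insert_absorb)
      also have "\<dots> = \<ominus> m \<otimes> r d x \<oplus> (\<Oplus>c\<in>A - {d}. \<kappa>' c \<otimes> r c x)"
        using fin k rc x d(1) mc by (subst finsum_insert) (auto simp: \<kappa>'_def)
      also have "(\<Oplus>c\<in>A - {d}. \<kappa>' c \<otimes> r c x) = (\<Oplus>c\<in>A - {d}. \<kappa> c \<otimes> r c x)"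
        using k rc x by (intro finsum_cong') (auto simp: \<kappa>'_def)
      also have "\<ominus> m \<otimes> r d x \<oplus> \<dots> = (\<Oplus>c\<in>A - {d}. \<kappa> c \<otimes> r' c x)"
      proof -
        have "(\<Oplus>c\<in>A - {d}. \<kappa> c \<otimes> r' c x) \<in> carrier R" using k r'c by (intro finsum_closed) auto
        moreover have "m \<otimes> r d x \<in> carrier R" using mc rc d(1) x by simp
        ultimately show ?thesis
          unfolding eq using mc rc[OF d(1) x] by (simp add: l_minus a_lcomm r_neg1 a_comm)
      qed
      finally show ?thesis .
    qed
    have "(\<Oplus>c\<in>A - {d}. \<kappa> c \<otimes> r' c y) = \<zero>"
    proof (rule finsum_eq_zero)
      fix c assume c: "c \<in> A - {d}"
      have "r' c y = \<zero>" using c rc[of c y] dc i by (simp add: r'_def m_assoc minus_eq r_neg)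
      thus "\<kappa> c \<otimes> r' c y = \<zero>" using \<kappa>(1) c by simp
    qed
    hence "\<forall>x\<in>insert y S. (\<Oplus>c\<in>A. \<kappa>' c \<otimes> r c x) = \<zero>" using sum \<kappa>(3) by auto
    moreover have "\<forall>c\<in>A. \<kappa>' c \<in> carrier R" using \<kappa>(1) mc by (auto simp: \<kappa>'_def)
    moreover have "\<exists>c\<in>A. \<kappa>' c \<noteq> \<zero>" using \<kappa>(2) by (auto simp: \<kappa>'_def)
    ultimately show ?thesis by blast
  qed
qed

section \<open>Right modules and central elements acting on simple ones\<close>

context right_module
begin

lemma act_zero_scalar [simp]: "x \<in> carrier M \<Longrightarrow> \<zero>\<^bsub>R\<^esub> \<odot>\<^bsub>M\<^esub> x = \<zero>\<^bsub>M\<^esub>"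
  using act_add_scalar[of "\<zero>\<^bsub>R\<^esub>" "\<zero>\<^bsub>R\<^esub>" x] act_closed[of "\<zero>\<^bsub>R\<^esub>" x]
  by (metis M.add.l_cancel_one R.l_zero R.zero_closed)

lemma act_zero [simp]: "r \<in> carrier R \<Longrightarrow> r \<odot>\<^bsub>M\<^esub> \<zero>\<^bsub>M\<^esub> = \<zero>\<^bsub>M\<^esub>"
  using act_add[of r "\<zero>\<^bsub>M\<^esub>" "\<zero>\<^bsub>M\<^esub>"] act_closed[of r "\<zero>\<^bsub>M\<^esub>"]
  by (metis M.add.l_cancel_one M.l_zero M.zero_closed)

lemma act_minus_scalar:
  assumes "r \<in> carrier R" "x \<in> carrier M"
  shows "(\<ominus>\<^bsub>R\<^esub> r) \<odot>\<^bsub>M\<^esub> x = \<ominus>\<^bsub>M\<^esub> (r \<odot>\<^bsub>M\<^esub> x)"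
proof -
  have "(\<ominus>\<^bsub>R\<^esub> r) \<odot>\<^bsub>M\<^esub> x \<oplus>\<^bsub>M\<^esub> r \<odot>\<^bsub>M\<^esub> x = \<zero>\<^bsub>M\<^esub>"
    using act_add_scalar[of "\<ominus>\<^bsub>R\<^esub> r" r x] assms by (simp add: R.l_neg)
  thus ?thesis using assms act_closed by (simp add: M.minus_equality)
qed

lemma submoduleI':
  assumes "N \<subseteq> carrier M" "\<zero>\<^bsub>M\<^esub> \<in> N"
    and "\<And>x y. x \<in> N \<Longrightarrow> y \<in> N \<Longrightarrow> x \<oplus>\<^bsub>M\<^esub> y \<in> N"
    and smult: "\<And>r x. r \<in> carrier R \<Longrightarrow> x \<in> N \<Longrightarrow> r \<odot>\<^bsub>M\<^esub> x \<in> N"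
  shows "submodule N R M"
proof (intro submodule.intro subgroup.intro submodule_axioms.intro)
  show "inv\<^bsub>add_monoid M\<^esub> x \<in> N" if x: "x \<in> N" for x
  proof -
    have "(\<ominus>\<^bsub>R\<^esub> \<one>\<^bsub>R\<^esub>) \<odot>\<^bsub>M\<^esub> x = \<ominus>\<^bsub>M\<^esub> x"
      using x assms(1) by (subst act_minus_scalar) (auto simp: act_one)
    thus ?thesis using smult[of "\<ominus>\<^bsub>R\<^esub> \<one>\<^bsub>R\<^esub>" x] x by (simp add: a_inv_def)
  qed
qed (use assms in auto)

lemma act_finsum_scalar:
  assumes "finite A" "\<And>i. i \<in> A \<Longrightarrow> f i \<in> carrier R" "x \<in> carrier M"
  shows "(\<Oplus>\<^bsub>R\<^esub>i\<in>A. f i) \<odot>\<^bsub>M\<^esub> x = (\<Oplus>\<^bsub>M\<^esub>i\<in>A. f i \<odot>\<^bsub>M\<^esub> x)"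
  using assms
proof (induction A rule: finite_induct)
  case (insert i A)
  have "(\<Oplus>\<^bsub>R\<^esub>i\<in>insert i A. f i) \<odot>\<^bsub>M\<^esub> x = (f i \<oplus>\<^bsub>R\<^esub> (\<Oplus>\<^bsub>R\<^esub>i\<in>A. f i)) \<odot>\<^bsub>M\<^esub> x"
    using insert by (subst R.finsum_insert) auto
  also have "\<dots> = f i \<odot>\<^bsub>M\<^esub> x \<oplus>\<^bsub>M\<^esub> (\<Oplus>\<^bsub>M\<^esub>i\<in>A. f i \<odot>\<^bsub>M\<^esub> x)"
    using insert by (subst act_add_scalar) (auto intro!: R.finsum_closed)
  also have "\<dots> = (\<Oplus>\<^bsub>M\<^esub>i\<in>insert i A. f i \<odot>\<^bsub>M\<^esub> x)"
    using insert act_closed by (subst M.finsum_insert) auto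
  finally show ?case .
qed simp

lemma act_finsum:
  assumes "finite A" "\<And>i. i \<in> A \<Longrightarrow> f i \<in> carrier M" "r \<in> carrier R"
  shows "r \<odot>\<^bsub>M\<^esub> (\<Oplus>\<^bsub>M\<^esub>i\<in>A. f i) = (\<Oplus>\<^bsub>M\<^esub>i\<in>A. r \<odot>\<^bsub>M\<^esub> f i)"
  using assms
proof (induction A rule: finite_induct)
  case (insert i A)
  have "r \<odot>\<^bsub>M\<^esub> (\<Oplus>\<^bsub>M\<^esub>i\<in>insert i A. f i) = r \<odot>\<^bsub>M\<^esub> (f i \<oplus>\<^bsub>M\<^esub> (\<Oplus>\<^bsub>M\<^esub>i\<in>A. f i))"
    using insert by (subst M.finsum_insert) auto
  also have "\<dots> = r \<odot>\<^bsub>M\<^esub> f i \<oplus>\<^bsub>M\<^esub> (\<Oplus>\<^bsub>M\<^esub>i\<in>A. r \<odot>\<^bsub>M\<^esub> f i)"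
    using insert by (subst act_add) (auto intro!: M.finsum_closed)
  also have "\<dots> = (\<Oplus>\<^bsub>M\<^esub>i\<in>insert i A. r \<odot>\<^bsub>M\<^esub> f i)"
    using insert act_closed by (subst M.finsum_insert) auto
  finally show ?case .
qed simp

end

locale simple_faithful = right_module R M
  for R :: "('r, 'n) ring_scheme" (structure) and M :: "('r, 'm) module" (structure) +
  assumes irreducible: "irreducible_right_module R M" and faithful: "faithful_right_module R M"
begin

lemma simple: "submodule N R M \<Longrightarrow> N = {\<zero>\<^bsub>M\<^esub>} \<or> N = carrier M"
  using irreducible by (simp add: irreducible_right_module_def)

lemma exists_nonzero: "\<exists>v\<in>carrier M. v \<noteq> \<zero>\<^bsub>M\<^esub>"
  using irreducible M.zero_closed unfolding irreducible_right_module_def by blast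

lemma generated:
  assumes v: "v \<in> carrier M" "v \<noteq> \<zero>\<^bsub>M\<^esub>" and m: "m \<in> carrier M"
  shows "\<exists>r\<in>carrier R. m = r \<odot>\<^bsub>M\<^esub> v"
proof -
  let ?N = "(\<lambda>r. r \<odot>\<^bsub>M\<^esub> v) ` carrier R"
  have "submodule ?N R M"
  proof (rule submoduleI')
    show "?N \<subseteq> carrier M" using v act_closed by auto
    show "\<zero>\<^bsub>M\<^esub> \<in> ?N" using v by (intro image_eqI[of _ _ "\<zero>\<^bsub>R\<^esub>"]) auto
    show "x \<oplus>\<^bsub>M\<^esub> y \<in> ?N" if "x \<in> ?N" "y \<in> ?N" for x y
      using that v by (auto simp: act_add_scalar[symmetric])
    show "r \<odot>\<^bsub>M\<^esub> x \<in> ?N" if "r \<in> carrier R" "x \<in> ?N" for r x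
      using that v by (auto simp: act_assoc[symmetric])
  qed
  moreover have "v \<in> ?N" using v act_one by (intro image_eqI[of _ _ "\<one>\<^bsub>R\<^esub>"]) auto
  ultimately have "?N = carrier M" using simple v by blast
  thus ?thesis using m by blast
qed

lemma central_swap:
  assumes "y \<in> carrier R" "\<And>r. r \<in> carrier R \<Longrightarrow> y \<otimes>\<^bsub>R\<^esub> r = r \<otimes>\<^bsub>R\<^esub> y"
    and "r \<in> carrier R" "m \<in> carrier M"
  shows "y \<odot>\<^bsub>M\<^esub> (r \<odot>\<^bsub>M\<^esub> m) = r \<odot>\<^bsub>M\<^esub> (y \<odot>\<^bsub>M\<^esub> m)"
  using assms by (simp add: act_assoc[symmetric])

text \<open>Schur's argument: the kernel of a central element is a submodule, and faithfulness
  prevents it from being the whole module.\<close>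

lemma central_injective:
  assumes y: "y \<in> carrier R" "\<And>r. r \<in> carrier R \<Longrightarrow> y \<otimes>\<^bsub>R\<^esub> r = r \<otimes>\<^bsub>R\<^esub> y" "y \<noteq> \<zero>\<^bsub>R\<^esub>"
    and m: "m \<in> carrier M" "y \<odot>\<^bsub>M\<^esub> m = \<zero>\<^bsub>M\<^esub>"
  shows "m = \<zero>\<^bsub>M\<^esub>"
proof -
  let ?N = "{m \<in> carrier M. y \<odot>\<^bsub>M\<^esub> m = \<zero>\<^bsub>M\<^esub>}"
  have "submodule ?N R M"
    using y by (intro submoduleI') (auto simp: act_add act_closed central_swap[OF y(1,2)])
  moreover have "?N \<noteq> carrier M"
    using faithful y(1,3) unfolding faithful_right_module_def by blast
  ultimately show ?thesis using simple m by blast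
qed

lemma central_surjective:
  assumes y: "y \<in> carrier R" "\<And>r. r \<in> carrier R \<Longrightarrow> y \<otimes>\<^bsub>R\<^esub> r = r \<otimes>\<^bsub>R\<^esub> y" "y \<noteq> \<zero>\<^bsub>R\<^esub>"
    and v: "v \<in> carrier M"
  shows "\<exists>w\<in>carrier M. y \<odot>\<^bsub>M\<^esub> w = v"
proof -
  let ?N = "(\<lambda>m. y \<odot>\<^bsub>M\<^esub> m) ` carrier M"
  have "submodule ?N R M"
  proof (rule submoduleI')
    show "?N \<subseteq> carrier M" using y act_closed by auto
    show "\<zero>\<^bsub>M\<^esub> \<in> ?N" using y by (intro image_eqI[of _ _ "\<zero>\<^bsub>M\<^esub>"]) auto
    show "a \<oplus>\<^bsub>M\<^esub> b \<in> ?N" if "a \<in> ?N" "b \<in> ?N" for a b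
      using that y by (auto simp: act_add[symmetric])
    show "r \<odot>\<^bsub>M\<^esub> a \<in> ?N" if "r \<in> carrier R" "a \<in> ?N" for r a
      using that y act_closed by (auto simp: central_swap[OF y(1,2), symmetric])
  qed
  moreover have "?N \<noteq> {\<zero>\<^bsub>M\<^esub>}"
    using exists_nonzero central_injective[OF y] by blast
  ultimately have "v \<in> ?N" using simple v by blast
  thus ?thesis by auto
qed

end

context group_algebra
begin

lemma monom_add: "c \<in> carrier K \<Longrightarrow> d \<in> carrier K \<Longrightarrow> monom c g \<oplus>\<^bsub>KG\<^esub> monom d g = monom (c \<oplus>\<^bsub>K\<^esub> d) g"
  by (rule ext) (simp, simp add: monom_def)

lemma monom_central:
  assumes "central G z" "a \<in> carrier KG"
  shows "monom \<one>\<^bsub>K\<^esub> z \<otimes>\<^bsub>KG\<^esub> a = a \<otimes>\<^bsub>KG\<^esub> monom \<one>\<^bsub>K\<^esub> z"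
proof (rule KG_eqI)
  have z: "z \<in> carrier G" using assms by (simp add: central_def)
  show "monom \<one>\<^bsub>K\<^esub> z \<otimes>\<^bsub>KG\<^esub> a \<in> carrier KG" "a \<otimes>\<^bsub>KG\<^esub> monom \<one>\<^bsub>K\<^esub> z \<in> carrier KG"
    using assms z by (auto intro!: mult_closed)
  fix x assume x: "x \<in> carrier G"
  have "inv\<^bsub>G\<^esub> z \<otimes>\<^bsub>G\<^esub> x = x \<otimes>\<^bsub>G\<^esub> inv\<^bsub>G\<^esub> z"
    using G.central_inv[OF assms(1)] x by (simp add: central_def)
  thus "(monom \<one>\<^bsub>K\<^esub> z \<otimes>\<^bsub>KG\<^esub> a) x = (a \<otimes>\<^bsub>KG\<^esub> monom \<one>\<^bsub>K\<^esub> z) x"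
    using assms z x by (simp add: coeff_monom_mult coeff_mult_monom)
qed

text \<open>The elements \<open>v / (z - c)\<close> of a simple faithful module are linearly independent over \<open>K\<close>, since
  polynomials in \<open>z\<close> act injectively. If \<open>K\<close> were larger than \<open>G\<close>, infinitely many of them
  would lie in the span of \<open>v S\<close> for one finite subset \<open>S\<close> of \<open>G\<close>.\<close>

lemma primitive_imp_small:
  fixes B :: "'b set"
  assumes z: "central G z" "inj (\<lambda>n::nat. z [^]\<^bsub>G\<^esub> n)"
    and B: "infinite B" "carrier G \<lesssim> B"
    and prim: "primitive_ring KG"
  shows "carrier K \<lesssim> B"
proof -
  obtain M :: "('g \<Rightarrow> 'k, ('g \<Rightarrow> 'k) set) module"
    where M: "faithful_right_module KG M" "irreducible_right_module KG M"
    using prim by (auto simp: primitive_ring_def)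
  interpret M: simple_faithful KG M
    using M by (intro simple_faithful.intro simple_faithful_axioms.intro)
      (auto simp: irreducible_right_module_def)
  have zc: "z \<in> carrier G" using z by (simp add: central_def)
  define cent where "cent y \<longleftrightarrow> y \<in> carrier KG \<and> (\<forall>r\<in>carrier KG. y \<otimes>\<^bsub>KG\<^esub> r = r \<otimes>\<^bsub>KG\<^esub> y)" for y
  define sc where "sc c = monom c \<one>\<^bsub>G\<^esub>" for c
  define lin where "lin c = monom \<one>\<^bsub>K\<^esub> z \<ominus>\<^bsub>KG\<^esub> sc c" for c
  \<comment> \<open>The polynomials in \<open>z\<close>. Natural exponents provide leading terms,
    and centrality makes nonzero members act injectively.\<close>
  define Q where "Q = {q. cent q \<and> supp q \<subseteq> range (\<lambda>n::nat. z [^]\<^bsub>G\<^esub> n)}"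
  have cent_minus: "cent (a \<ominus>\<^bsub>KG\<^esub> b)" if "cent a" "cent b" for a b
    using that by (auto simp: cent_def R.minus_eq R.l_distr R.r_distr R.l_minus R.r_minus)
  have cent_mult: "cent (a \<otimes>\<^bsub>KG\<^esub> b)" if "cent a" "cent b" for a b
    using that unfolding cent_def by (metis R.m_assoc R.m_closed)
  have sc_cent: "cent (sc c)" if "c \<in> carrier K" for c
    using that scalar_central by (simp add: cent_def sc_def)
  have lin_cent: "cent (lin c)" if "c \<in> carrier K" for c
    unfolding lin_def using that monom_central[OF z(1)] zc
    by (intro cent_minus sc_cent) (auto simp: cent_def)
  have zpow: "z [^]\<^bsub>G\<^esub> n = z [^]\<^bsub>G\<^esub> m \<longleftrightarrow> n = m" for n m :: nat
    using inj_eq[OF z(2)] .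
  have z1: "z \<noteq> \<one>\<^bsub>G\<^esub>" using zpow[of 1 0] zc by simp
  have lin_coeff: "(lin c \<otimes>\<^bsub>KG\<^esub> q) x = q (inv\<^bsub>G\<^esub> z \<otimes>\<^bsub>G\<^esub> x) \<ominus>\<^bsub>K\<^esub> c \<otimes>\<^bsub>K\<^esub> q x"
    if "c \<in> carrier K" "q \<in> carrier KG" "x \<in> carrier G" for c q x
  proof -
    have "lin c \<otimes>\<^bsub>KG\<^esub> q = monom \<one>\<^bsub>K\<^esub> z \<otimes>\<^bsub>KG\<^esub> q \<oplus>\<^bsub>KG\<^esub> \<ominus>\<^bsub>KG\<^esub> (sc c \<otimes>\<^bsub>KG\<^esub> q)"
      using that zc by (simp add: lin_def sc_def R.minus_eq R.l_distr R.l_minus)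
    thus ?thesis using that zc by (simp add: sc_def coeff_monom_mult mult_closed K.minus_eq)
  qed
  have lin_nz: "lin c \<noteq> \<zero>\<^bsub>KG\<^esub>" if c: "c \<in> carrier K" for c
  proof
    assume "lin c = \<zero>\<^bsub>KG\<^esub>"
    hence "lin c z = \<zero>\<^bsub>K\<^esub>" by simp
    thus False using c zc z1 by (simp add: lin_def sc_def R.minus_eq) (simp add: monom_def)
  qed
  have Q_step: "lin c \<otimes>\<^bsub>KG\<^esub> q \<ominus>\<^bsub>KG\<^esub> sc d \<in> Q" if q: "q \<in> Q" and cd: "c \<in> carrier K" "d \<in> carrier K" for c d q
  proof -
    have qc: "q \<in> carrier KG" "cent q" using q by (auto simp: Q_def cent_def)
    have lc: "lin c \<in> carrier KG" using lin_cent[OF cd(1)] by (simp add: cent_def)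
    have scc: "sc d \<in> carrier KG" using cd by (simp add: sc_def)
    have "supp (lin c) \<subseteq> {z, \<one>\<^bsub>G\<^esub>}"
      using supp_minus[of "monom \<one>\<^bsub>K\<^esub> z" "sc c"] cd zc
      by (auto simp: lin_def sc_def) (auto simp: supp_def monom_def split: if_splits)
    have "supp (lin c \<otimes>\<^bsub>KG\<^esub> q) \<subseteq> range (\<lambda>n::nat. z [^]\<^bsub>G\<^esub> n)"
    proof
      fix x assume "x \<in> supp (lin c \<otimes>\<^bsub>KG\<^esub> q)"
      then obtain g h where gh: "g \<in> supp (lin c)" "h \<in> supp q" "x = g \<otimes>\<^bsub>G\<^esub> h"
        using supp_mult[OF lc qc(1)] by auto
      obtain n :: nat where n: "h = z [^]\<^bsub>G\<^esub> n" using gh(2) q by (auto simp: Q_def)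
      have "g = z \<or> g = \<one>\<^bsub>G\<^esub>" using gh(1) \<open>supp (lin c) \<subseteq> {z, \<one>\<^bsub>G\<^esub>}\<close> by blast
      thus "x \<in> range (\<lambda>n::nat. z [^]\<^bsub>G\<^esub> n)"
      proof
        assume "g = z"
        hence "x = z [^]\<^bsub>G\<^esub> Suc n" using gh(3) n G.nat_pow_Suc2[OF zc] by simp
        thus ?thesis by blast
      next
        assume "g = \<one>\<^bsub>G\<^esub>"
        thus ?thesis using gh(3) n zc by auto
      qed
    qed
    moreover have "supp (sc d) \<subseteq> range (\<lambda>n::nat. z [^]\<^bsub>G\<^esub> n)"
      by (auto simp: supp_def sc_def monom_def intro: range_eqI[of _ _ 0] split: if_splits)
    ultimately show ?thesis
      using supp_minus[OF mult_closed[OF lc qc(1)] scc]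
        cent_minus[OF cent_mult[OF lin_cent[OF cd(1)] qc(2)] sc_cent[OF cd(2)]]
      by (auto simp: Q_def)
  qed
  \<comment> \<open>Compare leading terms: for nonzero \<open>q\<close> the product with
    \<open>z - c\<close> has positive degree in \<open>z\<close>, so it cannot be a nonzero
    constant.\<close>
  have lin_const: "d = \<zero>\<^bsub>K\<^esub>" if q: "q \<in> Q" and cd: "c \<in> carrier K" "d \<in> carrier K"
    and eq: "lin c \<otimes>\<^bsub>KG\<^esub> q = sc d" for c d q
  proof (rule ccontr)
    assume d: "d \<noteq> \<zero>\<^bsub>K\<^esub>"
    have qc: "q \<in> carrier KG" using q by (simp add: Q_def cent_def)
    have lc: "lin c \<in> carrier KG" using lin_cent[OF cd(1)] by (simp add: cent_def)
    define N where "N = {n::nat. z [^]\<^bsub>G\<^esub> n \<in> supp q}"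
    have "finite N" unfolding N_def
      using finite_vimageI[OF finite_supp[OF qc] z(2)] by (simp add: vimage_def)
    have "q \<noteq> \<zero>\<^bsub>KG\<^esub>"
    proof
      assume "q = \<zero>\<^bsub>KG\<^esub>"
      hence "sc d = \<zero>\<^bsub>KG\<^esub>" using eq lc by simp
      hence "sc d \<one>\<^bsub>G\<^esub> = \<zero>\<^bsub>K\<^esub>" by simp
      thus False using d by (simp add: sc_def monom_def)
    qed
    hence "N \<noteq> {}" using supp_empty_iff[OF qc] q by (auto simp: N_def Q_def)
    define n where "n = Max N"
    have n: "n \<in> N" "Suc n \<notin> N"
      unfolding n_def using Max_in[OF \<open>finite N\<close> \<open>N \<noteq> {}\<close>] Max_ge[OF \<open>finite N\<close>, of "Suc (Max N)"]
      by (blast, fastforce)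
    have "(lin c \<otimes>\<^bsub>KG\<^esub> q) (z [^]\<^bsub>G\<^esub> Suc n) =
        q (inv\<^bsub>G\<^esub> z \<otimes>\<^bsub>G\<^esub> z [^]\<^bsub>G\<^esub> Suc n) \<ominus>\<^bsub>K\<^esub> c \<otimes>\<^bsub>K\<^esub> q (z [^]\<^bsub>G\<^esub> Suc n)"
      using cd qc zc by (intro lin_coeff) auto
    also have "inv\<^bsub>G\<^esub> z \<otimes>\<^bsub>G\<^esub> z [^]\<^bsub>G\<^esub> Suc n = z [^]\<^bsub>G\<^esub> n"
      unfolding G.nat_pow_Suc2[OF zc] using zc by simp
    also have "q (z [^]\<^bsub>G\<^esub> Suc n) = \<zero>\<^bsub>K\<^esub>" using n(2) by (simp add: N_def supp_def)
    finally have "(lin c \<otimes>\<^bsub>KG\<^esub> q) (z [^]\<^bsub>G\<^esub> Suc n) = q (z [^]\<^bsub>G\<^esub> n)"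
      using cd qc by (simp add: K.minus_eq)
    moreover have "sc d (z [^]\<^bsub>G\<^esub> Suc n) = \<zero>\<^bsub>K\<^esub>"
      using zpow[of "Suc n" 0] by (simp add: sc_def monom_def)
    ultimately show False using n(1) eq by (simp add: N_def supp_def)
  qed
  obtain v where v: "v \<in> carrier M" "v \<noteq> \<zero>\<^bsub>M\<^esub>" using M.exists_nonzero by blast
  have "\<forall>c\<in>carrier K. \<exists>w\<in>carrier M. lin c \<odot>\<^bsub>M\<^esub> w = v"
  proof
    fix c assume c: "c \<in> carrier K"
    show "\<exists>w\<in>carrier M. lin c \<odot>\<^bsub>M\<^esub> w = v"
      using M.central_surjective[OF _ _ lin_nz[OF c] v(1)] lin_cent[OF c] by (simp add: cent_def)
  qed
  then obtain w where w: "\<And>c. c \<in> carrier K \<Longrightarrow> w c \<in> carrier M" "\<And>c. c \<in> carrier K \<Longrightarrow> lin c \<odot>\<^bsub>M\<^esub> w c = v"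
    by metis
  have "\<forall>c\<in>carrier K. \<exists>r\<in>carrier KG. w c = r \<odot>\<^bsub>M\<^esub> v" using M.generated[OF v w(1)] by blast
  then obtain r where r: "\<And>c. c \<in> carrier K \<Longrightarrow> r c \<in> carrier KG" "\<And>c. c \<in> carrier K \<Longrightarrow> w c = r c \<odot>\<^bsub>M\<^esub> v"
    by metis
  have scc: "sc c \<in> carrier KG" if "c \<in> carrier K" for c using that by (simp add: sc_def)
  have linc: "lin c \<in> carrier KG" if "c \<in> carrier K" for c using lin_cent[OF that] by (simp add: cent_def)
  \<comment> \<open>Multiplication by \<open>z - c\<close> turns the relation into
    \<open>(z - c) q - \<kappa>\<close> annihilating \<open>v\<close>; this is a polynomial in
    \<open>z\<close>, hence zero.\<close>
  have sc_inj: "\<kappa> = \<zero>\<^bsub>K\<^esub>" if "\<kappa> \<in> carrier K" "q \<in> Q" "c \<in> carrier K" "sc \<kappa> \<odot>\<^bsub>M\<^esub> w c = q \<odot>\<^bsub>M\<^esub> v" for \<kappa> q c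
  proof -
    have qc: "q \<in> carrier KG" "cent q" using that(2) by (auto simp: Q_def cent_def)
    have "sc \<kappa> \<odot>\<^bsub>M\<^esub> v = sc \<kappa> \<odot>\<^bsub>M\<^esub> (lin c \<odot>\<^bsub>M\<^esub> w c)" using w that by simp
    also have "\<dots> = lin c \<odot>\<^bsub>M\<^esub> (sc \<kappa> \<odot>\<^bsub>M\<^esub> w c)"
      using that sc_cent[OF that(1)] linc w by (intro M.central_swap) (auto simp: cent_def)
    also have "\<dots> = (q \<otimes>\<^bsub>KG\<^esub> lin c) \<odot>\<^bsub>M\<^esub> v" using that qc linc v by (simp add: M.act_assoc)
    also have "q \<otimes>\<^bsub>KG\<^esub> lin c = lin c \<otimes>\<^bsub>KG\<^esub> q" using qc linc that by (simp add: cent_def)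
    finally have e: "sc \<kappa> \<odot>\<^bsub>M\<^esub> v = (lin c \<otimes>\<^bsub>KG\<^esub> q) \<odot>\<^bsub>M\<^esub> v" .
    let ?y = "lin c \<otimes>\<^bsub>KG\<^esub> q \<ominus>\<^bsub>KG\<^esub> sc \<kappa>"
    have yQ: "?y \<in> Q" by (rule Q_step[OF that(2,3,1)])
    have yc: "?y \<in> carrier KG" "\<And>r. r \<in> carrier KG \<Longrightarrow> ?y \<otimes>\<^bsub>KG\<^esub> r = r \<otimes>\<^bsub>KG\<^esub> ?y"
      using yQ by (auto simp: Q_def cent_def)
    have lq: "lin c \<otimes>\<^bsub>KG\<^esub> q \<in> carrier KG" using qc linc that by (intro mult_closed)
    have "?y \<odot>\<^bsub>M\<^esub> v = \<zero>\<^bsub>M\<^esub>"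
      using lq scc[OF that(1)] v e M.act_closed[OF lq v(1)]
      by (simp add: R.minus_eq M.act_add_scalar M.act_minus_scalar M.M.r_neg)
    hence "?y = \<zero>\<^bsub>KG\<^esub>" using M.central_injective[OF yc _ v(1)] v(2) by blast
    hence "lin c \<otimes>\<^bsub>KG\<^esub> q = sc \<kappa>" using R.minus_zero_imp_eq[OF lq scc[OF that(1)]] by blast
    thus ?thesis by (rule lin_const[OF that(2,3,1)])
  qed
  \<comment> \<open>The right-hand side is a polynomial multiple of \<open>v\<close> instead of zero
    so that the induction goes through: multiplying by \<open>z - d\<close> clears one denominator
    and leaves constants behind.\<close>
  have indep: "\<forall>c\<in>A. \<kappa> c = \<zero>\<^bsub>K\<^esub>"
    if "finite A" "A \<subseteq> carrier K" "\<forall>c\<in>A. \<kappa> c \<in> carrier K" "q \<in> Q"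
      "(\<Oplus>\<^bsub>M\<^esub>c\<in>A. sc (\<kappa> c) \<odot>\<^bsub>M\<^esub> w c) = q \<odot>\<^bsub>M\<^esub> v" for A \<kappa> q
    using that
  proof (induction A arbitrary: \<kappa> q rule: finite_induct)
    case (insert d A)
    have dK: "d \<in> carrier K" and AK: "A \<subseteq> carrier K" and kd: "\<kappa> d \<in> carrier K"
      and kA: "\<And>c. c \<in> A \<Longrightarrow> \<kappa> c \<in> carrier K" using insert.prems by auto
    have cK: "c \<in> carrier K" if "c \<in> A" for c using AK that by blast
    have qc: "q \<in> carrier KG" "cent q" using insert.prems(3) by (auto simp: Q_def cent_def)
    define \<kappa>' where "\<kappa>' c = \<kappa> c \<otimes>\<^bsub>K\<^esub> (c \<ominus>\<^bsub>K\<^esub> d)" for c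
    define s where "s = (\<Oplus>\<^bsub>K\<^esub>c\<in>insert d A. \<kappa> c)"
    have k'c: "\<kappa>' c \<in> carrier K" if "c \<in> A" for c using that kA cK dK by (simp add: \<kappa>'_def)
    have sK: "s \<in> carrier K" unfolding s_def using kd kA by (intro K.finsum_closed) auto
    \<comment> \<open>The identity \<open>(z - d) / (z - c) = 1 + (c - d) / (z - c)\<close>.\<close>
    have lin_act: "lin d \<odot>\<^bsub>M\<^esub> (sc (\<kappa> c) \<odot>\<^bsub>M\<^esub> w c) = sc (\<kappa> c) \<odot>\<^bsub>M\<^esub> v \<oplus>\<^bsub>M\<^esub> sc (\<kappa>' c) \<odot>\<^bsub>M\<^esub> w c"
      if c: "c \<in> carrier K" "\<kappa> c \<in> carrier K" for c
    proof -
      have cd: "c \<ominus>\<^bsub>K\<^esub> d \<in> carrier K" using c dK by simp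
      have "lin d = lin c \<oplus>\<^bsub>KG\<^esub> sc (c \<ominus>\<^bsub>K\<^esub> d)"
      proof (rule ext)
        fix x
        have "monom \<one>\<^bsub>K\<^esub> z x \<in> carrier K" using zc by simp
        thus "lin d x = (lin c \<oplus>\<^bsub>KG\<^esub> sc (c \<ominus>\<^bsub>K\<^esub> d)) x"
          using c dK zc cd by (simp add: lin_def sc_def R.minus_eq)
            (simp add: monom_def K.minus_eq K.a_assoc K.r_neg1)
      qed
      hence "lin d \<odot>\<^bsub>M\<^esub> w c = v \<oplus>\<^bsub>M\<^esub> sc (c \<ominus>\<^bsub>K\<^esub> d) \<odot>\<^bsub>M\<^esub> w c"
        using linc[OF c(1)] scc[OF cd] w c(1) by (simp add: M.act_add_scalar)
      moreover have "lin d \<odot>\<^bsub>M\<^esub> (sc (\<kappa> c) \<odot>\<^bsub>M\<^esub> w c) = sc (\<kappa> c) \<odot>\<^bsub>M\<^esub> (lin d \<odot>\<^bsub>M\<^esub> w c)"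
        using lin_cent[OF dK] linc scc c w by (intro M.central_swap) (auto simp: cent_def)
      moreover have "sc (\<kappa> c) \<odot>\<^bsub>M\<^esub> (sc (c \<ominus>\<^bsub>K\<^esub> d) \<odot>\<^bsub>M\<^esub> w c) = sc (\<kappa>' c) \<odot>\<^bsub>M\<^esub> w c"
      proof -
        have "sc (c \<ominus>\<^bsub>K\<^esub> d) \<otimes>\<^bsub>KG\<^esub> sc (\<kappa> c) = sc (\<kappa>' c)"
          using cd c by (simp add: sc_def monom_mult_monom \<kappa>'_def K.m_comm)
        thus ?thesis using scc c cd w M.act_assoc[of "sc (c \<ominus>\<^bsub>K\<^esub> d)" "sc (\<kappa> c)" "w c"] by simp
      qed
      ultimately show ?thesis
        using scc c cd w v M.act_closed by (simp add: M.act_add)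
    qed
    have k'd: "sc (\<kappa>' d) \<odot>\<^bsub>M\<^esub> w d = \<zero>\<^bsub>M\<^esub>"
    proof -
      have "\<kappa>' d = \<zero>\<^bsub>K\<^esub>" using kd dK by (simp add: \<kappa>'_def K.minus_eq K.r_neg)
      moreover have "sc \<zero>\<^bsub>K\<^esub> = \<zero>\<^bsub>KG\<^esub>" by (rule ext) (simp add: sc_def, simp add: monom_def)
      ultimately show ?thesis using w dK by simp
    qed
    have fin: "finite (insert d A)" using insert.hyps by simp
    have sc_add: "sc (a \<oplus>\<^bsub>K\<^esub> b) = sc a \<oplus>\<^bsub>KG\<^esub> sc b" if "a \<in> carrier K" "b \<in> carrier K" for a b
      using that by (simp add: sc_def monom_add)
    have sumsc: "(\<Oplus>\<^bsub>M\<^esub>c\<in>insert d A. sc (\<kappa> c) \<odot>\<^bsub>M\<^esub> v) = sc s \<odot>\<^bsub>M\<^esub> v"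
    proof -
      have "(\<Oplus>\<^bsub>KG\<^esub>c\<in>C. sc (\<kappa> c)) = sc (\<Oplus>\<^bsub>K\<^esub>c\<in>C. \<kappa> c)" if "finite C" "\<And>c. c \<in> C \<Longrightarrow> \<kappa> c \<in> carrier K" for C
        using that
      proof (induction C rule: finite_induct)
        case empty
        show ?case by (rule ext) (simp add: sc_def, simp add: monom_def)
      next
        case (insert c C)
        thus ?case using scc by (simp add: R.finsum_insert K.finsum_insert Pi_def sc_add)
      qed
      hence "(\<Oplus>\<^bsub>KG\<^esub>c\<in>insert d A. sc (\<kappa> c)) = sc s" unfolding s_def using fin kd kA by blast
      moreover have "(\<Oplus>\<^bsub>KG\<^esub>c\<in>insert d A. sc (\<kappa> c)) \<odot>\<^bsub>M\<^esub> v = (\<Oplus>\<^bsub>M\<^esub>c\<in>insert d A. sc (\<kappa> c) \<odot>\<^bsub>M\<^esub> v)"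
        using kd kA scc by (intro M.act_finsum_scalar fin v(1)) auto
      ultimately show ?thesis by simp
    qed
    have wcl: "sc (\<kappa> c) \<odot>\<^bsub>M\<^esub> w c \<in> carrier M" "sc (\<kappa> c) \<odot>\<^bsub>M\<^esub> v \<in> carrier M" if "c \<in> insert d A" for c
      using that scc kd kA dK cK w v by (auto intro!: M.act_closed)
    have w'cl: "sc (\<kappa>' c) \<odot>\<^bsub>M\<^esub> w c \<in> carrier M" if "c \<in> insert d A" for c
    proof (cases "c = d")
      case False
      hence "c \<in> A" using that by simp
      thus ?thesis using scc[OF k'c] w(1)[OF cK] by (intro M.act_closed)
    qed (simp add: k'd)
    have "lin d \<odot>\<^bsub>M\<^esub> (q \<odot>\<^bsub>M\<^esub> v) = (\<Oplus>\<^bsub>M\<^esub>c\<in>insert d A. lin d \<odot>\<^bsub>M\<^esub> (sc (\<kappa> c) \<odot>\<^bsub>M\<^esub> w c))"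
      unfolding insert.prems(4)[symmetric] using fin wcl linc[OF dK] by (intro M.act_finsum) auto
    also have "\<dots> = (\<Oplus>\<^bsub>M\<^esub>c\<in>insert d A. sc (\<kappa> c) \<odot>\<^bsub>M\<^esub> v \<oplus>\<^bsub>M\<^esub> sc (\<kappa>' c) \<odot>\<^bsub>M\<^esub> w c)"
      using kd kA dK cK wcl w'cl lin_act by (intro M.M.finsum_cong') auto
    also have "\<dots> = (\<Oplus>\<^bsub>M\<^esub>c\<in>insert d A. sc (\<kappa> c) \<odot>\<^bsub>M\<^esub> v) \<oplus>\<^bsub>M\<^esub> (\<Oplus>\<^bsub>M\<^esub>c\<in>insert d A. sc (\<kappa>' c) \<odot>\<^bsub>M\<^esub> w c)"
      using wcl w'cl by (intro M.M.finsum_addf) auto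
    also have "(\<Oplus>\<^bsub>M\<^esub>c\<in>insert d A. sc (\<kappa>' c) \<odot>\<^bsub>M\<^esub> w c) = (\<Oplus>\<^bsub>M\<^esub>c\<in>A. sc (\<kappa>' c) \<odot>\<^bsub>M\<^esub> w c)"
    proof -
      have "(\<Oplus>\<^bsub>M\<^esub>c\<in>A. sc (\<kappa>' c) \<odot>\<^bsub>M\<^esub> w c) \<in> carrier M" using w'cl by (intro M.M.finsum_closed) auto
      thus ?thesis using insert.hyps w'cl k'd by (subst M.M.finsum_insert) auto
    qed
    finally have e: "lin d \<odot>\<^bsub>M\<^esub> (q \<odot>\<^bsub>M\<^esub> v) = sc s \<odot>\<^bsub>M\<^esub> v \<oplus>\<^bsub>M\<^esub> (\<Oplus>\<^bsub>M\<^esub>c\<in>A. sc (\<kappa>' c) \<odot>\<^bsub>M\<^esub> w c)"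
      unfolding sumsc .
    have lq: "lin d \<otimes>\<^bsub>KG\<^esub> q \<in> carrier KG" using qc linc dK by (intro mult_closed)
    have "lin d \<odot>\<^bsub>M\<^esub> (q \<odot>\<^bsub>M\<^esub> v) = (lin d \<otimes>\<^bsub>KG\<^esub> q) \<odot>\<^bsub>M\<^esub> v"
      using qc linc[OF dK] v(1) M.act_assoc[of q "lin d" v] by (simp add: cent_def)
    moreover have sumc: "(\<Oplus>\<^bsub>M\<^esub>c\<in>A. sc (\<kappa>' c) \<odot>\<^bsub>M\<^esub> w c) \<in> carrier M"
      using w'cl by (intro M.M.finsum_closed) auto
    moreover have ssc: "sc s \<odot>\<^bsub>M\<^esub> v \<in> carrier M" using scc[OF sK] v by (intro M.act_closed)
    ultimately have "(\<Oplus>\<^bsub>M\<^esub>c\<in>A. sc (\<kappa>' c) \<odot>\<^bsub>M\<^esub> w c) = (lin d \<otimes>\<^bsub>KG\<^esub> q \<ominus>\<^bsub>KG\<^esub> sc s) \<odot>\<^bsub>M\<^esub> v"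
    proof -
      assume a: "lin d \<odot>\<^bsub>M\<^esub> (q \<odot>\<^bsub>M\<^esub> v) = (lin d \<otimes>\<^bsub>KG\<^esub> q) \<odot>\<^bsub>M\<^esub> v"
      let ?T = "\<Oplus>\<^bsub>M\<^esub>c\<in>A. sc (\<kappa>' c) \<odot>\<^bsub>M\<^esub> w c" and ?S = "sc s \<odot>\<^bsub>M\<^esub> v"
      have "(lin d \<otimes>\<^bsub>KG\<^esub> q \<ominus>\<^bsub>KG\<^esub> sc s) \<odot>\<^bsub>M\<^esub> v = (lin d \<otimes>\<^bsub>KG\<^esub> q) \<odot>\<^bsub>M\<^esub> v \<oplus>\<^bsub>M\<^esub> \<ominus>\<^bsub>M\<^esub> ?S"
        using lq scc[OF sK] v(1) by (simp add: R.minus_eq M.act_add_scalar M.act_minus_scalar)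
      also have "\<dots> = (?T \<oplus>\<^bsub>M\<^esub> ?S) \<oplus>\<^bsub>M\<^esub> \<ominus>\<^bsub>M\<^esub> ?S"
        by (simp only: a[symmetric] e M.M.a_comm[OF ssc sumc])
      also have "\<dots> = ?T" using ssc sumc by (simp add: M.M.a_assoc M.M.r_neg)
      finally show ?thesis by simp
    qed
    hence k'0: "\<forall>c\<in>A. \<kappa>' c = \<zero>\<^bsub>K\<^esub>"
      using k'c by (intro insert.IH[OF AK _ Q_step[OF insert.prems(3) dK sK]]) auto
    have kA0: "\<kappa> c = \<zero>\<^bsub>K\<^esub>" if c: "c \<in> A" for c
    proof -
      have "c \<ominus>\<^bsub>K\<^esub> d \<noteq> \<zero>\<^bsub>K\<^esub>"
      proof
        assume "c \<ominus>\<^bsub>K\<^esub> d = \<zero>\<^bsub>K\<^esub>"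
        hence "c = d" by (rule K.minus_zero_imp_eq[OF cK[OF c] dK])
        thus False using c insert.hyps by blast
      qed
      thus ?thesis using k'0 c kA[OF c] cK[OF c] dK by (auto simp: \<kappa>'_def K.integral_iff)
    qed
    have "sc \<zero>\<^bsub>K\<^esub> = \<zero>\<^bsub>KG\<^esub>" by (rule ext) (simp add: sc_def, simp add: monom_def)
    hence "(\<Oplus>\<^bsub>M\<^esub>c\<in>A. sc (\<kappa> c) \<odot>\<^bsub>M\<^esub> w c) = \<zero>\<^bsub>M\<^esub>"
      using kA0 cK w by (intro M.M.finsum_eq_zero) auto
    hence "sc (\<kappa> d) \<odot>\<^bsub>M\<^esub> w d = q \<odot>\<^bsub>M\<^esub> v"
      using insert.prems(4) insert.hyps wcl by (subst (asm) M.M.finsum_insert) auto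
    hence "\<kappa> d = \<zero>\<^bsub>K\<^esub>" by (rule sc_inj[OF kd insert.prems(3) dK])
    thus ?case using kA0 by blast
  qed simp
  show ?thesis
  proof (rule ccontr)
    assume big: "\<not> carrier K \<lesssim> B"
    let ?P = "{S. finite S \<and> S \<subseteq> carrier G}"
    have PB: "?P \<lesssim> B" by (rule finite_subsets_lepoll[OF B])
    obtain j where j: "inj_on j ?P" "j ` ?P \<subseteq> B" using PB by (auto simp: lepoll_def)
    let ?f = "\<lambda>c. j (supp (r c))"
    \<comment> \<open>Each \<open>c\<close> is sent to the support of \<open>r c\<close>, encoded in
      \<open>B\<close>. If all fibres were finite, \<open>K\<close> would be no larger than
      \<open>B\<close>.\<close>
    have "\<exists>b. infinite {c \<in> carrier K. ?f c = b}"
    proof (rule ccontr)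
      assume "\<not> ?thesis"
      moreover have "?f ` carrier K \<subseteq> B" using j(2) r(1) supp_subset by auto
      ultimately show False using finite_fibres_lepoll[OF B(1), of ?f "carrier K"] big by blast
    qed
    then obtain b where b: "infinite {c \<in> carrier K. ?f c = b}" (is "infinite ?C") by blast
    then obtain c0 where c0: "c0 \<in> ?C" using infinite_imp_nonempty by blast
    define S where "S = supp (r c0)"
    have S: "finite S" using r c0 by (simp add: S_def)
    have suppS: "supp (r c) = S" if "c \<in> ?C" for c
    proof -
      have "j (supp (r c)) = j S" "c \<in> carrier K" "c0 \<in> carrier K" using that c0 by (auto simp: S_def)
      moreover from this have "supp (r c) \<in> ?P" "S \<in> ?P"
        using r(1) supp_subset by (auto simp: S_def)
      ultimately show ?thesis using inj_onD[OF j(1)] by blast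
    qed
    \<comment> \<open>One element more than \<open>S\<close> has, so that the coefficient vectors of
      the \<open>r c\<close> on \<open>S\<close> become linearly dependent.\<close>
    obtain A where A: "A \<subseteq> ?C" "finite A" "card A = Suc (card S)"
      using infinite_arbitrarily_large[OF b] by blast
    have AK: "A \<subseteq> carrier K" using A by blast
    have "card S < card A" using A by simp
    moreover have "r c x \<in> carrier K" if "c \<in> A" "x \<in> S" for c x
      using that r(1) AK by blast
    ultimately obtain \<kappa> where \<kappa>: "\<forall>c\<in>A. \<kappa> c \<in> carrier K" "\<exists>c\<in>A. \<kappa> c \<noteq> \<zero>\<^bsub>K\<^esub>"
        "\<forall>x\<in>S. (\<Oplus>\<^bsub>K\<^esub>c\<in>A. \<kappa> c \<otimes>\<^bsub>K\<^esub> r c x) = \<zero>\<^bsub>K\<^esub>"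
      using K.linear_dependence[OF S A(2), of r] by blast
    have kr: "sc (\<kappa> c) \<otimes>\<^bsub>KG\<^esub> r c \<in> carrier KG" if "c \<in> A" for c
      using that \<kappa>(1) scc r AK by (intro mult_closed) auto
    have "(\<Oplus>\<^bsub>KG\<^esub>c\<in>A. sc (\<kappa> c) \<otimes>\<^bsub>KG\<^esub> r c) = \<zero>\<^bsub>KG\<^esub>"
    proof (rule ext)
      fix x
      have "(\<Oplus>\<^bsub>KG\<^esub>c\<in>A. sc (\<kappa> c) \<otimes>\<^bsub>KG\<^esub> r c) x = (\<Oplus>\<^bsub>K\<^esub>c\<in>A. (sc (\<kappa> c) \<otimes>\<^bsub>KG\<^esub> r c) x)"
        by (rule coeff_finsum[OF A(2) kr])
      also have "\<dots> = (\<Oplus>\<^bsub>K\<^esub>c\<in>A. \<kappa> c \<otimes>\<^bsub>K\<^esub> r c x)"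
        using \<kappa>(1) r(1) AK by (intro K.finsum_cong') (auto simp: sc_def coeff_scalar)
      also have "\<dots> = \<zero>\<^bsub>K\<^esub>"
      proof (cases "x \<in> S")
        case False
        have "r c x = \<zero>\<^bsub>K\<^esub>" if "c \<in> A" for c
        proof -
          have "x \<notin> supp (r c)" using suppS[of c] A(1) that False by blast
          thus ?thesis by (simp only: not_in_supp)
        qed
        thus ?thesis using \<kappa>(1) by (intro K.finsum_eq_zero) auto
      qed (use \<kappa>(3) in blast)
      finally show "(\<Oplus>\<^bsub>KG\<^esub>c\<in>A. sc (\<kappa> c) \<otimes>\<^bsub>KG\<^esub> r c) x = \<zero>\<^bsub>KG\<^esub> x" by simp
    qed
    hence "(\<Oplus>\<^bsub>M\<^esub>c\<in>A. (sc (\<kappa> c) \<otimes>\<^bsub>KG\<^esub> r c) \<odot>\<^bsub>M\<^esub> v) = \<zero>\<^bsub>M\<^esub>"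
      using M.act_finsum_scalar[OF A(2), of "\<lambda>c. sc (\<kappa> c) \<otimes>\<^bsub>KG\<^esub> r c" v] kr v(1) by simp
    moreover have "(sc (\<kappa> c) \<otimes>\<^bsub>KG\<^esub> r c) \<odot>\<^bsub>M\<^esub> v = sc (\<kappa> c) \<odot>\<^bsub>M\<^esub> w c" if "c \<in> A" for c
    proof -
      have c: "c \<in> carrier K" "\<kappa> c \<in> carrier K" using that AK \<kappa>(1) by auto
      have "sc (\<kappa> c) \<otimes>\<^bsub>KG\<^esub> r c = r c \<otimes>\<^bsub>KG\<^esub> sc (\<kappa> c)" using scalar_central c r by (simp add: sc_def)
      thus ?thesis using M.act_assoc[of "r c" "sc (\<kappa> c)" v] r c scc v by simp
    qed
    hence "(\<Oplus>\<^bsub>M\<^esub>c\<in>A. (sc (\<kappa> c) \<otimes>\<^bsub>KG\<^esub> r c) \<odot>\<^bsub>M\<^esub> v) = (\<Oplus>\<^bsub>M\<^esub>c\<in>A. sc (\<kappa> c) \<odot>\<^bsub>M\<^esub> w c)"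
      using AK \<kappa>(1) scc w by (intro M.M.finsum_cong') (auto intro!: M.act_closed)
    moreover have "\<zero>\<^bsub>KG\<^esub> \<in> Q"
    proof -
      have "\<zero>\<^bsub>KG\<^esub> \<in> carrier KG" "supp \<zero>\<^bsub>KG\<^esub> = {}" by (auto simp: supp_def)
      thus ?thesis by (simp add: Q_def cent_def)
    qed
    ultimately have "\<forall>c\<in>A. \<kappa> c = \<zero>\<^bsub>K\<^esub>"
      using indep[OF A(2) AK \<kappa>(1), of "\<zero>\<^bsub>KG\<^esub>"] v(1) by simp
    thus False using \<kappa>(2) by blast
  qed
qed

end

theorem theorem1p2:
  fixes F :: "('a, 'm) monoid_scheme" and K :: "('k, 'n) ring_scheme" and \<phi> :: "'a \<Rightarrow> 'a"
  assumes "free_group F" and "\<not> comm_group F"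
    and "\<phi> \<in> hom F F" and "inj_on \<phi> (carrier F)"
    and "field K"
  shows "(primitive_ring (group_ring K (ascending_HNN F \<phi>)) \<longleftrightarrow>
            carrier K \<lesssim> carrier F \<or> \<not> virtually (ascending_HNN F \<phi>) (F \<times>\<times> integer_group))
       \<and> (primitive_ring (group_ring K (ascending_HNN F \<phi>)) \<longleftrightarrow>
            carrier K \<lesssim> carrier F \<or> FC_center (ascending_HNN F \<phi>) = {\<one>\<^bsub>ascending_HNN F \<phi>\<^esub>})
       \<and> (\<phi> ` carrier F \<noteq> carrier F \<longrightarrow> primitive_ring (group_ring K (ascending_HNN F \<phi>)))"
proof -
  let ?G = "ascending_HNN F \<phi>"
  have F: "group F" using assms(1) by (simp add: free_group_def)
  obtain \<beta> t \<delta> where ext: "ascending_ext F ?G \<phi> \<beta> t \<delta>"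
    by (rule ascending_HNN_ext[OF F assms(3,4)])
  interpret ascending_ext F ?G \<phi> \<beta> t \<delta> by (rule ext)
  interpret field K by (rule assms(5))
  interpret hnn_algebra F ?G \<phi> \<beta> t \<delta> K
    by (intro hnn_algebra.intro free_ascending_ext.intro free_ascending_ext_axioms.intro
        group_algebra.intro ext assms G.group_axioms)
  \<comment> \<open>Finite index and the FC centre enter the claim only through the existence of a
    nontrivial central element.\<close>
  have virt: "virtually ?G (F \<times>\<times> integer_group) \<longleftrightarrow> (\<exists>z. central ?G z \<and> z \<noteq> \<one>\<^bsub>?G\<^esub>)"
    using virtually_product_if_central central_if_virtually_product by blast
  have fc: "FC_center ?G = {\<one>\<^bsub>?G\<^esub>} \<longleftrightarrow> \<not> (\<exists>z. central ?G z \<and> z \<noteq> \<one>\<^bsub>?G\<^esub>)"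
    using G.central_one by (auto simp: FC_center_eq)
  have "carrier K \<lesssim> carrier F" if prim: "primitive_ring KG" and z: "central ?G z" "z \<noteq> \<one>\<^bsub>?G\<^esub>" for z
  proof (rule primitive_imp_small[OF z(1) _ infinite_F G_lepoll_F prim])
    have zc: "z \<in> carrier ?G" using z by (simp add: central_def)
    have dz: "\<delta> z \<noteq> 0" using central_degree_zero z by blast
    show "inj (\<lambda>n::nat. z [^]\<^bsub>?G\<^esub> n)"
    proof (rule injI)
      fix m n :: nat assume "z [^]\<^bsub>?G\<^esub> m = z [^]\<^bsub>?G\<^esub> n"
      hence "\<delta> (z [^]\<^bsub>?G\<^esub> m) = \<delta> (z [^]\<^bsub>?G\<^esub> n)" by simp
      thus "m = n" using zc dz by simp
    qed
  qed
  hence prim: "primitive_ring KG \<longleftrightarrow>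
      carrier K \<lesssim> carrier F \<or> \<not> (\<exists>z. central ?G z \<and> z \<noteq> \<one>\<^bsub>?G\<^esub>)"
    using primitive_if_centerless primitive_if_small by blast
  moreover have "primitive_ring KG" if "\<phi> ` carrier F \<noteq> carrier F"
    using that central_imp_surj prim by blast
  ultimately show ?thesis by (simp only: virt fc) blast
qed

end
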